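(* Let $A_\Gamma$ be a triangle-free $(2,2)$-free Artin group that is not of spherical type. Let $m\geq 1$ be a uniform exponent for the power alternative for $A_\Gamma$. Let $S$ be a generating set of $A_\Gamma$. Then there exist $s,t\in S$ such that $s^m$ and $t^m$ generate a non-abelian free subgroup of $A_\Gamma$. In particular, $A_\Gamma$ has uniform exponential growth.
   Context: An integer $m\ge1$ is a uniform exponent for the power alternative for a group $G$ if for every $g,h\in G$, either $g^m$ and $h^m$ commute or $\langle g^m,h^m\rangle\cong F_2$. A presentation graph is a finite simplicial graph $\Gamma$ with a label $m_{st}\in\{2,3,\dots\}$ on each edge $\{s,t\}$; the Artin group is $A_\Gamma=\langle \mathrm{Vert}(\Gamma)\mid \underbrace{sts\cdots}_{m_{st}}=\underbrace{tst\cdots}_{m_{st}}\text{ for every edge }\{s,t\}\rangle$. $A_\Gamma$ is triangle-free if $\Gamma$ contains no induced $3$-cycle, and $(2,2)$-free if $\Gamma$ does not contain two adjacent edges both labelled $2$. $A_\Gamma$ is of spherical type if the associated Coxeter group $W_\Gamma$, the quotient of $A_\Gamma$ by the normal closure of $\{s^2:s\in\mathrm{Vert}(\Gamma)\}$, is finite. A finitely generated group has uniform exponential growth if the infimum, over all finite generating sets, of the exponential growth rate is strictly greater than $1$. (Such an exponent $m$ is known for these groups: with $m'_{ab}=m_{ab}/2$ if $m_{ab}$ is even and $2m_{ab}$ if $m_{ab}$ is odd, and $N=\operatorname{lcm}\{m'_{ab}\}$ over the edges $\{a,b\}$ of $\Gamma$, one may take $m=N$ if $N\ge3$ and $m=4$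 if $N=2$.) *)

theory Defs
  imports "HOL-Algebra.Elementary_Groups" "HOL-Library.Extended_Real"
begin

text \<open>
  Words over the letters \<open>X \<union> X\<^sup>-\<^sup>1\<close>: the letter \<open>(x, True)\<close> stands for \<open>x\<close>
  and \<open>(x, False)\<close> for \<open>x\<^sup>-\<^sup>1\<close>.  The group \<open>\<langle>X | R\<rangle>\<close>, whose relations
  are given as pairs \<open>(u, v)\<close> meaning \<open>u = v\<close>, is the quotient of the
  monoid of words by the congruence generated by \<open>R\<close> and by free cancellation.
\<close>

type_synonym 'a gword = "('a \<times> bool) list"

definition gwords :: "'a set \<Rightarrow> 'a gword set" where
  "gwords X = lists (X \<times> UNIV)"

inductive pres_cong :: "'a set \<Rightarrow> ('a gword \<times> 'a gword) set \<Rightarrow> 'a gword \<Rightarrow> 'a gword \<Rightarrow> bool"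
  for X R where
  refl: "w \<in> gwords X \<Longrightarrow> pres_cong X R w w"
| sym: "pres_cong X R v w \<Longrightarrow> pres_cong X R w v"
| trans: "pres_cong X R u v \<Longrightarrow> pres_cong X R v w \<Longrightarrow> pres_cong X R u w"
| append: "pres_cong X R u u' \<Longrightarrow> pres_cong X R v v' \<Longrightarrow> pres_cong X R (u @ v) (u' @ v')"
| cancel: "x \<in> X \<Longrightarrow> pres_cong X R [(x, b), (x, \<not> b)] []"
| relation: "(u, v) \<in> R \<Longrightarrow> u \<in> gwords X \<Longrightarrow> v \<in> gwords X \<Longrightarrow> pres_cong X R u v"

definition pres_class :: "'a set \<Rightarrow> ('a gword \<times> 'a gword) set \<Rightarrow> 'a gword \<Rightarrow> 'a gword set" where
  "pres_class X R w = {v. pres_cong X R w v}"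

definition presented_group :: "'a set \<Rightarrow> ('a gword \<times> 'a gword) set \<Rightarrow> 'a gword set monoid" where
  "presented_group X R =
     \<lparr>carrier = pres_class X R ` gwords X,
      mult = (\<lambda>A B. \<Union>u\<in>A. \<Union>v\<in>B. pres_class X R (u @ v)),
      one = pres_class X R []\<rparr>"

definition free_group :: "'a set \<Rightarrow> 'a gword set monoid" where
  "free_group X = presented_group X {}"

text \<open>
  Taking the basis to be a set of elements of the type underlying \<open>G\<close> is no
  restriction, since a basis of a free group is a subset of the group.
\<close>

definition is_free_group :: "('a, 'b) monoid_scheme \<Rightarrow> bool" where
  "is_free_group G \<longleftrightarrow> (\<exists>X :: 'a set. G \<cong> free_group X)"

definition normal_closure :: "('a, 'b) monoid_scheme \<Rightarrow> 'a set \<Rightarrow> 'a set" where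
  "normal_closure G S = \<Inter>{N. N \<lhd> G \<and> S \<subseteq> N}"

definition generates :: "('a, 'b) monoid_scheme \<Rightarrow> 'a set \<Rightarrow> bool" where
  "generates G S \<longleftrightarrow> S \<subseteq> carrier G \<and> generate G S = carrier G"

definition uniform_power_exponent :: "('a, 'b) monoid_scheme \<Rightarrow> nat \<Rightarrow> bool" where
  "uniform_power_exponent G m \<longleftrightarrow> m \<ge> 1 \<and>
     (\<forall>g\<in>carrier G. \<forall>h\<in>carrier G.
        (g [^]\<^bsub>G\<^esub> m) \<otimes>\<^bsub>G\<^esub> (h [^]\<^bsub>G\<^esub> m) = (h [^]\<^bsub>G\<^esub> m) \<otimes>\<^bsub>G\<^esub> (g [^]\<^bsub>G\<^esub> m) \<or>
        subgroup_generated G {g [^]\<^bsub>G\<^esub> m, h [^]\<^bsub>G\<^esub> m} \<cong> free_group (UNIV :: bool set))"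

definition word_ball :: "('a, 'b) monoid_scheme \<Rightarrow> 'a set \<Rightarrow> nat \<Rightarrow> 'a set" where
  "word_ball G S n =
     (\<lambda>ws. foldr (\<otimes>\<^bsub>G\<^esub>) ws \<one>\<^bsub>G\<^esub>) ` {ws \<in> lists (S \<union> m_inv G ` S). length ws \<le> n}"

text \<open>
  The upper limit is in fact a limit, because the cardinalities of the balls are
  submultiplicative in the radius.
\<close>

definition exp_growth_rate :: "('a, 'b) monoid_scheme \<Rightarrow> 'a set \<Rightarrow> ereal" where
  "exp_growth_rate G S = limsup (\<lambda>n. ereal (root n (real (card (word_ball G S n)))))"

definition uniform_exponential_growth :: "('a, 'b) monoid_scheme \<Rightarrow> bool" where
  "uniform_exponential_growth G \<longleftrightarrow>
     (\<exists>S. finite S \<and> generates G S) \<and>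
     1 < (INF S\<in>{S. finite S \<and> generates G S}. exp_growth_rate G S)"

text \<open>Only the values of \<open>lab\<close> on the edges, i.e. on members of \<open>E\<close>, are meaningful.\<close>

definition presentation_graph :: "'v set \<Rightarrow> 'v set set \<Rightarrow> ('v set \<Rightarrow> nat) \<Rightarrow> bool" where
  "presentation_graph V E lab \<longleftrightarrow>
     finite V \<and> (\<forall>e\<in>E. e \<subseteq> V \<and> card e = 2 \<and> lab e \<ge> 2)"

text \<open>In a simplicial graph every 3-cycle is induced.\<close>

definition triangle_free :: "'v set set \<Rightarrow> bool" where
  "triangle_free E \<longleftrightarrow>
     \<not> (\<exists>a b c. distinct [a, b, c] \<and> {a, b} \<in> E \<and> {b, c} \<in> E \<and> {a, c} \<in> E)"

definition two_two_free :: "'v set set \<Rightarrow> ('v set \<Rightarrow> nat) \<Rightarrow> bool" where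
  "two_two_free E lab \<longleftrightarrow>
     \<not> (\<exists>e\<in>E. \<exists>e'\<in>E. e \<noteq> e' \<and> e \<inter> e' \<noteq> {} \<and> lab e = 2 \<and> lab e' = 2)"

definition alternating_word :: "'v \<Rightarrow> 'v \<Rightarrow> nat \<Rightarrow> 'v gword" where
  "alternating_word s t k = map (\<lambda>i. (if even i then s else t, True)) [0..<k]"

definition artin_relations :: "'v set set \<Rightarrow> ('v set \<Rightarrow> nat) \<Rightarrow> ('v gword \<times> 'v gword) set" where
  "artin_relations E lab =
     {(alternating_word s t (lab {s, t}), alternating_word t s (lab {s, t})) | s t. {s, t} \<in> E}"

definition artin_group :: "'v set \<Rightarrow> 'v set set \<Rightarrow> ('v set \<Rightarrow> nat) \<Rightarrow> 'v gword set monoid" where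
  "artin_group V E lab = presented_group V (artin_relations E lab)"

definition artin_gen :: "'v set \<Rightarrow> 'v set set \<Rightarrow> ('v set \<Rightarrow> nat) \<Rightarrow> 'v \<Rightarrow> 'v gword set" where
  "artin_gen V E lab s = pres_class V (artin_relations E lab) [(s, True)]"

definition coxeter_group :: "'v set \<Rightarrow> 'v set set \<Rightarrow> ('v set \<Rightarrow> nat) \<Rightarrow> 'v gword set set monoid" where
  "coxeter_group V E lab =
     artin_group V E lab Mod
       normal_closure (artin_group V E lab)
         {artin_gen V E lab s [^]\<^bsub>artin_group V E lab\<^esub> (2 :: nat) | s. s \<in> V}"

definition spherical_type :: "'v set \<Rightarrow> 'v set set \<Rightarrow> ('v set \<Rightarrow> nat) \<Rightarrow> bool" where
  "spherical_type V E lab \<longleftrightarrow> finite (carrier (coxeter_group V E lab))"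

lemma pres_cong_gwords: "pres_cong X R u v \<Longrightarrow> u \<in> gwords X \<and> v \<in> gwords X"
  by (induction rule: pres_cong.induct) (auto simp: gwords_def)

lemma pres_class_eq_iff:
  assumes "u \<in> gwords X"
  shows "pres_class X R u = pres_class X R v \<longleftrightarrow> pres_cong X R u v"
  using assms unfolding pres_class_def
  by (auto simp: set_eq_iff intro: pres_cong.intros)

lemma presented_group_mult:
  assumes "u \<in> gwords X" "v \<in> gwords X"
  shows "pres_class X R u \<otimes>\<^bsub>presented_group X R\<^esub> pres_class X R v = pres_class X R (u @ v)"
proof -
  have "pres_cong X R (u @ v) w \<longleftrightarrow>
      (\<exists>u' v'. pres_cong X R u u' \<and> pres_cong X R v v' \<and> pres_cong X R (u' @ v') w)" for w
    using assms by (meson pres_cong.refl pres_cong.append pres_cong.trans pres_cong.sym)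
  then show ?thesis
    unfolding presented_group_def by (auto simp: pres_class_def)
qed

lemma presented_group_left_inverse:
  assumes "w \<in> gwords X"
  shows "\<exists>v\<in>gwords X. pres_cong X R (v @ w) []"
  using assms
proof (induction w)
  case Nil
  then show ?case by (auto simp: gwords_def intro!: bexI[of _ "[]"] pres_cong.refl)
next
  case (Cons a w)
  obtain x b where a: "a = (x, b)" by force
  with Cons.prems have x: "x \<in> X" and w: "w \<in> gwords X" by (auto simp: gwords_def)
  from Cons.IH[OF w] obtain v where v: "v \<in> gwords X" "pres_cong X R (v @ w) []" by blast
  have "pres_cong X R ([(x, \<not> b), (x, b)] @ w) ([] @ w)"
    using pres_cong.cancel[OF x, of R "\<not> b"] w by (intro pres_cong.append pres_cong.refl) auto
  then have "pres_cong X R (v @ [(x, \<not> b), (x, b)] @ w) (v @ w)"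
    using v(1) by (auto intro: pres_cong.append pres_cong.refl)
  then have "pres_cong X R ((v @ [(x, \<not> b)]) @ a # w) []"
    using v(2) a by (auto intro: pres_cong.trans)
  moreover have "v @ [(x, \<not> b)] \<in> gwords X" using v x by (auto simp: gwords_def)
  ultimately show ?case by blast
qed

lemma group_presented_group: "group (presented_group X R)"
proof (rule groupI)
  let ?G = "presented_group X R"
  have car: "carrier ?G = pres_class X R ` gwords X" and one: "\<one>\<^bsub>?G\<^esub> = pres_class X R []"
    by (simp_all add: presented_group_def)
  have app: "u @ v \<in> gwords X" if "u \<in> gwords X" "v \<in> gwords X" for u v
    using that by (auto simp: gwords_def)
  have nil: "[] \<in> gwords X" by (simp add: gwords_def)
  show "x \<otimes>\<^bsub>?G\<^esub> y \<in> carrier ?G" if "x \<in> carrier ?G" "y \<in> carrier ?G" for x y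
    using that by (auto simp: car presented_group_mult app)
  show "\<one>\<^bsub>?G\<^esub> \<in> carrier ?G" by (auto simp: car one nil)
  show "x \<otimes>\<^bsub>?G\<^esub> y \<otimes>\<^bsub>?G\<^esub> z = x \<otimes>\<^bsub>?G\<^esub> (y \<otimes>\<^bsub>?G\<^esub> z)"
    if "x \<in> carrier ?G" "y \<in> carrier ?G" "z \<in> carrier ?G" for x y z
    using that by (auto simp: car presented_group_mult app)
  show "\<one>\<^bsub>?G\<^esub> \<otimes>\<^bsub>?G\<^esub> x = x" if "x \<in> carrier ?G" for x
    using that by (auto simp: car one presented_group_mult nil)
  show "\<exists>y\<in>carrier ?G. y \<otimes>\<^bsub>?G\<^esub> x = \<one>\<^bsub>?G\<^esub>" if x: "x \<in> carrier ?G" for x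
  proof -
    obtain w where w: "w \<in> gwords X" "x = pres_class X R w" using x car by auto
    obtain v where "v \<in> gwords X" "pres_cong X R (v @ w) []"
      using presented_group_left_inverse[OF w(1)] by blast
    then show ?thesis
      using w by (intro bexI[of _ "pres_class X R v"])
        (auto simp: car one presented_group_mult pres_class_eq_iff app)
  qed
qed

lemma group_artin_group: "group (artin_group V E lab)"
  unfolding artin_group_def by (rule group_presented_group)

end

theory Submission
  imports Defs "HOL-Algebra.Left_Coset" "HOL-Algebra.Bij" "HOL-Computational_Algebra.Polynomial"
begin

text \<open>
  If every two vertices are adjacent, then triangle-freeness leaves at most two vertices and the
  Coxeter group is finite; so there are non-adjacent vertices \<open>a\<close> and \<open>c\<close>.  Splitting the Artin group
  over the free group on the neighbours of \<open>a\<close> gives an amalgamated product whose edge groups are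
  isolated: \<open>g\<^sup>n \<in> C\<close> implies \<open>g \<in> C\<close>.  Isolation of all standard parabolic subgroups follows by
  induction on the number of vertices from the case of a star, which is an amalgam of dihedral
  groups over the cyclic group of its central vertex; at most one edge there has label 2, and the
  other ones force the free subgroup on the leaves to be isolated.

  Let \<open>S\<close> be a generating set in which the \<open>m\<close>-th powers commute pairwise.  In the action on the
  Bass--Serre tree, isolation forces the whole group to fix a vertex or an end, and in the latter
  case the standard generators, being elliptic, fix a common edge.  Both contradict the
  non-triviality of the splitting.  So some \<open>s\<^sup>m\<close> and \<open>t\<^sup>m\<close> do not commute and generate a free group of
  rank two; being a generating pair, they satisfy no positive relation, which bounds the growth
  rate from below in terms of \<open>m\<close> alone.

  All this takes place in a quotient of the Artin group, in which each dihedral Artin group is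
  replaced by its image in \<open>SL\<^sub>2(\<real>[x]) \<times> \<int>\<close>.
\<close>

no_notation (ASCII) subset_mset (infix "<#" 50)

subsection \<open>Conjugation, isolated subgroups and words in two subgroups\<close>

context group
begin

lemma inv_mult_cancel_left [simp]:
  "x \<in> carrier G \<Longrightarrow> y \<in> carrier G \<Longrightarrow> inv x \<otimes> (x \<otimes> y) = y"
  by (simp add: m_assoc [symmetric])

lemma mult_inv_cancel_left [simp]:
  "x \<in> carrier G \<Longrightarrow> y \<in> carrier G \<Longrightarrow> x \<otimes> (inv x \<otimes> y) = y"
  by (simp add: m_assoc [symmetric])

lemma commute_inv:
  assumes "x \<in> carrier G" "y \<in> carrier G" "x \<otimes> y = y \<otimes> x"
  shows "inv x \<otimes> y = y \<otimes> inv x"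
  using assms by (metis inv_closed inv_solve_left' inv_solve_right m_assoc m_closed)

lemma pow_commute_self: "x \<in> carrier G \<Longrightarrow> x \<otimes> x [^] (n::nat) = x [^] n \<otimes> x"
  by (metis nat_pow_Suc nat_pow_Suc2)

lemma commute_int_pow:
  assumes "x \<in> carrier G" "y \<in> carrier G" "x \<otimes> y = y \<otimes> x"
  shows "x [^] (k::int) \<otimes> y = y \<otimes> x [^] k"
proof (cases k rule: int_cases2)
  case (nonneg n)
  then show ?thesis using group_commutes_pow[OF assms(3,1,2)] by (simp add: int_pow_int)
next
  case (nonpos n)
  then show ?thesis
    using commute_inv[OF _ assms(2) group_commutes_pow[OF assms(3,1,2), of n]] assms(1)
    by (simp add: int_pow_neg_int)
qed

lemma mult_int_pow_neg_pow_eq_one: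
  assumes carrier: "g \<in> carrier G" "b \<in> carrier G"
    and commute: "g \<otimes> b [^] (- e :: int) = b [^] (- e) \<otimes> g"
      and pow: "g [^] (n::nat) = b [^] (int n * e)"
  shows "(g \<otimes> b [^] (- e)) [^] n = \<one>"
proof -
  have "(g \<otimes> b [^] (- e)) [^] n = g [^] n \<otimes> (b [^] (- e)) [^] n"
    using carrier by (intro pow_mult_distrib[OF commute]) simp_all
  also have "(b [^] (- e)) [^] n = b [^] (- (int n * e))"
    using int_pow_pow[OF carrier(2), of "- e" "int n"] by (simp add: int_pow_int mult.commute)
  also have "g [^] n \<otimes> \<dots> = \<one>" using carrier pow by (simp flip: int_pow_mult)
  finally show ?thesis .
qed

lemma subgroup_mult_left_iff:
  assumes "subgroup H G" "h \<in> H" "x \<in> carrier G"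
  shows "h \<otimes> x \<in> H \<longleftrightarrow> x \<in> H"
  using assms by (metis inv_mult_cancel_left subgroup.m_closed subgroup.m_inv_closed
    subgroup.mem_carrier)

lemma subgroup_mult_right_iff:
  assumes "subgroup H G" "h \<in> H" "x \<in> carrier G"
  shows "x \<otimes> h \<in> H \<longleftrightarrow> x \<in> H"
  using assms by (metis inv_solve_right m_closed subgroup.m_closed subgroup.m_inv_closed
    subgroup.mem_carrier)

lemma subgroup_inv_iff:
  assumes "subgroup H G" "x \<in> carrier G"
  shows "inv x \<in> H \<longleftrightarrow> x \<in> H"
  using assms by (metis inv_inv subgroup.m_inv_closed)

lemma subgroup_nat_pow_closed:
  assumes "subgroup H G" "x \<in> H"
  shows "x [^] (n::nat) \<in> H"
  by (induction n) (use assms in \<open>auto simp: subgroup.one_closed subgroup.m_closed\<close>)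

lemma inv_lcoset_eq:
  assumes "g \<in> carrier G" "A \<subseteq> carrier G" "g <# A = B"
  shows "inv g <# B = A"
  using lcos_m_assoc[OF assms(2), of "inv g" g] assms lcos_mult_one[OF assms(2)] by auto

lemma lcoset_eqI:
  assumes "subgroup H G" "y \<in> carrier G" "h \<in> H"
  shows "(y \<otimes> h) <# H = y <# H"
  using assms lcos_m_assoc[of H y h] coset_join3[of h H] subgroup.subset[OF assms(1)]
  by (simp add: subgroup.mem_carrier)

lemma lcoset_eqD:
  assumes "subgroup H G" "x \<in> carrier G" "x <# H = y <# H"
  obtains h where "h \<in> H" "x = y \<otimes> h"
  using lcos_self[OF assms(2,1)] assms(3) that by (auto simp: l_coset_def)

lemma subgroup_stabilizer_lcoset:
  assumes "A \<subseteq> carrier G"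
  shows "subgroup {g \<in> carrier G. g <# A = A} G"
proof (rule subgroupI)
  show "{g \<in> carrier G. g <# A = A} \<noteq> {}"
    using lcos_mult_one[OF assms] by blast
qed (use inv_lcoset_eq[OF _ assms] in \<open>auto simp flip: lcos_m_assoc[OF assms]\<close>)

definition conj_by :: "'a \<Rightarrow> 'a \<Rightarrow> 'a" where
  "conj_by h g = inv h \<otimes> g \<otimes> h"

lemma conj_by_closed [simp]:
  "h \<in> carrier G \<Longrightarrow> g \<in> carrier G \<Longrightarrow> conj_by h g \<in> carrier G"
  by (simp add: conj_by_def)

lemma conj_by_mult:
  assumes "h \<in> carrier G" "a \<in> carrier G" "b \<in> carrier G"
  shows "conj_by h (a \<otimes> b) = conj_by h a \<otimes> conj_by h b"
  using assms by (simp add: conj_by_def m_assoc)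

lemma group_hom_conj_by: "h \<in> carrier G \<Longrightarrow> group_hom G G (conj_by h)"
  by unfold_locales (auto simp: hom_def conj_by_mult)

lemma conj_by_pow:
  "h \<in> carrier G \<Longrightarrow> a \<in> carrier G \<Longrightarrow> conj_by h (a [^] (n::nat)) = conj_by h a [^] n"
  by (rule group_hom.hom_nat_pow[OF group_hom_conj_by])

lemma conj_by_conj_by:
  assumes "h \<in> carrier G" "k \<in> carrier G" "a \<in> carrier G"
  shows "conj_by h (conj_by k a) = conj_by (k \<otimes> h) a"
  using assms by (simp add: conj_by_def m_assoc inv_mult_group)

lemma conj_by_one [simp]: "a \<in> carrier G \<Longrightarrow> conj_by \<one> a = a"
  by (simp add: conj_by_def)

lemma conj_by_inv_cancel [simp]:
  assumes "h \<in> carrier G" "a \<in> carrier G"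
  shows "conj_by (inv h) (conj_by h a) = a" "conj_by h (conj_by (inv h) a) = a"
  using assms by (simp_all add: conj_by_conj_by)

lemma conj_by_eq_one_iff:
  assumes "h \<in> carrier G" "a \<in> carrier G"
  shows "conj_by h a = \<one> \<longleftrightarrow> a = \<one>"
  using assms conj_by_inv_cancel(1)[OF assms] by (auto simp: conj_by_def)

lemma conj_by_mem_subgroup:
  assumes "subgroup H G" "h \<in> H" "a \<in> H"
  shows "conj_by h a \<in> H"
  using assms by (simp add: conj_by_def subgroup.m_closed subgroup.m_inv_closed)

lemma conj_by_mem_subgroup_iff:
  assumes "subgroup H G" "h \<in> H" "a \<in> carrier G"
  shows "conj_by h a \<in> H \<longleftrightarrow> a \<in> H"
  using assms conj_by_mem_subgroup[of H h a] conj_by_mem_subgroup[of H "inv h" "conj_by h a"]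
  by (auto simp: subgroup.m_inv_closed subgroup.mem_carrier[OF assms(1)])

lemma conj_by_commute_pow:
  assumes "h \<in> carrier G" "a \<in> carrier G" "b \<in> carrier G"
    and "a [^] (m::nat) \<otimes> b [^] m = b [^] m \<otimes> a [^] m"
  shows "conj_by h a [^] m \<otimes> conj_by h b [^] m = conj_by h b [^] m \<otimes> conj_by h a [^] m"
  using assms by (simp flip: conj_by_pow conj_by_mult)

lemma generating_set_conj_by_subset_imp_eq_carrier:
  assumes H: "subgroup H G" and h: "h \<in> carrier G"
    and S: "S \<subseteq> carrier G" "generate G S = carrier G" and conj: "\<And>s. s \<in> S \<Longrightarrow> conj_by h s \<in> H"
  shows "H = carrier G"
proof
  interpret c: group_hom G G "conj_by h" using h by (rule group_hom_conj_by)
  have "conj_by h ` carrier G \<subseteq> H"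
    using c.generate_img[OF S(1)] generate_subgroup_incl[OF _ H, of "conj_by h ` S"] conj S(2) by auto
  then have "conj_by h (conj_by (inv h) g) \<in> H" if "g \<in> carrier G" for g
    using h that by (meson conj_by_closed image_subset_iff inv_closed)
  then show "carrier G \<subseteq> H" using h by auto
qed (rule subgroup.subset[OF H])

definition isolated_in :: "'a set \<Rightarrow> 'a set \<Rightarrow> bool" where
  "isolated_in K H \<longleftrightarrow> (\<forall>g\<in>K. \<forall>n::nat. n \<ge> 1 \<longrightarrow> g [^] n \<in> H \<longrightarrow> g \<in> H)"

lemma isolated_inI:
  "(\<And>g n. g \<in> K \<Longrightarrow> n \<ge> 1 \<Longrightarrow> g [^] (n::nat) \<in> H \<Longrightarrow> g \<in> H) \<Longrightarrow> isolated_in K H"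
  by (auto simp: isolated_in_def)

lemma isolated_inD:
  "isolated_in K H \<Longrightarrow> g \<in> K \<Longrightarrow> g [^] (n::nat) \<in> H \<Longrightarrow> n \<ge> 1 \<Longrightarrow> g \<in> H"
  by (auto simp: isolated_in_def)

text \<open>
  For the cyclic groups on the two generators of a dihedral Artin group this holds unless the label
  is 2, which is where (2,2)-freeness enters.
\<close>

definition separated :: "'a set \<Rightarrow> 'a set \<Rightarrow> bool" where
  "separated Z B \<longleftrightarrow>
     (\<forall>z\<in>Z. \<forall>z'\<in>Z. \<forall>b\<in>B. b \<noteq> \<one> \<longrightarrow> z \<otimes> b \<otimes> z' \<in> B \<longrightarrow> z = \<one>)"

lemma separatedD:
  "separated Z B \<Longrightarrow> z \<in> Z \<Longrightarrow> z' \<in> Z \<Longrightarrow> b \<in> B \<Longrightarrow> b \<noteq> \<one> \<Longrightarrow> z \<otimes> b \<otimes> z' \<in> B \<Longrightarrow> z = \<one>"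
  by (auto simp: separated_def)

definition word_prod :: "(bool \<times> 'a) list \<Rightarrow> 'a" where
  "word_prod xs = foldr (\<lambda>x y. snd x \<otimes> y) xs \<one>"

lemma word_prod_Nil [simp]: "word_prod [] = \<one>"
  and word_prod_Cons [simp]: "word_prod (x # xs) = snd x \<otimes> word_prod xs"
  by (simp_all add: word_prod_def)

lemma word_prod_closed [simp]: "snd ` set xs \<subseteq> carrier G \<Longrightarrow> word_prod xs \<in> carrier G"
  by (induction xs) auto

lemma word_prod_append:
  "snd ` set xs \<subseteq> carrier G \<Longrightarrow> snd ` set ys \<subseteq> carrier G \<Longrightarrow>
    word_prod (xs @ ys) = word_prod xs \<otimes> word_prod ys"
  by (induction xs) (auto simp: m_assoc)

definition word_inv :: "(bool \<times> 'a) list \<Rightarrow> (bool \<times> 'a) list" where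
  "word_inv xs = rev (map (\<lambda>(i, x). (i, inv x)) xs)"

lemma word_inv_Nil [simp]: "word_inv [] = []"
  and word_inv_Cons: "word_inv (x # xs) = word_inv xs @ [(fst x, inv (snd x))]"
  and length_word_inv [simp]: "length (word_inv xs) = length xs"
  and word_inv_eq_Nil_iff [simp]: "word_inv xs = [] \<longleftrightarrow> xs = []"
  by (auto simp: word_inv_def case_prod_unfold)

lemma hd_word_inv: "xs \<noteq> [] \<Longrightarrow> fst (hd (word_inv xs)) = fst (last xs)"
  and last_word_inv: "xs \<noteq> [] \<Longrightarrow> fst (last (word_inv xs)) = fst (hd xs)"
  by (auto simp: word_inv_def hd_rev last_rev last_map hd_map case_prod_unfold)

lemma word_inv_carrier: "snd ` set xs \<subseteq> carrier G \<Longrightarrow> snd ` set (word_inv xs) \<subseteq> carrier G"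
  by (auto simp: word_inv_def)

lemma word_prod_word_inv:
  "snd ` set xs \<subseteq> carrier G \<Longrightarrow> word_prod (word_inv xs) = inv (word_prod xs)"
  by (induction xs) (auto simp: word_inv_Cons word_prod_append word_inv_carrier inv_mult_group)

definition reduced :: "(bool \<Rightarrow> 'a set) \<Rightarrow> 'a set \<Rightarrow> (bool \<times> 'a) list \<Rightarrow> bool" where
  "reduced P C xs \<longleftrightarrow>
     (\<forall>x\<in>set xs. snd x \<in> P (fst x) - C) \<and> successively (\<lambda>x y. fst x \<noteq> fst y) xs"

lemma reduced_Nil [simp]: "reduced P C []"
  by (simp add: reduced_def)

lemma reduced_Cons:
  "reduced P C (x # xs) \<longleftrightarrow>
     snd x \<in> P (fst x) \<and> snd x \<notin> C \<and> reduced P C xs \<and> (xs \<noteq> [] \<longrightarrow> fst x \<noteq> fst (hd xs))"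
  by (auto simp: reduced_def successively_Cons)

lemma reduced_append:
  "reduced P C (xs @ ys) \<longleftrightarrow> reduced P C xs \<and> reduced P C ys \<and>
     (xs \<noteq> [] \<longrightarrow> ys \<noteq> [] \<longrightarrow> fst (last xs) \<noteq> fst (hd ys))"
  by (auto simp: reduced_def successively_append_iff)

lemma reduced_take: "reduced P C xs \<Longrightarrow> reduced P C (take k xs)"
  and reduced_drop: "reduced P C xs \<Longrightarrow> reduced P C (drop k xs)"
  using reduced_append[of P C "take k xs" "drop k xs"] by simp_all

lemma reduced_carrier:
  assumes "\<And>i. P i \<subseteq> carrier G" "reduced P C xs"
  shows "snd ` set xs \<subseteq> carrier G"
  using assms by (force simp: reduced_def)

lemma reduced_word_inv:
  assumes "\<And>i. subgroup (P i) G" "subgroup C G" "reduced P C xs"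
  shows "reduced P C (word_inv xs)"
  using assms(3)
proof (induction xs)
  case (Cons x xs)
  have "snd x \<in> P (fst x)" "snd x \<notin> C" "snd x \<in> carrier G"
    using Cons.prems subgroup.mem_carrier[OF assms(1)] by (auto simp: reduced_Cons)
  then show ?case
    using Cons assms(1) subgroup_inv_iff[OF assms(2), of "snd x"]
    by (auto simp: word_inv_Cons reduced_append reduced_Cons last_word_inv subgroup.m_inv_closed)
qed simp

definition represents :: "(bool \<Rightarrow> 'a set) \<Rightarrow> 'a set \<Rightarrow> (bool \<times> 'a) list \<Rightarrow> 'a \<Rightarrow> bool" where
  "represents P C xs g \<longleftrightarrow> reduced P C xs \<and> (\<exists>c\<in>C. g = word_prod xs \<otimes> c)"

lemma representsI: "reduced P C xs \<Longrightarrow> c \<in> C \<Longrightarrow> g = word_prod xs \<otimes> c \<Longrightarrow> represents P C xs g"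
  by (auto simp: represents_def)

lemma representsE:
  assumes "represents P C xs g"
  obtains c where "reduced P C xs" "c \<in> C" "g = word_prod xs \<otimes> c"
  using assms by (auto simp: represents_def)

end

locale two_subgroups = group G for G (structure) +
  fixes P :: "bool \<Rightarrow> 'a set" and C :: "'a set"
  assumes P_subgroup: "\<And>i. subgroup (P i) G"
    and C_subgroup: "subgroup C G"
    and C_subset_P: "\<And>i. C \<subseteq> P i"
begin

abbreviation red :: "(bool \<times> 'a) list \<Rightarrow> bool" where "red \<equiv> reduced P C"

lemma P_carrier [simp]: "x \<in> P i \<Longrightarrow> x \<in> carrier G"
  using P_subgroup by (rule subgroup.mem_carrier)

lemma C_carrier [simp]: "x \<in> C \<Longrightarrow> x \<in> carrier G"
  using C_subgroup by (rule subgroup.mem_carrier)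

lemma C_subset: "C \<subseteq> carrier G"
  by auto

lemma C_mem_P: "x \<in> C \<Longrightarrow> x \<in> P i"
  using C_subset_P by blast

lemmas P_mult [intro] = subgroup.m_closed[OF P_subgroup]
  and P_inv [intro] = subgroup.m_inv_closed[OF P_subgroup]
  and P_one [intro] = subgroup.one_closed[OF P_subgroup]
  and P_pow [intro] = subgroup_nat_pow_closed[OF P_subgroup]
  and C_mult [simp, intro] = subgroup.m_closed[OF C_subgroup]
  and C_inv [simp, intro] = subgroup.m_inv_closed[OF C_subgroup]
  and C_one [simp, intro] = subgroup.one_closed[OF C_subgroup]
  and C_pow [simp, intro] = subgroup_nat_pow_closed[OF C_subgroup]
  and C_inv_iff [simp] = subgroup_inv_iff[OF C_subgroup]
  and C_mult_left_iff [simp] = subgroup_mult_left_iff[OF C_subgroup]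
  and C_mult_right_iff [simp] = subgroup_mult_right_iff[OF C_subgroup]
  and C_coset_eqI = lcoset_eqI[OF C_subgroup]
  and C_coset_eqD = lcoset_eqD[OF C_subgroup]

lemma red_carrier: "red xs \<Longrightarrow> snd ` set xs \<subseteq> carrier G"
  using reduced_carrier P_subgroup by (metis subgroup.subset)

lemma word_prod_red [simp]: "red xs \<Longrightarrow> word_prod xs \<in> carrier G"
  using red_carrier word_prod_closed by blast

lemma word_prod_red_append:
  "red xs \<Longrightarrow> red ys \<Longrightarrow> word_prod (xs @ ys) = word_prod xs \<otimes> word_prod ys"
  using red_carrier word_prod_append by blast

lemma red_word_inv: "red xs \<Longrightarrow> red (word_inv xs)"
  using reduced_word_inv P_subgroup C_subgroup by blast

lemma word_prod_red_word_inv: "red xs \<Longrightarrow> word_prod (word_inv xs) = inv (word_prod xs)"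
  using word_prod_word_inv red_carrier by blast

lemma red_snoc:
  assumes "red (xs @ [(i, x)])"
  shows "red xs" "x \<in> P i" "x \<notin> C" "xs \<noteq> [] \<Longrightarrow> fst (last xs) \<noteq> i"
    "word_prod (xs @ [(i, x)]) = word_prod xs \<otimes> x"
  using assms word_prod_red_append[of xs "[(i, x)]"] by (auto simp: reduced_append reduced_Cons)

lemma red_absorb_left:
  assumes "red ((i, x) # xs)" "c \<in> C"
  shows "red ((i, c \<otimes> x) # xs)" "word_prod ((i, c \<otimes> x) # xs) = c \<otimes> word_prod ((i, x) # xs)"
  using assms P_mult[OF C_mem_P[OF assms(2)], of x i] by (auto simp: reduced_Cons m_assoc)

lemma red_absorb_right:
  assumes "red (xs @ [(i, x)])" "c \<in> C"
  shows "red (xs @ [(i, x \<otimes> c)])" "word_prod (xs @ [(i, x \<otimes> c)]) = word_prod (xs @ [(i, x)]) \<otimes> c"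
proof -
  have syllables: "red xs" "red [(i, x)]" "red [(i, x \<otimes> c)]" "x \<in> carrier G"
    using assms P_mult[OF _ C_mem_P[OF assms(2)], of x i] by (auto simp: reduced_Cons reduced_append)
  then show "red (xs @ [(i, x \<otimes> c)])" using assms by (auto simp: reduced_append)
  show "word_prod (xs @ [(i, x \<otimes> c)]) = word_prod (xs @ [(i, x)]) \<otimes> c"
    using syllables assms(2) by (simp add: word_prod_red_append m_assoc)
qed

lemma represents_C_mult:
  assumes "represents P C xs g" "c \<in> C"
  obtains ys where "represents P C ys (c \<otimes> g)" "length ys = length xs"
proof -
  obtain d where d: "red xs" "d \<in> C" "g = word_prod xs \<otimes> d" using assms(1) by (rule representsE)
  show ?thesis
  proof (cases xs)
    case Nil
    then have "represents P C [] (c \<otimes> g)" using assms d by (intro representsI[of _ _ _ "c \<otimes> d"]) auto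
    then show ?thesis using that Nil by blast
  next
    case (Cons a xs')
    then obtain i x where xs: "xs = (i, x) # xs'" by (cases a) auto
    have "represents P C ((i, c \<otimes> x) # xs') (c \<otimes> g)"
      using red_absorb_left[of i x xs' c] d xs assms
      by (intro representsI[OF _ d(2)]) (auto simp: m_assoc reduced_Cons)
    then show ?thesis using that xs by simp
  qed
qed

lemma represents_P_mult:
  assumes "represents P C xs g" "p \<in> P i"
  obtains ys where "represents P C ys (p \<otimes> g)" "length ys \<le> Suc (length xs)"
proof -
  obtain c where c: "red xs" "c \<in> C" "g = word_prod xs \<otimes> c" using assms(1) by (rule representsE)
  show ?thesis
  proof (cases "p \<in> C")
    case True
    then show ?thesis using represents_C_mult[OF assms(1)] that by (metis le_SucI le_refl)
  next
    case p: False
    show ?thesis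
    proof (cases "xs \<noteq> [] \<and> fst (hd xs) = i")
      case False
      then have "represents P C ((i, p) # xs) (p \<otimes> g)"
        using c p assms(2) by (intro representsI[OF _ c(2)]) (auto simp: reduced_Cons m_assoc)
      then show ?thesis using that by force
    next
      case True
      then obtain y xs' where xs: "xs = (i, y) # xs'" by (cases xs) auto
      then have y: "y \<in> P i" "red xs'" "xs' \<noteq> [] \<Longrightarrow> i \<noteq> fst (hd xs')"
        using c(1) by (auto simp: reduced_Cons)
      have product: "p \<otimes> g = (p \<otimes> y) \<otimes> (word_prod xs' \<otimes> c)"
        using c xs y assms(2) by (simp add: m_assoc P_carrier[OF y(1)] P_carrier[OF assms(2)])
      show ?thesis
      proof (cases "p \<otimes> y \<in> C")
        case True
        have "represents P C xs' (word_prod xs' \<otimes> c)" using y c by (intro representsI) auto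
        then show ?thesis
          using represents_C_mult[OF _ True] that xs product by (metis le_SucI le_refl length_Cons)
      next
        case False
        then have "represents P C ((i, p \<otimes> y) # xs') (p \<otimes> g)"
          using y assms(2) c product by (intro representsI[OF _ c(2)]) (auto simp: reduced_Cons m_assoc)
        then show ?thesis using that xs by force
      qed
    qed
  qed
qed

lemma represents_exists:
  assumes "g \<in> generate G (P True \<union> P False)"
  obtains xs where "represents P C xs g"
proof -
  have P_carrier_subset: "P True \<union> P False \<subseteq> carrier G" by auto
  have "\<exists>ys. represents P C ys (g \<otimes> u)" if "represents P C xs u" "u \<in> carrier G" for u xs
    using assms that
  proof (induction g arbitrary: u xs rule: generate.induct)
    case one
    then show ?case by auto
  next
    case (incl h)
    then show ?case using represents_P_mult by (metis Un_iff)
  next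
    case (inv h)
    then show ?case using represents_P_mult P_inv by (metis Un_iff)
  next
    case (eng h1 h2)
    have carrier: "h1 \<in> carrier G" "h2 \<in> carrier G"
      using generate_in_carrier[OF P_carrier_subset] eng(1,2) by simp_all
    obtain ys where "represents P C ys (h2 \<otimes> u)" using eng.IH(2)[OF eng.prems] by blast
    then show ?case using eng.IH(1)[of ys "h2 \<otimes> u"] carrier eng.prems by (simp add: m_assoc)
  qed
  moreover have "represents P C [] \<one>" by (rule representsI[of _ _ _ \<one>]) auto
  moreover have "g \<in> carrier G" using generate_in_carrier[OF P_carrier_subset assms] .
  ultimately show ?thesis using that by (metis one_closed r_one)
qed

text \<open>The word may get shorter by two syllables, when the outer ones cancel into \<open>C\<close>.\<close>

lemma red_cyclic_reduction:
  assumes "red xs" "length xs \<ge> 2" "fst (hd xs) = fst (last xs)"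
  obtains ys where "red ys" "ys \<noteq> []" "length ys < length xs"
    "conj_by (snd (hd xs)) (word_prod xs) = word_prod ys"
proof -
  obtain i x zs where xs: "xs = (i, x) # zs" using assms(2) by (cases xs) auto
  then have "zs \<noteq> []" using assms(2) by auto
  then obtain mid j y where "zs = mid @ [(j, y)]" by (metis append_butlast_last_id surj_pair)
  then have xs: "xs = (i, x) # mid @ [(i, y)]" using assms(3) xs by simp
  have "red (mid @ [(i, y)])" and x: "x \<in> P i" using assms(1) xs by (auto simp: reduced_Cons)
  note y = red_snoc[OF this(1)]
  have "mid \<noteq> []" using assms(1) xs by (auto simp: reduced_Cons)
  have conj: "conj_by x (word_prod xs) = word_prod mid \<otimes> (y \<otimes> x)"
    using xs y x by (simp add: conj_by_def m_assoc P_carrier[OF x] P_carrier[OF y(2)])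
  show ?thesis
  proof (cases "y \<otimes> x \<in> C")
    case True
    obtain ys j z where mid: "mid = ys @ [(j, z)]"
      using \<open>mid \<noteq> []\<close> by (metis append_butlast_last_id surj_pair)
    then show ?thesis
      using that[of "ys @ [(j, z \<otimes> (y \<otimes> x))]"] red_absorb_right[of ys j z "y \<otimes> x"] y(1) True conj xs
      by simp
  next
    case False
    then have "red (mid @ [(i, y \<otimes> x)])" using x y \<open>mid \<noteq> []\<close>
      by (auto simp: reduced_append reduced_Cons)
    then show ?thesis using that[of "mid @ [(i, y \<otimes> x)]"] red_snoc(5) conj xs by simp
  qed
qed

end

subsection \<open>Amalgamated products\<close>

locale amalgam = two_subgroups +
  assumes generated: "generate G (P True \<union> P False) = carrier G"
    and normal_form: "\<And>xs. red xs \<Longrightarrow> xs \<noteq> [] \<Longrightarrow> word_prod xs \<noteq> \<one>"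
begin

lemma word_prod_red_notin_C:
  assumes "red xs" "xs \<noteq> []"
  shows "word_prod xs \<notin> C"
proof
  assume in_C: "word_prod xs \<in> C"
  obtain i x xs' where xs: "xs = (i, x) # xs'"
    using assms(2) by (metis list.exhaust surj_pair)
  have "word_prod ((i, inv (word_prod xs) \<otimes> x) # xs') = inv (word_prod xs) \<otimes> word_prod xs"
    and "red ((i, inv (word_prod xs) \<otimes> x) # xs')"
    using red_absorb_left[of i x xs' "inv (word_prod xs)"] assms in_C xs by auto
  then show False using normal_form[of "(i, inv (word_prod xs) \<otimes> x) # xs'"] in_C by simp
qed

lemma P_inter: "P True \<inter> P False = C"
proof
  show "P True \<inter> P False \<subseteq> C"
  proof
    fix x assume x: "x \<in> P True \<inter> P False"
    show "x \<in> C"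
    proof (rule ccontr)
      assume "x \<notin> C"
      then have "red [(True, x), (False, inv x)]" using x by (auto simp: reduced_Cons)
      from normal_form[OF this] show False using x by auto
    qed
  qed
qed (use C_subset_P in blast)

lemma mem_C_if_mem_both: "x \<in> P i \<Longrightarrow> x \<in> P j \<Longrightarrow> i \<noteq> j \<Longrightarrow> x \<in> C"
  using P_inter by (cases i; cases j) auto

lemma red_unique_head:
  assumes xs: "red ((i, x) # xs)" and ys: "red ((j, y) # ys)" and C: "c \<in> C" "d \<in> C"
    and eq: "c \<otimes> word_prod ((i, x) # xs) = word_prod ((j, y) # ys) \<otimes> d"
  shows "i = j" "inv y \<otimes> c \<otimes> x \<in> C" "(inv y \<otimes> c \<otimes> x) \<otimes> word_prod xs = word_prod ys \<otimes> d"
proof -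
  have x: "red xs" "x \<in> P i" "xs \<noteq> [] \<Longrightarrow> i \<noteq> fst (hd xs)"
    and y: "red ys" "y \<in> P j" "ys \<noteq> [] \<Longrightarrow> j \<noteq> fst (hd ys)"
    using xs ys by (auto simp: reduced_Cons)
  have carrier: "x \<in> carrier G" "y \<in> carrier G" "word_prod xs \<in> carrier G" "word_prod ys \<in> carrier G"
    using x y by auto
  have "inv y \<otimes> (c \<otimes> (x \<otimes> word_prod xs)) = inv y \<otimes> ((y \<otimes> word_prod ys) \<otimes> d)" using eq by simp
  then show tails: "(inv y \<otimes> c \<otimes> x) \<otimes> word_prod xs = word_prod ys \<otimes> d"
    using carrier C by (simp add: m_assoc)
  show "i = j"
  proof (rule ccontr)
    assume "i \<noteq> j"
    have cx: "red ((i, c \<otimes> x) # xs)" using red_absorb_left(1)[OF xs C(1)] .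
    have word: "red (word_inv ((j, y) # ys) @ (i, c \<otimes> x) # xs)"
      using cx red_word_inv[OF ys] \<open>i \<noteq> j\<close> by (auto simp: reduced_append last_word_inv)
    have "word_prod (word_inv ((j, y) # ys) @ (i, c \<otimes> x) # xs)
        = inv (word_prod ((j, y) # ys)) \<otimes> (c \<otimes> (x \<otimes> word_prod xs))"
      using word_prod_red_append[OF red_word_inv[OF ys] cx] word_prod_red_word_inv[OF ys] carrier C
      by (simp add: m_assoc)
    also have "\<dots> = d" using eq carrier C by (simp add: m_assoc inv_mult_group)
    finally show False using word_prod_red_notin_C[OF word] C by simp
  qed
  show "inv y \<otimes> c \<otimes> x \<in> C"
  proof (rule ccontr)
    assume "inv y \<otimes> c \<otimes> x \<notin> C"
    then have quotient: "red ((i, inv y \<otimes> c \<otimes> x) # xs)"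
      using x y \<open>i = j\<close> C_mem_P[OF C(1)] by (auto simp: reduced_Cons)
    then have word: "red (word_inv ys @ (i, inv y \<otimes> c \<otimes> x) # xs)"
      using red_word_inv[OF y(1)] y(3) \<open>i = j\<close> by (auto simp: reduced_append last_word_inv)
    have "word_prod (word_inv ys @ (i, inv y \<otimes> c \<otimes> x) # xs)
        = inv (word_prod ys) \<otimes> ((inv y \<otimes> c \<otimes> x) \<otimes> word_prod xs)"
      using word_prod_red_append[OF red_word_inv[OF y(1)] quotient] word_prod_red_word_inv[OF y(1)]
      by simp
    also have "\<dots> = d" using tails carrier C by simp
    finally show False using word_prod_red_notin_C[OF word] C by simp
  qed
qed

lemma red_unique_Nil_iff:
  assumes "red xs" "red ys" "c \<in> C" "d \<in> C" "c \<otimes> word_prod xs = word_prod ys \<otimes> d"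
  shows "xs = [] \<longleftrightarrow> ys = []"
proof -
  have "word_prod xs \<in> C \<longleftrightarrow> word_prod ys \<in> C"
    using assms by (metis C_mult_left_iff C_mult_right_iff word_prod_red)
  then show ?thesis
    using word_prod_red_notin_C[OF assms(1)] word_prod_red_notin_C[OF assms(2)]
    by (metis C_one word_prod_Nil)
qed

lemma red_unique_types:
  assumes "red xs" "red ys" "c \<in> C" "d \<in> C" "c \<otimes> word_prod xs = word_prod ys \<otimes> d"
  shows "map fst xs = map fst ys"
  using assms
proof (induction xs arbitrary: ys c)
  case Nil
  then show ?case using red_unique_Nil_iff[OF Nil.prems] by simp
next
  case (Cons a xs)
  obtain i x where a: "a = (i, x)" by force
  obtain j y ys' where ys: "ys = (j, y) # ys'"
    using red_unique_Nil_iff[OF Cons.prems] by (metis list.exhaust surj_pair)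
  note head = red_unique_head[OF Cons.prems[unfolded a ys]]
  have "map fst xs = map fst ys'"
    using Cons.IH[OF _ _ head(2) Cons.prems(4) head(3)] Cons.prems a ys by (simp add: reduced_Cons)
  then show ?case using head(1) a ys by simp
qed

lemma red_unique_length:
  assumes "red xs" "red ys" "c \<in> C" "d \<in> C" "c \<otimes> word_prod xs = word_prod ys \<otimes> d"
  shows "length xs = length ys"
  using red_unique_types[OF assms] by (metis length_map)

lemma red_unique_prefix:
  assumes "red xs" "red ys" "c \<in> C" "d \<in> C" "c \<otimes> word_prod xs = word_prod ys \<otimes> d"
  obtains e where "e \<in> C" "c \<otimes> word_prod (take k xs) = word_prod (take k ys) \<otimes> e"
proof -
  have "\<exists>e\<in>C. c \<otimes> word_prod (take k xs) = word_prod (take k ys) \<otimes> e"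
    using assms
  proof (induction k arbitrary: xs ys c)
    case 0
    then show ?case by (intro bexI[of _ c]) auto
  next
    case (Suc k)
    show ?case
    proof (cases "xs = []")
      case True
      then show ?thesis using Suc.prems red_unique_Nil_iff[OF Suc.prems] by (intro bexI[of _ c]) auto
    next
      case False
      then obtain i x xs' j y ys' where words: "xs = (i, x) # xs'" "ys = (j, y) # ys'"
        using red_unique_Nil_iff[OF Suc.prems] by (metis list.exhaust surj_pair)
      note head = red_unique_head[OF Suc.prems[unfolded words]]
      have red: "red xs'" "red ys'" and carrier: "x \<in> carrier G" "y \<in> carrier G"
        using Suc.prems words by (auto simp: reduced_Cons)
      obtain e where e: "e \<in> C"
          "(inv y \<otimes> c \<otimes> x) \<otimes> word_prod (take k xs') = word_prod (take k ys') \<otimes> e"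
        using Suc.IH[OF red head(2) Suc.prems(4) head(3)] by blast
      have takes: "word_prod (take k xs') \<in> carrier G" "word_prod (take k ys') \<in> carrier G"
        using red reduced_take by auto
      have "y \<otimes> ((inv y \<otimes> c \<otimes> x) \<otimes> word_prod (take k xs')) = y \<otimes> (word_prod (take k ys') \<otimes> e)"
        using e by simp
      then have "c \<otimes> (x \<otimes> word_prod (take k xs')) = y \<otimes> word_prod (take k ys') \<otimes> e"
        using carrier takes e(1) Suc.prems(3) by (simp add: m_assoc)
      then show ?thesis using e(1) words by auto
    qed
  qed
  then show ?thesis using that by blast
qed

lemma red_unique_suffix:
  assumes words: "red xs" "red ys" and C: "c \<in> C" "d \<in> C" "e \<in> C"
    and eq: "c \<otimes> word_prod xs = word_prod ys \<otimes> d"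
    and prefix: "c \<otimes> word_prod (take k xs) = word_prod (take k ys) \<otimes> e"
  shows "e \<otimes> word_prod (drop k xs) = word_prod (drop k ys) \<otimes> d"
proof -
  have xs: "red (take k xs)" "red (drop k xs)" and ys: "red (take k ys)" "red (drop k ys)"
    using words reduced_take reduced_drop by blast+
  have "word_prod (take k ys) \<otimes> (e \<otimes> word_prod (drop k xs))
      = (c \<otimes> word_prod (take k xs)) \<otimes> word_prod (drop k xs)"
    using xs ys C prefix by (simp add: m_assoc)
  also have "\<dots> = c \<otimes> word_prod xs"
    using xs C word_prod_red_append[OF xs] by (simp add: m_assoc)
  also have "\<dots> = word_prod (take k ys) \<otimes> (word_prod (drop k ys) \<otimes> d)"
    using ys C word_prod_red_append[OF ys] eq by (simp add: m_assoc)
  finally show ?thesis using xs ys C by simp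
qed

lemma red_exists:
  assumes "g \<in> carrier G"
  obtains xs c where "red xs" "c \<in> C" "g = word_prod xs \<otimes> c"
  using represents_exists[of g] representsE assms generated by metis

lemma red_exists_notin_C:
  assumes "g \<in> carrier G" "g \<notin> C"
  obtains xs where "red xs" "xs \<noteq> []" "g = word_prod xs"
proof -
  obtain xs c where xs: "red xs" "c \<in> C" "g = word_prod xs \<otimes> c"
    using red_exists[of g] assms by metis
  then have "xs \<noteq> []" using assms by auto
  then obtain zs i x where "xs = zs @ [(i, x)]" by (metis append_butlast_last_id surj_pair)
  then show ?thesis using that red_absorb_right[of zs i x c] xs by auto
qed

definition len :: "'a \<Rightarrow> nat" where
  "len g = (THE n. \<exists>xs. represents P C xs g \<and> n = length xs)"

lemma len_eq:
  assumes "represents P C xs g"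
  shows "len g = length xs"
  unfolding len_def
proof (rule the_equality)
  fix n assume "\<exists>ys. represents P C ys g \<and> n = length ys"
  then obtain ys d where ys: "n = length ys" "red ys" "d \<in> C" "g = word_prod ys \<otimes> d"
    by (auto elim!: representsE)
  obtain c where c: "red xs" "c \<in> C" "g = word_prod xs \<otimes> c" using assms by (rule representsE)
  have "\<one> \<otimes> word_prod ys = word_prod xs \<otimes> (c \<otimes> inv d)"
    using c ys by (metis C_carrier C_inv inv_solve_right l_one m_assoc m_closed word_prod_red)
  then show "n = length xs" using red_unique_length[of ys xs \<one> "c \<otimes> inv d"] c ys by auto
qed (use assms in blast)

lemma len_word_prod: "red xs \<Longrightarrow> len (word_prod xs) = length xs"
  by (rule len_eq) (auto intro: representsI[of _ _ _ \<one>])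

lemma len_C: "c \<in> C \<Longrightarrow> len c = 0"
  by (subst len_eq[of "[]"]) (auto intro: representsI)

lemma represents_len_exists:
  assumes "g \<in> carrier G"
  obtains xs where "represents P C xs g" "length xs = len g"
  using represents_exists[of g] len_eq assms generated by metis

lemma len_P_mult:
  assumes "p \<in> P i" "g \<in> carrier G"
  shows "len (p \<otimes> g) \<le> Suc (len g)"
proof -
  obtain xs where xs: "represents P C xs g" "length xs = len g"
    using represents_len_exists[OF assms(2)] .
  show ?thesis using represents_P_mult[OF xs(1) assms(1)] len_eq xs(2) by metis
qed

lemma len_P: "p \<in> P i \<Longrightarrow> len p \<le> 1"
  using len_P_mult[of p i \<one>] by (simp add: len_C)

lemma len_C_mult:
  assumes "c \<in> C" "g \<in> carrier G"
  shows "len (c \<otimes> g) = len g"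
proof -
  obtain xs where xs: "represents P C xs g" "length xs = len g"
    using represents_len_exists[OF assms(2)] .
  show ?thesis using represents_C_mult[OF xs(1) assms(1)] len_eq xs(2) by metis
qed

lemma len_word_prod_mult:
  assumes "red xs" "g \<in> carrier G"
  shows "len (word_prod xs \<otimes> g) \<le> length xs + len g"
  using assms(1)
proof (induction xs)
  case Nil
  then show ?case using assms by simp
next
  case (Cons x xs)
  then have x: "red xs" "snd x \<in> P (fst x)" by (auto simp: reduced_Cons)
  have "len (snd x \<otimes> (word_prod xs \<otimes> g)) \<le> Suc (len (word_prod xs \<otimes> g))"
    using len_P_mult x assms by simp
  then show ?case using Cons.IH x assms by (simp add: m_assoc P_carrier[OF x(2)])
qed

lemma len_mult:
  assumes "h \<in> carrier G" "g \<in> carrier G"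
  shows "len (h \<otimes> g) \<le> len h + len g"
proof -
  obtain xs where xs: "represents P C xs h" "length xs = len h"
    using represents_len_exists[OF assms(1)] .
  then obtain c where c: "red xs" "c \<in> C" "h = word_prod xs \<otimes> c" by (auto elim: representsE)
  then have "h \<otimes> g = word_prod xs \<otimes> (c \<otimes> g)" using assms by (simp add: m_assoc)
  also have "len \<dots> \<le> length xs + len (c \<otimes> g)"
    using len_word_prod_mult[OF c(1)] c(2) assms by simp
  finally show ?thesis using len_C_mult[OF c(2) assms(2)] xs(2) by simp
qed

lemma len_mult_same_type_less:
  assumes "red us" "red vs" "us \<noteq> []" "vs \<noteq> []" "fst (last us) = fst (hd vs)"
  shows "len (word_prod us \<otimes> word_prod vs) < length us + length vs"
proof -
  obtain us' i u where us: "us = us' @ [(i, u)]"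
    using assms(3) by (metis append_butlast_last_id surj_pair)
  obtain v vs' where vs: "vs = (i, v) # vs'" using assms(4,5) us by (cases vs) auto
  note u = red_snoc[OF assms(1)[unfolded us]]
  have v: "v \<in> P i" "red vs'" using assms(2) vs by (auto simp: reduced_Cons)
  have carrier: "u \<in> carrier G" "v \<in> carrier G" using u v by auto
  have "word_prod us \<otimes> word_prod vs = word_prod us' \<otimes> ((u \<otimes> v) \<otimes> word_prod vs')"
    using u v us vs carrier by (simp add: m_assoc)
  also have "len \<dots> \<le> length us' + len ((u \<otimes> v) \<otimes> word_prod vs')"
    using len_word_prod_mult[OF u(1)] v carrier by simp
  also have "len ((u \<otimes> v) \<otimes> word_prod vs') \<le> Suc (length vs')"
    using len_P_mult[OF P_mult[OF u(2) v(1)], of "word_prod vs'"] len_word_prod[OF v(2)] v(2) by simp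
  finally show ?thesis using us vs by simp
qed

end

definition list_power :: "nat \<Rightarrow> 'b list \<Rightarrow> 'b list" where
  "list_power k xs = concat (replicate k xs)"

lemma list_power_0 [simp]: "list_power 0 xs = []"
  and list_power_Suc [simp]: "list_power (Suc k) xs = xs @ list_power k xs"
  by (simp_all add: list_power_def)

lemma length_list_power [simp]: "length (list_power k xs) = k * length xs"
  by (induction k) auto

lemma list_power_add: "list_power (k + l) xs = list_power k xs @ list_power l xs"
  by (induction k) auto

lemma list_power_eq_Nil_iff [simp]: "list_power k xs = [] \<longleftrightarrow> k = 0 \<or> xs = []"
  by (induction k) auto

lemma hd_list_power: "k \<ge> 1 \<Longrightarrow> xs \<noteq> [] \<Longrightarrow> hd (list_power k xs) = hd xs"
  by (cases k) auto

lemma last_list_power: "k \<ge> 1 \<Longrightarrow> xs \<noteq> [] \<Longrightarrow> last (list_power k xs) = last xs"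
  by (induction k) (auto simp: last_append Suc_le_eq)

lemma take_list_power_eq:
  assumes "i \<le> k * length xs" "i \<le> l * length xs"
  shows "take i (list_power l xs) = take i (list_power k xs)"
proof -
  have "take i (list_power l' xs) = take i (list_power k' xs)" if "i \<le> k' * length xs" "k' \<le> l'"
    for k' l'
    using list_power_add[of k' "l' - k'" xs] that by simp
  then show ?thesis using assms by (metis nle_le)
qed

subsection \<open>Elliptic and hyperbolic elements\<close>

context amalgam
begin

definition cyclically_red :: "(bool \<times> 'a) list \<Rightarrow> bool" where
  "cyclically_red xs \<longleftrightarrow> red xs \<and> xs \<noteq> [] \<and> fst (hd xs) \<noteq> fst (last xs)"

lemma cyclically_redD:
  assumes "cyclically_red xs"
  shows "red xs" "xs \<noteq> []" "fst (last xs) \<longleftrightarrow> \<not> fst (hd xs)" "length xs \<ge> 1"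
  using assms by (auto simp: cyclically_red_def Suc_le_eq)

lemma cyclically_red_carrier: "cyclically_red xs \<Longrightarrow> word_prod xs \<in> carrier G"
  by (simp add: cyclically_red_def)

lemma red_list_power: "cyclically_red xs \<Longrightarrow> red (list_power k xs)"
proof (induction k)
  case (Suc k)
  then show ?case using cyclically_redD[OF Suc.prems] hd_list_power[of k xs]
    by (cases k) (auto simp: reduced_append)
qed simp

lemma word_prod_list_power:
  assumes "cyclically_red xs" shows "word_prod (list_power k xs) = word_prod xs [^] k"
proof (induction k)
  case (Suc k)
  have "word_prod (list_power (Suc k) xs) = word_prod xs \<otimes> word_prod xs [^] k"
    using Suc assms cyclically_redD[OF assms] red_list_power[OF assms, of k]
    by (simp add: word_prod_red_append)
  then show ?case using pow_commute_self[OF cyclically_red_carrier[OF assms], of k] by simp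
qed simp

lemma cyclically_red_word_inv: "cyclically_red xs \<Longrightarrow> cyclically_red (word_inv xs)"
  using red_word_inv by (auto simp: cyclically_red_def hd_word_inv last_word_inv)

lemma cyclically_red_list_power:
  "cyclically_red xs \<Longrightarrow> k \<ge> 1 \<Longrightarrow> cyclically_red (list_power k xs)"
  using red_list_power[of xs k] by (auto simp: cyclically_red_def hd_list_power last_list_power)

definition elliptic :: "'a \<Rightarrow> bool" where
  "elliptic g \<longleftrightarrow> (\<exists>h\<in>carrier G. \<exists>i. conj_by h g \<in> P i)"

definition hyperbolic :: "'a \<Rightarrow> bool" where
  "hyperbolic g \<longleftrightarrow> (\<exists>h\<in>carrier G. \<exists>xs. cyclically_red xs \<and> conj_by h g = word_prod xs)"

lemma elliptic_if_elliptic_conj_by: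
  "h \<in> carrier G \<Longrightarrow> g \<in> carrier G \<Longrightarrow> elliptic (conj_by h g) \<Longrightarrow> elliptic g"
  unfolding elliptic_def by (metis conj_by_conj_by m_closed)

lemma hyperbolic_if_hyperbolic_conj_by:
  "h \<in> carrier G \<Longrightarrow> g \<in> carrier G \<Longrightarrow> hyperbolic (conj_by h g) \<Longrightarrow> hyperbolic g"
  unfolding hyperbolic_def by (metis conj_by_conj_by m_closed)

lemma elliptic_if_mem_P: "g \<in> P i \<Longrightarrow> elliptic g"
  unfolding elliptic_def by (intro bexI[of _ \<one>] exI[of _ i]) auto

lemma hyperbolic_word_prod: "cyclically_red xs \<Longrightarrow> hyperbolic (word_prod xs)"
  unfolding hyperbolic_def by (intro bexI[of _ \<one>] exI[of _ xs]) (auto simp: cyclically_red_carrier)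

lemma elliptic_or_hyperbolic:
  assumes "g \<in> carrier G"
  shows "elliptic g \<or> hyperbolic g"
proof (cases "g \<in> C")
  case True
  then show ?thesis using elliptic_if_mem_P C_mem_P by blast
next
  case False
  then obtain xs where "red xs" "xs \<noteq> []" "g = word_prod xs"
    using red_exists_notin_C[of g] assms by metis
  then show ?thesis
  proof (induction "length xs" arbitrary: xs g rule: less_induct)
    case less
    consider "fst (hd xs) \<noteq> fst (last xs)" | "fst (hd xs) = fst (last xs)" "length xs \<ge> 2"
      | x where "xs = [x]"
      using less.prems(2) by (cases xs; cases "tl xs") auto
    then show ?case
    proof cases
      case 1
      then show ?thesis using less.prems hyperbolic_word_prod by (simp add: cyclically_red_def)
    next
      case 2
      obtain ys where ys: "red ys" "ys \<noteq> []" "length ys < length xs"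
          "conj_by (snd (hd xs)) (word_prod xs) = word_prod ys"
        using red_cyclic_reduction[OF less.prems(1) 2(2,1)] .
      moreover have "snd (hd xs) \<in> carrier G" "g \<in> carrier G"
        using red_carrier[OF less.prems(1)] less.prems by auto
      ultimately show ?thesis
        using less.hyps[OF ys(3,1,2)] less.prems(3) elliptic_if_elliptic_conj_by
          hyperbolic_if_hyperbolic_conj_by
        by metis
    next
      case (3 x)
      then have "g \<in> P (fst x)" using less.prems by (auto simp: reduced_Cons)
      then show ?thesis using elliptic_if_mem_P by blast
    qed
  qed
qed

lemma cyclically_red_pow_not_elliptic:
  assumes "cyclically_red xs" "n \<ge> 1"
  shows "\<not> elliptic (word_prod xs [^] (n::nat))"
proof
  assume "elliptic (word_prod xs [^] n)"
  then obtain h i where h: "h \<in> carrier G" and P: "conj_by h (word_prod xs [^] n) \<in> P i"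
    by (auto simp: elliptic_def)
  note carrier = cyclically_red_carrier[OF assms(1)]
  define N where "N = len h + len (inv h) + 2"
  define q where "q = conj_by h (word_prod xs [^] n) [^] N"
  have q: "q \<in> P i" using P by (auto simp: q_def)
  have "word_prod xs [^] (n * N) = conj_by (inv h) q"
    using h carrier by (simp add: q_def nat_pow_pow flip: conj_by_pow)
  also have "\<dots> = h \<otimes> (q \<otimes> inv h)" using h q by (simp add: conj_by_def m_assoc)
  also have "len \<dots> \<le> len h + Suc (len (inv h))"
    using len_mult[of h "q \<otimes> inv h"] len_P_mult[OF q, of "inv h"] h q by simp
  also have "\<dots> < N" by (simp add: N_def)
  also have "N \<le> n * N * length xs"
    using assms(2) cyclically_redD(4)[OF assms(1)] mult_le_mono[of 1 n N N]
      mult_le_mono[of N "n * N" 1 "length xs"]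
    by simp
  also have "\<dots> = len (word_prod xs [^] (n * N))"
    using len_word_prod[OF red_list_power[OF assms(1), of "n * N"]] word_prod_list_power[OF assms(1)]
    by simp
  finally show False by simp
qed

lemma red_conjugate:
  assumes "red hs" "hs \<noteq> [] \<Longrightarrow> fst (last hs) \<noteq> j" "r \<in> P j" "r \<notin> C"
  shows "red (hs @ [(j, r)] @ word_inv hs)"
    and "word_prod (hs @ [(j, r)] @ word_inv hs) = conj_by (inv (word_prod hs)) r"
proof -
  have "red ((j, r) # word_inv hs)"
    using red_word_inv[OF assms(1)] assms(2-4) by (auto simp: reduced_Cons hd_word_inv)
  then show "red (hs @ [(j, r)] @ word_inv hs)"
    and "word_prod (hs @ [(j, r)] @ word_inv hs) = conj_by (inv (word_prod hs)) r"
    using assms(1-3) red_word_inv[OF assms(1)] word_prod_red_word_inv[OF assms(1)]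
    by (auto simp: reduced_append word_prod_red_append conj_by_def m_assoc)
qed

lemma elliptic_normal_form:
  assumes "g \<in> carrier G" "elliptic g"
  obtains hs r j where "red hs" "r \<in> P j" "g = conj_by (inv (word_prod hs)) r"
    "hs \<noteq> [] \<Longrightarrow> r \<notin> P (fst (last hs))"
proof -
  obtain h j where h: "h \<in> carrier G" "conj_by h g \<in> P j" using assms(2) by (auto simp: elliptic_def)
  obtain hs c where hs: "red hs" "c \<in> C" "h = word_prod hs \<otimes> c" using red_exists[OF h(1)] .
  define r where "r = conj_by (inv c) (conj_by h g)"
  have "r \<in> P j" using h hs C_mem_P P_subgroup by (simp add: r_def conj_by_mem_subgroup)
  moreover have "g = conj_by (inv (word_prod hs)) r"
    using assms(1) hs by (simp add: r_def conj_by_conj_by m_assoc)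
  ultimately show ?thesis
    using hs(1) that
  proof (induction hs arbitrary: r j rule: rev_induct)
    case Nil
    then show ?case by (metis reduced_Nil)
  next
    case (snoc a hs)
    obtain l x where a: "a = (l, x)" by force
    note x = red_snoc[OF snoc.prems(3)[unfolded a]]
    show ?case
    proof (cases "r \<in> P l")
      case False
      then show ?thesis using snoc.prems a by simp
    next
      case True
      have "conj_by (inv x) r \<in> P l"
        using True x P_subgroup by (simp add: conj_by_mem_subgroup P_inv)
      moreover have "g = conj_by (inv (word_prod hs)) (conj_by (inv x) r)"
        using snoc.prems(1,2) x a P_carrier[OF x(2)] by (simp add: conj_by_conj_by inv_mult_group)
      ultimately show ?thesis using snoc.IH x(1) snoc.prems(4) by blast
    qed
  qed
qed

end

locale isolated_amalgam = amalgam +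
  assumes C_isolated_in_P: "\<And>i. isolated_in (P i) C"
begin

lemma red_elliptic_pow:
  assumes "red hs" "r \<in> P j" "r \<notin> C" "hs \<noteq> [] \<Longrightarrow> r \<notin> P (fst (last hs))" "n \<ge> 1"
  shows "red (hs @ [(j, r [^] (n::nat))] @ word_inv hs)"
    and "word_prod (hs @ [(j, r [^] n)] @ word_inv hs) = conj_by (inv (word_prod hs)) r [^] n"
proof -
  have pow: "r [^] n \<in> P j" "r [^] n \<notin> C"
    using assms(2,3,5) isolated_inD[OF C_isolated_in_P assms(2), of n] by auto
  have "fst (last hs) \<noteq> j" if "hs \<noteq> []"
  proof
    assume "fst (last hs) = j"
    show False using assms(2) assms(4)[OF that] unfolding \<open>fst (last hs) = j\<close> by contradiction
  qed
  note red_conjugate[OF assms(1) this pow]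
  then show "red (hs @ [(j, r [^] n)] @ word_inv hs)"
    and "word_prod (hs @ [(j, r [^] n)] @ word_inv hs) = conj_by (inv (word_prod hs)) r [^] n"
    using assms(1,2) by (simp_all add: conj_by_pow)
qed

lemma P_isolated: "isolated_in (carrier G) (P i)"
proof (rule isolated_inI)
  fix g and n :: nat assume g: "g \<in> carrier G" and n: "n \<ge> 1" and pow: "g [^] n \<in> P i"
  have "elliptic g"
  proof (rule ccontr)
    assume "\<not> elliptic g"
    then obtain h xs where h: "h \<in> carrier G" "cyclically_red xs" "conj_by h g = word_prod xs"
      using elliptic_or_hyperbolic[OF g] by (auto simp: hyperbolic_def)
    have "conj_by (inv h) (word_prod xs [^] n) = g [^] n"
      using g h by (simp flip: h(3) conj_by_pow)
    then have "elliptic (word_prod xs [^] n)" using pow h(1) unfolding elliptic_def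
      by (metis inv_closed)
    then show False using cyclically_red_pow_not_elliptic[OF h(2) n] by contradiction
  qed
  then obtain hs r j where r: "red hs" "r \<in> P j" "g = conj_by (inv (word_prod hs)) r"
    "hs \<noteq> [] \<Longrightarrow> r \<notin> P (fst (last hs))" using elliptic_normal_form[OF g] by metis
  show "g \<in> P i"
  proof (cases "hs = []")
    case True
    then have "g \<in> P j" using r by simp
    show ?thesis
    proof (cases "i = j")
      case False
      then have "g [^] n \<in> C" using mem_C_if_mem_both[OF pow P_pow[OF \<open>g \<in> P j\<close>]] by blast
      then show ?thesis using isolated_inD[OF C_isolated_in_P \<open>g \<in> P j\<close>] n C_mem_P by blast
    qed (use \<open>g \<in> P j\<close> in simp)
  next
    case False
    then have "r \<notin> C" using r(4) C_mem_P by blast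
    from red_elliptic_pow[OF r(1,2) this r(4) n]
    have "len (g [^] n) = 2 * length hs + 1" using len_word_prod r(3) by fastforce
    moreover have "len (g [^] n) \<le> 1" using len_P[OF pow] .
    ultimately show ?thesis using False by simp
  qed
qed

lemma C_isolated: "isolated_in (carrier G) C"
proof (rule isolated_inI)
  fix g and n :: nat assume g: "g \<in> carrier G" "n \<ge> 1" "g [^] n \<in> C"
  then have "g \<in> P i" for i using isolated_inD[OF P_isolated, of g n i] C_mem_P by blast
  then show "g \<in> C" using P_inter by blast
qed

end

subsection \<open>Ends of the Bass--Serre tree\<close>

context amalgam
begin

lemma commute_imp_cyclically_red:
  assumes ys: "cyclically_red ys" and g: "g \<in> carrier G" "g \<notin> C"
    and commute: "g \<otimes> word_prod ys = word_prod ys \<otimes> g"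
  obtains zs where "cyclically_red zs" "g = word_prod zs"
proof -
  obtain zs where zs: "red zs" "zs \<noteq> []" "g = word_prod zs" using red_exists_notin_C[OF g] .
  note ys_red = cyclically_redD[OF ys]
  have "fst (hd zs) \<noteq> fst (last zs)"
  proof
    assume same: "fst (hd zs) = fst (last zs)"
    show False
    proof (cases "fst (hd ys) = fst (last zs)")
      case True
      then have "red (ys @ zs)" using ys_red zs same by (auto simp: reduced_append)
      then have "len (word_prod ys \<otimes> word_prod zs) = length ys + length zs"
        using len_word_prod[of "ys @ zs"] word_prod_red_append ys_red zs by simp
      then show False using len_mult_same_type_less[of zs ys] True ys_red zs commute by simp
    next
      case False
      then have "red (zs @ ys)" using ys_red zs by (auto simp: reduced_append)
      then have "len (word_prod zs \<otimes> word_prod ys) = length zs + length ys"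
        using len_word_prod[of "zs @ ys"] word_prod_red_append ys_red zs by simp
      moreover have "fst (last ys) = fst (hd zs)" using False ys_red same by blast
      ultimately show False using len_mult_same_type_less[of ys zs] ys_red zs commute by simp
    qed
  qed
  then show ?thesis using that zs by (simp add: cyclically_red_def)
qed

lemma commute_imp_same_direction:
  assumes ys: "cyclically_red ys" and g: "g \<in> carrier G" "g \<notin> C"
    and commute: "g \<otimes> word_prod ys = word_prod ys \<otimes> g"
  obtains zs where "cyclically_red zs" "fst (hd zs) = fst (hd ys)"
    "g = word_prod zs \<or> inv g = word_prod zs"
      "word_prod zs \<otimes> word_prod ys = word_prod ys \<otimes> word_prod zs"
proof -
  obtain zs where zs: "cyclically_red zs" "g = word_prod zs"
    using commute_imp_cyclically_red[OF assms] .
  note zs_red = cyclically_redD[OF zs(1)]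
  show ?thesis
  proof (cases "fst (hd zs) = fst (hd ys)")
    case True
    then show ?thesis using that[OF zs(1)] zs(2) commute by simp
  next
    case False
    then have "fst (hd (word_inv zs)) = fst (hd ys)" using zs_red hd_word_inv[OF zs_red(2)] by blast
    moreover have "word_prod (word_inv zs) = inv g" using zs zs_red word_prod_red_word_inv by simp
    ultimately show ?thesis
      using that[OF cyclically_red_word_inv[OF zs(1)]]
        commute_inv[OF g(1) cyclically_red_carrier[OF ys] commute] by simp
  qed
qed

text \<open>
  \<open>ray ys i\<close> is the \<open>i\<close>-th edge of the ray in the Bass--Serre tree that runs along the axis of the
  hyperbolic element \<open>word_prod ys\<close>; edges are left cosets of \<open>C\<close>.
\<close>

definition ray :: "(bool \<times> 'a) list \<Rightarrow> nat \<Rightarrow> 'a set" where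
  "ray ys i = word_prod (take i (list_power i ys)) <# C"

lemma red_take_list_power: "cyclically_red ys \<Longrightarrow> red (take i (list_power k ys))"
  by (rule reduced_take[OF red_list_power])

lemma word_prod_take_list_power_carrier [simp]:
  "cyclically_red ys \<Longrightarrow> word_prod (take i (list_power k ys)) \<in> carrier G"
  by (rule word_prod_red[OF red_take_list_power])

lemma ray_eq:
  assumes "cyclically_red ys" "i \<le> k * length ys"
  shows "ray ys i = word_prod (take i (list_power k ys)) <# C"
proof -
  have "i \<le> i * length ys" using cyclically_redD(4)[OF assms(1)] by simp
  then show ?thesis using take_list_power_eq[OF assms(2), of i] by (simp add: ray_def)
qed

lemma ray_carrier: "cyclically_red ys \<Longrightarrow> ray ys i \<subseteq> carrier G"
  using l_coset_subset_G[OF C_subset] by (simp add: ray_def)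

lemma ray_0: "ray ys 0 = C"
  using lcos_mult_one[OF C_subset] by (simp add: ray_def)

lemma len_ray:
  assumes "cyclically_red ys" "g \<in> ray ys i"
  shows "len g = i"
proof -
  obtain c where "c \<in> C" "g = word_prod (take i (list_power i ys)) \<otimes> c"
    using assms(2) by (auto simp: ray_def l_coset_def)
  then have "len g = length (take i (list_power i ys))"
    by (intro len_eq representsI[OF red_take_list_power[OF assms(1)]])
  then show ?thesis using mult_le_mono2[OF cyclically_redD(4)[OF assms(1)], of i] by simp
qed

lemma C_commute_ray:
  assumes ys: "cyclically_red ys" and c: "c \<in> C" "c \<otimes> word_prod ys = word_prod ys \<otimes> c"
  shows "c <# ray ys i = ray ys i"
proof -
  let ?w = "list_power i ys"
  have "c \<otimes> word_prod ys [^] i = word_prod ys [^] i \<otimes> c"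
    using c cyclically_red_carrier[OF ys] group_commutes_pow[of "word_prod ys" c i] by simp
  then have "c \<otimes> word_prod ?w = word_prod ?w \<otimes> c" using word_prod_list_power[OF ys] by simp
  then obtain e where e: "e \<in> C" "c \<otimes> word_prod (take i ?w) = word_prod (take i ?w) \<otimes> e"
    using red_unique_prefix[OF red_list_power[OF ys] red_list_power[OF ys] c(1) c(1)] by metis
  have "c <# ray ys i = (c \<otimes> word_prod (take i ?w)) <# C"
    using lcos_m_assoc[OF C_subset] c ys by (simp add: ray_def)
  then show ?thesis using C_coset_eqI[OF _ e(1)] e(2) ys by (simp add: ray_def)
qed

lemma ray_shift:
  assumes ys: "cyclically_red ys" and zs: "cyclically_red zs" "fst (hd zs) = fst (hd ys)"
    and commute: "word_prod zs \<otimes> word_prod ys = word_prod ys \<otimes> word_prod zs"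
  shows "word_prod zs <# ray ys i = ray ys (i + length zs)"
proof -
  define k where "k = i + length zs"
  let ?w = "list_power k ys"
  note ys_red = cyclically_redD[OF ys] and zs_red = cyclically_redD[OF zs(1)]
  have k: "k \<ge> 1" "k \<le> k * length ys" "i \<le> k * length ys"
    using ys_red(4) zs_red(4) by (auto simp: k_def intro: order.trans[OF _ mult_le_mono2[OF ys_red(4)]])
  have w: "red ?w" "hd ?w = hd ys" "last ?w = last ys"
    using red_list_power[OF ys] hd_list_power[OF k(1)] last_list_power[OF k(1)] ys_red(2) by auto
  have words: "red (zs @ ?w)" "red (?w @ zs)"
    using w ys_red zs_red zs(2) by (auto simp: reduced_append)
  have "word_prod zs \<otimes> word_prod ys [^] k = word_prod ys [^] k \<otimes> word_prod zs"
    using commute ys_red(1) zs_red(1) by (metis group_commutes_pow word_prod_red)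
  then have "\<one> \<otimes> word_prod (zs @ ?w) = word_prod (?w @ zs) \<otimes> \<one>"
    using word_prod_red_append w(1) zs_red(1) cyclically_red_carrier[OF ys] word_prod_list_power[OF ys]
    by simp
  then obtain e where e: "e \<in> C"
      "\<one> \<otimes> word_prod (take (i + length zs) (zs @ ?w)) = word_prod (take (i + length zs) (?w @ zs)) \<otimes> e"
    using red_unique_prefix[OF words C_one C_one] by metis
  have prefix: "word_prod zs \<otimes> word_prod (take i ?w) = word_prod (take k ?w) \<otimes> e"
    using e(2) k word_prod_red_append[OF zs_red(1) red_take_list_power[OF ys]] zs_red(1) ys
    by (simp add: k_def)
  have "word_prod zs <# ray ys i = (word_prod zs \<otimes> word_prod (take i ?w)) <# C"
    using lcos_m_assoc[OF C_subset] zs_red(1) ys ray_eq[OF ys k(3)] by simp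
  also have "\<dots> = word_prod (take k ?w) <# C"
    unfolding prefix using C_coset_eqI[OF _ e(1)] ys by simp
  finally show ?thesis using ray_eq[OF ys k(2)] by (simp add: k_def)
qed

lemma pow_ray_shift:
  assumes ys: "cyclically_red ys" and zs: "cyclically_red zs" "fst (hd zs) = fst (hd ys)"
    and commute: "word_prod zs \<otimes> word_prod ys = word_prod ys \<otimes> word_prod zs"
  shows "word_prod zs [^] k <# ray ys 0 = ray ys (k * length zs)"
proof (induction k)
  case 0
  then show ?case using lcos_mult_one[OF ray_carrier[OF ys]] by simp
next
  case (Suc k)
  note carrier = cyclically_red_carrier[OF zs(1)]
  have "word_prod zs [^] Suc k <# ray ys 0 = word_prod zs <# (word_prod zs [^] k <# ray ys 0)"
    using lcos_m_assoc[OF ray_carrier[OF ys], of "word_prod zs" "word_prod zs [^] k"] carrier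
    by (simp only: nat_pow_Suc2 nat_pow_closed)
  then show ?case using Suc ray_shift[OF assms, of "k * length zs"] by (simp add: add.commute)
qed

lemma ray_unique:
  assumes ys: "cyclically_red ys" and zs: "cyclically_red zs" "fst (hd zs) = fst (hd ys)"
    and commute: "word_prod zs \<otimes> word_prod ys = word_prod ys \<otimes> word_prod zs"
  shows "ray zs i = ray ys i"
proof -
  define L where "L = i * length zs"
  let ?w = "list_power L ys"
  have L: "i \<le> L" "L \<le> L * length ys" "i \<le> L * length ys"
    using cyclically_redD(4)[OF zs(1)] cyclically_redD(4)[OF ys] by (auto simp: L_def)
  have "word_prod (list_power i zs) <# C = word_prod (take L ?w) <# C"
    using pow_ray_shift[OF assms, of i] word_prod_list_power[OF zs(1)] ray_eq[OF ys L(2)]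
    by (simp add: ray_0 L_def)
  then obtain e where e: "e \<in> C" "word_prod (list_power i zs) = word_prod (take L ?w) \<otimes> e"
    using C_coset_eqD red_list_power[OF zs(1)] word_prod_red by metis
  then have "\<one> \<otimes> word_prod (list_power i zs) = word_prod (take L ?w) \<otimes> e"
    using red_list_power[OF zs(1)] l_one word_prod_red by metis
  then obtain f where f: "f \<in> C"
    "\<one> \<otimes> word_prod (take i (list_power i zs)) = word_prod (take i (take L ?w)) \<otimes> f"
    using red_unique_prefix[OF red_list_power[OF zs(1)] red_take_list_power[OF ys] C_one e(1), of i]
    by metis
  have "word_prod (take i (list_power i zs)) <# C = word_prod (take i ?w) <# C"
    using C_coset_eqI[OF _ f(1)] f(2) L(1) ys zs(1) by (simp add: min_def)
  then show ?thesis using ray_eq[OF ys L(3)] by (simp add: ray_def)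
qed

definition end_stab :: "(bool \<times> 'a) list \<Rightarrow> 'a set" where
  "end_stab ys = {g \<in> carrier G. \<exists>p q. \<forall>i. g <# ray ys (i + p) = ray ys (i + q)}"

lemma end_stabI:
  "g \<in> carrier G \<Longrightarrow> (\<And>i. g <# ray ys i = ray ys (i + q)) \<Longrightarrow> g \<in> end_stab ys"
  unfolding end_stab_def by (rule CollectI) (metis add.right_neutral)

lemma subgroup_end_stab:
  assumes "cyclically_red ys"
  shows "subgroup (end_stab ys) G"
proof (rule subgroupI)
  note ray_carrier = ray_carrier[OF assms]
  have "\<one> \<in> end_stab ys" using lcos_mult_one[OF ray_carrier] by (intro end_stabI[of _ _ 0]) auto
  then show "end_stab ys \<noteq> {}" by blast
  show "end_stab ys \<subseteq> carrier G" by (auto simp: end_stab_def)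
  show "inv g \<in> end_stab ys" if "g \<in> end_stab ys" for g
  proof -
    obtain p q where g: "g \<in> carrier G" "\<And>i. g <# ray ys (i + p) = ray ys (i + q)"
      using \<open>g \<in> end_stab ys\<close> by (auto simp: end_stab_def)
    then show ?thesis using inv_lcoset_eq[OF g(1) ray_carrier g(2)] unfolding end_stab_def by blast
  qed
  show "g \<otimes> h \<in> end_stab ys" if "g \<in> end_stab ys" "h \<in> end_stab ys" for g h
  proof -
    obtain p q where g: "g \<in> carrier G" "\<And>i. g <# ray ys (i + p) = ray ys (i + q)"
      using \<open>g \<in> end_stab ys\<close> by (auto simp: end_stab_def)
    obtain p' q' where h: "h \<in> carrier G" "\<And>i. h <# ray ys (i + p') = ray ys (i + q')"
      using \<open>h \<in> end_stab ys\<close> by (auto simp: end_stab_def)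
    have "(g \<otimes> h) <# ray ys (i + (p + p')) = ray ys (i + (q' + q))" for i
    proof -
      have "(g \<otimes> h) <# ray ys (i + (p + p')) = g <# (h <# ray ys ((i + p) + p'))"
        using lcos_m_assoc[OF ray_carrier g(1) h(1)] by (simp add: add.assoc)
      also have "\<dots> = g <# ray ys ((i + q') + p)" using h(2)[of "i + p"] by (simp add: ac_simps)
      also have "\<dots> = ray ys (i + (q' + q))" using g(2)[of "i + q'"] by (simp add: ac_simps)
      finally show ?thesis .
    qed
    then show ?thesis using g h unfolding end_stab_def by blast
  qed
qed

lemma end_stab_inv_iff: "cyclically_red ys \<Longrightarrow> g \<in> carrier G \<Longrightarrow> inv g \<in> end_stab ys \<longleftrightarrow> g \<in> end_stab ys"
  by (rule subgroup_inv_iff[OF subgroup_end_stab])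

lemma commute_imp_mem_end_stab:
  assumes ys: "cyclically_red ys" and g: "g \<in> carrier G" "g \<otimes> word_prod ys = word_prod ys \<otimes> g"
  shows "g \<in> end_stab ys"
proof (cases "g \<in> C")
  case True
  then show ?thesis using C_commute_ray[OF ys True g(2)] g(1) by (intro end_stabI[of _ _ 0]) auto
next
  case False
  obtain zs where zs: "cyclically_red zs" "fst (hd zs) = fst (hd ys)"
    "g = word_prod zs \<or> inv g = word_prod zs"
      "word_prod zs \<otimes> word_prod ys = word_prod ys \<otimes> word_prod zs"
    using commute_imp_same_direction[OF ys g(1) False g(2)] .
  have "word_prod zs \<in> end_stab ys"
    using ray_shift[OF ys zs(1,2,4)] by (intro end_stabI cyclically_red_carrier[OF zs(1)])
  then show ?thesis using zs(3) end_stab_inv_iff[OF ys g(1)] by auto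
qed

lemma P_not_shift_ray:
  assumes ys: "cyclically_red ys" and v: "v \<in> P j"
    and shift: "\<And>i. v <# ray ys (i + p) = ray ys (i + q)"
  shows "\<not> p < q"
proof
  assume "p < q"
  define g where "g = word_prod (take p (list_power p ys))"
  have g: "g \<in> carrier G" "g \<in> ray ys p"
    using lcos_self[OF _ C_subgroup] ys by (simp_all add: ray_def g_def)
  have "(v \<otimes> v) <# ray ys p = v <# (v <# ray ys (0 + p))"
    using lcos_m_assoc[OF ray_carrier[OF ys]] v by simp
  also have "\<dots> = v <# ray ys ((q - p) + p)" using shift[of 0] \<open>p < q\<close> by simp
  also have "\<dots> = ray ys (2 * q - p)" using shift[of "q - p"] \<open>p < q\<close> by (simp add: mult_2)
  finally have "(v \<otimes> v) \<otimes> g \<in> ray ys (2 * q - p)" using g by (auto simp: l_coset_def)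
  then have "len ((v \<otimes> v) \<otimes> g) = 2 * q - p" using len_ray[OF ys] by blast
  moreover have "len ((v \<otimes> v) \<otimes> g) \<le> Suc (len g)" using len_P_mult[OF P_mult[OF v v] g(1)] .
  moreover have "len g = p" using len_ray[OF ys g(2)] .
  ultimately show False using \<open>p < q\<close> by linarith
qed

lemma P_end_stab_fixes_ray:
  assumes ys: "cyclically_red ys" and v: "v \<in> P j" "v \<in> end_stab ys"
  obtains p where "\<And>i. i \<ge> p \<Longrightarrow> v <# ray ys i = ray ys i"
proof -
  obtain p q where pq: "\<And>i. v <# ray ys (i + p) = ray ys (i + q)"
    using v by (auto simp: end_stab_def)
  have "inv v <# ray ys (i + q) = ray ys (i + p)" for i
    using inv_lcoset_eq[OF _ ray_carrier[OF ys] pq] v by simp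
  then have "p = q" using P_not_shift_ray[OF ys v(1) pq] P_not_shift_ray[OF ys P_inv[OF v(1)], of q p]
    by simp
  then have "v <# ray ys i = ray ys i" if "i \<ge> p" for i using pq[of "i - p"] that by simp
  then show ?thesis using that by blast
qed

lemma finite_end_stab_fixes_edge:
  assumes ys: "cyclically_red ys" and "finite V" "V \<subseteq> P True \<union> P False" "V \<subseteq> end_stab ys"
  obtains p where "\<And>v. v \<in> V \<Longrightarrow> v <# ray ys p = ray ys p"
proof -
  have "\<exists>p. \<forall>v\<in>V. \<forall>i\<ge>p. v <# ray ys i = ray ys i"
    using assms(2-4)
  proof (induction V rule: finite_induct)
    case (insert v V)
    obtain p where p: "\<forall>v\<in>V. \<forall>i\<ge>p. v <# ray ys i = ray ys i" using insert by auto
    obtain j where "v \<in> P j" using insert by auto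
    then obtain q where q: "\<And>i. i \<ge> q \<Longrightarrow> v <# ray ys i = ray ys i"
      using P_end_stab_fixes_ray[OF ys] insert.prems by blast
    show ?case using p q by (intro exI[of _ "max p q"]) auto
  qed auto
  then show ?thesis using that by blast
qed

lemma carrier_eq_C_if_fixes_edge:
  assumes w: "w \<in> carrier G" and fixed: "\<And>g. g \<in> carrier G \<Longrightarrow> g <# (w <# C) = w <# C"
  shows "carrier G = C"
proof
  show "carrier G \<subseteq> C"
  proof
    fix g assume g: "g \<in> carrier G"
    have "(conj_by (inv w) g \<otimes> w) <# C = w <# C"
      using fixed[of "conj_by (inv w) g"] g w lcos_m_assoc[OF C_subset] by simp
    then obtain e where "e \<in> C" "conj_by (inv w) g \<otimes> w = w \<otimes> e"
      using C_coset_eqD g w by (metis conj_by_closed inv_closed m_closed)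
    then show "g \<in> C" using g w by (simp add: conj_by_def m_assoc)
  qed
qed auto

lemma carrier_eq_C_if_fixes_end:
  assumes ys: "cyclically_red ys" and "carrier G \<subseteq> end_stab ys"
    and V: "finite V" "V \<subseteq> P True \<union> P False" "generate G V = carrier G"
  shows "carrier G = C"
proof -
  have V_carrier: "V \<subseteq> carrier G" using V(2) P_carrier by blast
  then obtain p where "\<And>v. v \<in> V \<Longrightarrow> v <# ray ys p = ray ys p"
    using finite_end_stab_fixes_edge[OF ys V(1,2)] assms(2) by blast
  then have "V \<subseteq> {g \<in> carrier G. g <# ray ys p = ray ys p}" using V_carrier by blast
  from generate_subgroup_incl[OF this subgroup_stabilizer_lcoset[OF ray_carrier[OF ys]]]
  have "carrier G \<subseteq> {g \<in> carrier G. g <# ray ys p = ray ys p}" using V(3) by simp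
  then show ?thesis
    using carrier_eq_C_if_fixes_edge[of "word_prod (take p (list_power p ys))"] ys
    by (auto simp: ray_def)
qed

end

context isolated_amalgam
begin

lemma pow_mem_C_fixes_ray:
  assumes ys: "cyclically_red ys" and t: "t \<in> carrier G" "m \<ge> 1" "t [^] (m::nat) \<in> C"
    and commute: "t [^] m \<otimes> word_prod ys = word_prod ys \<otimes> t [^] m"
  shows "t <# ray ys i = ray ys i"
proof -
  define h where "h = word_prod (take i (list_power i ys))"
  have h: "h \<in> carrier G" using ys by (simp add: h_def)
  have "(t [^] m \<otimes> h) <# C = h <# C"
    using C_commute_ray[OF ys t(3) commute, of i] lcos_m_assoc[OF C_subset] h t
    by (simp add: ray_def flip: h_def)
  then obtain e where e: "e \<in> C" "t [^] m \<otimes> h = h \<otimes> e"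
    using C_coset_eqD[of "t [^] m \<otimes> h" h] h t by auto
  then have "conj_by h (t [^] m) = e" using h t by (simp add: conj_by_def m_assoc)
  then have "conj_by h t [^] m \<in> C" using e(1) h t by (simp add: conj_by_pow)
  then have "conj_by h t \<in> C"
    using isolated_inD[OF C_isolated conj_by_closed[OF h t(1)]] t(2) by blast
  moreover have "t \<otimes> h = h \<otimes> conj_by h t" using h t by (simp add: conj_by_def m_assoc)
  ultimately have "(t \<otimes> h) <# C = h <# C" using C_coset_eqI[OF h] by simp
  then show ?thesis using lcos_m_assoc[OF C_subset] h t by (simp add: ray_def flip: h_def)
qed

lemma commute_pow_imp_mem_end_stab:
  assumes ys: "cyclically_red ys" and t: "t \<in> carrier G" and m: "m \<ge> 1"
    and commute: "t [^] (m::nat) \<otimes> word_prod ys = word_prod ys \<otimes> t [^] m"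
  shows "t \<in> end_stab ys"
proof (cases "t [^] m \<in> C")
  case True
  then show ?thesis
    using pow_mem_C_fixes_ray[OF ys t m True commute] t by (intro end_stabI[of _ _ 0]) auto
next
  case False
  obtain zs where zs: "cyclically_red zs" "fst (hd zs) = fst (hd ys)"
      "t [^] m = word_prod zs \<or> inv (t [^] m) = word_prod zs"
      "word_prod zs \<otimes> word_prod ys = word_prod ys \<otimes> word_prod zs"
    using commute_imp_same_direction[OF ys _ False commute] t by auto
  have "t \<otimes> word_prod zs = word_prod zs \<otimes> t"
    using zs(3) pow_commute_self[OF t, of m] commute_inv[of "t [^] m" t] t by auto
  then have "t \<in> end_stab zs" using commute_imp_mem_end_stab[OF zs(1) t] by blast
  moreover have "ray zs i = ray ys i" for i using ray_unique[OF ys zs(1,2,4)] .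
  ultimately show ?thesis by (simp add: end_stab_def)
qed

end

subsection \<open>Generating sets with commuting powers\<close>

context isolated_amalgam
begin

lemma P_commute_red_imp_mem_P:
  assumes a: "a \<in> P i" and zs: "red zs" "zs \<noteq> []" "fst (hd zs) = k" "fst (last zs) = k"
    and commute: "a \<otimes> word_prod zs = word_prod zs \<otimes> a"
  shows "a \<in> P k"
proof (cases "a \<in> C \<or> i = k")
  case True
  then show ?thesis using a C_mem_P by auto
next
  case False
  then have a_red: "red [(i, a)]" using a by (simp add: reduced_Cons)
  have words: "red ((i, a) # zs)" "red (zs @ [(i, a)])"
    using a_red zs False by (auto simp: reduced_Cons reduced_append)
  have "\<one> \<otimes> word_prod ((i, a) # zs) = word_prod (zs @ [(i, a)]) \<otimes> \<one>"
    using commute word_prod_red_append[OF zs(1) a_red] a zs(1) by simp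
  then have "map fst ((i, a) # zs) = map fst (zs @ [(i, a)])"
    using red_unique_types[OF words C_one C_one] by blast
  then have "i = fst (hd zs)" using zs(2) by (cases zs) auto
  then show ?thesis using False zs(3) by blast
qed

lemma subset_P_if_pow_commute_elliptic:
  assumes S: "S \<subseteq> P i" and m: "m \<ge> 1"
    and r: "red hs" "r \<in> P j" "r \<notin> C" "hs \<noteq> [] \<Longrightarrow> r \<notin> P (fst (last hs))"
    and t: "t = conj_by (inv (word_prod hs)) r"
    and commute: "\<And>s. s \<in> S \<Longrightarrow> s [^] (m::nat) \<otimes> t [^] m = t [^] m \<otimes> s [^] m"
  shows "S \<subseteq> P (if hs = [] then j else fst (hd hs))"
proof
  fix s assume s: "s \<in> S"
  let ?zs = "hs @ [(j, r [^] m)] @ word_inv hs" and ?k = "if hs = [] then j else fst (hd hs)"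
  have types: "?zs \<noteq> []" "fst (hd ?zs) = ?k" "fst (last ?zs) = ?k"
    by (auto simp: last_word_inv)
  have "s \<in> P i" using S s by blast
  moreover have "s [^] m \<otimes> word_prod ?zs = word_prod ?zs \<otimes> s [^] m"
    using commute[OF s] red_elliptic_pow(2)[OF r m] t by simp
  ultimately have "s [^] m \<in> P ?k"
    using P_commute_red_imp_mem_P[OF P_pow red_elliptic_pow(1)[OF r m] types] by blast
  then show "s \<in> P ?k"
    using isolated_inD[OF P_isolated P_carrier[OF \<open>s \<in> P i\<close>]] m by blast
qed

lemma insert_conj_common_conjugator:
  assumes "S \<subseteq> P i" and m: "m \<ge> 1"
    and r: "r \<in> P j" "r \<notin> C" and "red hs" "hs \<noteq> [] \<longrightarrow> r \<notin> P (fst (last hs))"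
    and "t = conj_by (inv (word_prod hs)) r"
    and "\<And>s. s \<in> S \<Longrightarrow> s [^] (m::nat) \<otimes> t [^] m = t [^] m \<otimes> s [^] m"
  shows "\<exists>h\<in>carrier G. \<exists>k. \<forall>s\<in>insert t S. conj_by h s \<in> P k"
  using assms(1,5-8)
proof (induction hs arbitrary: i S t)
  case Nil
  then have "t = r" using r(1) by simp
  moreover have "S \<subseteq> P j"
    using subset_P_if_pow_commute_elliptic[OF Nil.prems(1) m Nil.prems(2) r _ Nil.prems(4,5)] by simp
  ultimately have "\<forall>s\<in>insert t S. conj_by \<one> s \<in> P j" using r(1) by auto
  then show ?case by blast
next
  case (Cons a hs)
  obtain l x where a: "a = (l, x)" by force
  have x: "x \<in> P l" "x \<in> carrier G" "red hs" using Cons.prems(2) a by (auto simp: reduced_Cons)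
  have S: "S \<subseteq> P l"
    using subset_P_if_pow_commute_elliptic[OF Cons.prems(1) m Cons.prems(2) r _ Cons.prems(4,5)]
      Cons.prems(3) a by simp
  have t: "t \<in> carrier G"
    using word_prod_red[OF Cons.prems(2)] Cons.prems(4) r(1) by (simp del: word_prod_Cons)
  have S_carrier: "\<And>s. s \<in> S \<Longrightarrow> s \<in> carrier G" using S by auto
  have "\<exists>h\<in>carrier G. \<exists>k. \<forall>s\<in>insert (conj_by x t) (conj_by x ` S). conj_by h s \<in> P k"
  proof (rule Cons.IH)
    show "conj_by x ` S \<subseteq> P l" using S x(1) P_subgroup by (auto simp: conj_by_mem_subgroup)
    show "conj_by x t = conj_by (inv (word_prod hs)) r"
      using Cons.prems(4) a x r(1) by (simp add: conj_by_conj_by inv_mult_group m_assoc)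
    show "hs \<noteq> [] \<longrightarrow> r \<notin> P (fst (last hs))" using Cons.prems(3) by auto
    show "s [^] m \<otimes> conj_by x t [^] m = conj_by x t [^] m \<otimes> s [^] m" if "s \<in> conj_by x ` S" for s
      using that conj_by_commute_pow[OF x(2) S_carrier t Cons.prems(5)] by blast
  qed (use x in auto)
  then obtain h k where h: "h \<in> carrier G"
      "\<forall>s\<in>insert (conj_by x t) (conj_by x ` S). conj_by h s \<in> P k" by blast
  then have "\<forall>s\<in>insert t S. conj_by (x \<otimes> h) s \<in> P k"
    using conj_by_conj_by[OF h(1) x(2)] t S_carrier by force
  then show ?case using h(1) x(2) by blast
qed

lemma insert_common_conjugator:
  assumes S: "S \<subseteq> P i" and m: "m \<ge> 1" and t: "t \<in> carrier G" "elliptic t"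
    and commute: "\<And>s. s \<in> S \<Longrightarrow> s [^] (m::nat) \<otimes> t [^] m = t [^] m \<otimes> s [^] m"
  obtains h k where "h \<in> carrier G" "\<forall>s\<in>insert t S. conj_by h s \<in> P k"
proof -
  obtain hs r j where normal: "red hs" "r \<in> P j" "t = conj_by (inv (word_prod hs)) r"
      "hs \<noteq> [] \<longrightarrow> r \<notin> P (fst (last hs))"
    using elliptic_normal_form[OF t] by metis
  show ?thesis
  proof (cases "r \<in> C")
    case True
    then have "hs = []" using normal(4) C_mem_P by blast
    then have "\<forall>s\<in>insert t S. conj_by \<one> s \<in> P i" using normal True S C_mem_P by auto
    then show ?thesis using that by blast
  next
    case False
    then show ?thesis
      using insert_conj_common_conjugator[OF S m normal(2) _ normal(1,4,3) commute] that by blast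
  qed
qed

lemma elliptic_common_conjugator:
  assumes "finite S" "S \<subseteq> carrier G" "\<And>s. s \<in> S \<Longrightarrow> elliptic s" and m: "m \<ge> 1"
    and "\<And>s t. s \<in> S \<Longrightarrow> t \<in> S \<Longrightarrow> s [^] (m::nat) \<otimes> t [^] m = t [^] m \<otimes> s [^] m"
  obtains h k where "h \<in> carrier G" "\<forall>s\<in>S. conj_by h s \<in> P k"
proof -
  have "\<exists>h\<in>carrier G. \<exists>k. \<forall>s\<in>S. conj_by h s \<in> P k"
    using assms(1-3,5)
  proof (induction S rule: finite_induct)
    case empty
    then show ?case by blast
  next
    case (insert t S)
    obtain h k where h: "h \<in> carrier G" "\<forall>s\<in>S. conj_by h s \<in> P k" using insert by auto
    have t: "t \<in> carrier G" and S: "\<And>s. s \<in> S \<Longrightarrow> s \<in> carrier G" using insert.prems by auto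
    have conj_t: "conj_by h t \<in> carrier G" "elliptic (conj_by h t)"
      using elliptic_if_elliptic_conj_by[of "inv h" "conj_by h t"] h(1) t insert.prems(2) by simp_all
    have conj_S: "conj_by h ` S \<subseteq> P k" using h by blast
    have conj_commute: "s [^] m \<otimes> conj_by h t [^] m = conj_by h t [^] m \<otimes> s [^] m"
      if "s \<in> conj_by h ` S" for s
      using that conj_by_commute_pow[OF h(1) S t] insert.prems(3) by blast
    obtain h' k' where h': "h' \<in> carrier G"
        "\<forall>s\<in>insert (conj_by h t) (conj_by h ` S). conj_by h' s \<in> P k'"
      using insert_common_conjugator[OF conj_S m conj_t conj_commute] .
    then have "\<forall>s\<in>insert t S. conj_by (h \<otimes> h') s \<in> P k'"
      using conj_by_conj_by[OF h'(1) h(1)] t S by force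
    then show ?case using h'(1) h(1) by blast
  qed
  then show ?thesis using that by blast
qed

lemma hyperbolic_generator_fixes_end:
  assumes S: "S \<subseteq> carrier G" "generate G S = carrier G" and s: "s \<in> S" "hyperbolic s" and m: "m \<ge> 1"
    and commute: "\<And>t. t \<in> S \<Longrightarrow> t [^] (m::nat) \<otimes> s [^] m = s [^] m \<otimes> t [^] m"
  obtains ys where "cyclically_red ys" "end_stab ys = carrier G"
proof -
  obtain h xs where h: "h \<in> carrier G" "cyclically_red xs" "conj_by h s = word_prod xs"
    using s(2) by (auto simp: hyperbolic_def)
  define ys where "ys = list_power m xs"
  have ys: "cyclically_red ys" "word_prod ys = conj_by h s [^] m"
    using cyclically_red_list_power[OF h(2) m] word_prod_list_power[OF h(2)] h(3)
    by (simp_all add: ys_def)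
  have "conj_by h t \<in> end_stab ys" if t: "t \<in> S" for t
  proof (rule commute_pow_imp_mem_end_stab[OF ys(1) _ m])
    show "conj_by h t \<in> carrier G" using h(1) S(1) t by auto
    show "conj_by h t [^] m \<otimes> word_prod ys = word_prod ys \<otimes> conj_by h t [^] m"
      using conj_by_commute_pow[OF h(1) subsetD[OF S(1) t] subsetD[OF S(1) s(1)] commute[OF t]] ys(2)
      by simp
  qed
  then have "end_stab ys = carrier G"
    using generating_set_conj_by_subset_imp_eq_carrier[OF subgroup_end_stab[OF ys(1)] h(1) S] by blast
  then show ?thesis using that ys(1) by blast
qed

theorem noncommuting_powers_in_finite_generating_set:
  assumes proper: "\<And>i. P i \<noteq> carrier G"
    and V: "finite V" "V \<subseteq> P True \<union> P False" "generate G V = carrier G"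
    and S: "finite S" "S \<subseteq> carrier G" "generate G S = carrier G" and m: "m \<ge> 1"
  obtains s t where "s \<in> S" "t \<in> S" "s [^] (m::nat) \<otimes> t [^] m \<noteq> t [^] m \<otimes> s [^] m"
proof (rule ccontr)
  assume "\<not> thesis"
  then have commute: "\<And>s t. s \<in> S \<Longrightarrow> t \<in> S \<Longrightarrow> s [^] m \<otimes> t [^] m = t [^] m \<otimes> s [^] m"
    using that by blast
  show False
  proof (cases "\<forall>s\<in>S. elliptic s")
    case True
    then obtain h k where "h \<in> carrier G" "\<forall>s\<in>S. conj_by h s \<in> P k"
      using elliptic_common_conjugator[OF S(1,2) _ m commute] by blast
    then have "P k = carrier G"
      using generating_set_conj_by_subset_imp_eq_carrier[OF P_subgroup _ S(2,3)] by blast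
    then show False using proper by blast
  next
    case False
    then obtain s where s: "s \<in> S" "hyperbolic s" using elliptic_or_hyperbolic S(2) by blast
    obtain ys where "cyclically_red ys" "end_stab ys = carrier G"
      using hyperbolic_generator_fixes_end[OF S(2,3) s m commute[OF _ s(1)]] by blast
    then have "carrier G = C" using carrier_eq_C_if_fixes_end V by blast
    then show False using proper[of True] C_subset_P[of True] subgroup.subset[OF P_subgroup[of True]]
      by blast
  qed
qed

end

subsection \<open>Subgroups generated by subgroups of the factors\<close>

context amalgam
begin

lemma word_prod_pow_prefix:
  assumes zs: "cyclically_red zs" and ys: "red ys" and eq: "word_prod zs [^] (n::nat) = word_prod ys"
    and n: "n \<ge> 2"
  obtains c d where "c \<in> C" "d \<in> C" "word_prod zs = word_prod (take (length zs) ys) \<otimes> d"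
    "length zs < length ys" "fst (ys ! length zs) = fst (hd ys)"
    "snd (ys ! length zs) = d \<otimes> snd (hd ys) \<otimes> c"
proof -
  define l where "l = length zs"
  obtain k where k: "n = Suc (Suc k)" using n by (metis add_2_eq_Suc le_Suc_ex)
  note zs_red = cyclically_redD[OF zs]
  have tail_red: "red (list_power (Suc k) zs)" and carrier: "word_prod zs \<in> carrier G"
    using red_list_power[OF zs, of "Suc k"] zs_red(1) by auto
  note word = red_list_power[OF zs, of n]
  have same: "\<one> \<otimes> word_prod (list_power n zs) = word_prod ys \<otimes> \<one>"
    using word_prod_list_power[OF zs] eq word ys by simp
  have "length ys = n * l" using red_unique_length[OF word ys C_one C_one same] by (simp add: l_def)
  then have l: "l < length ys" using k zs_red(2) by (simp add: l_def)
  obtain i x zs' where z: "zs = (i, x) # zs'" using zs_red(2) by (metis list.exhaust surj_pair)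
  obtain j y ys' where y: "ys = (j, y) # ys'" using l by (cases ys) auto
  have first: "i = j" "inv y \<otimes> \<one> \<otimes> x \<in> C"
    using red_unique_head[of i x "zs' @ list_power (Suc k) zs" j y ys' \<one> \<one>] word ys same y z k by auto
  obtain d where d: "d \<in> C" "word_prod zs = word_prod (take l ys) \<otimes> d"
    using red_unique_prefix[OF word ys C_one C_one same, of l] k carrier by (auto simp: l_def)
  obtain j2 y2 where y2: "ys ! l = (j2, y2)" by force
  then have drop: "drop l ys = (j2, y2) # drop (Suc l) ys" using Cons_nth_drop_Suc[OF l] by simp
  have drop_red: "red (drop l ys)" using ys by (rule reduced_drop)
  have "d \<otimes> word_prod (list_power (Suc k) zs) = word_prod (drop l ys) \<otimes> \<one>"
    using red_unique_suffix[OF word ys C_one C_one d(1) same, of l] d(2) carrier k by (simp add: l_def)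
  then have second: "i = j2" "inv y2 \<otimes> d \<otimes> x \<in> C"
    using red_unique_head[of i x "zs' @ list_power k zs" j2 y2 "drop (Suc l) ys" d \<one>]
      tail_red drop_red d(1) drop z by auto
  have syllables: "x \<in> carrier G" "y \<in> carrier G" "y2 \<in> carrier G"
    using zs_red(1) ys drop_red y z drop by (auto simp: reduced_Cons)
  define c where "c = (inv y \<otimes> \<one> \<otimes> x) \<otimes> inv (inv y2 \<otimes> d \<otimes> x)"
  have "c \<in> C" using first(2) second(2) by (simp add: c_def)
  moreover have "y2 = d \<otimes> y \<otimes> c"
    using syllables d(1) by (simp add: c_def m_assoc inv_mult_group)
  ultimately show ?thesis using that d l first(1) second(1) y y2 by (simp add: l_def)
qed

end

locale amalgam_subgroups = amalgam +
  fixes B :: "bool \<Rightarrow> 'a set"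
  assumes B_subgroup: "\<And>i. subgroup (B i) G"
    and B_subset_P: "\<And>i. B i \<subseteq> P i"
    and B_inter_C: "\<And>i. B i \<inter> C = {\<one>}"
begin

sublocale B: two_subgroups G B "{\<one>}"
proof (intro two_subgroups.intro two_subgroups_axioms.intro group_axioms B_subgroup triv_subgroup)
  show "{\<one>} \<subseteq> B i" for i using subgroup.one_closed[OF B_subgroup] by simp
qed

abbreviation H :: "'a set" where "H \<equiv> generate G (B True \<union> B False)"

lemma H_subgroup: "subgroup H G"
  by (intro generate_is_subgroup) auto

lemma B_subset_H: "B i \<subseteq> H"
  by (cases i) (auto intro: generate.incl)

lemma red_if_B_red: "B.red xs \<Longrightarrow> red xs"
  using B_subset_P B_inter_C unfolding reduced_def by blast

lemma mem_H_imp_word_prod: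
  assumes "h \<in> H"
  obtains xs where "B.red xs" "h = word_prod xs"
proof -
  obtain xs where "represents B {\<one>} xs h" using B.represents_exists[OF assms] .
  then show ?thesis using that by (auto elim!: representsE)
qed

lemma word_prod_mem_H: "\<forall>x\<in>set xs. snd x \<in> B (fst x) \<Longrightarrow> word_prod xs \<in> H"
proof (induction xs)
  case (Cons x xs)
  then have "snd x \<in> H" using B_subset_H by auto
  then show ?case using Cons by (auto intro: generate.eng)
qed (simp add: generate.one)

lemma H_inter_C: "H \<inter> C = {\<one>}"
proof -
  have "h = \<one>" if h: "h \<in> H" "h \<in> C" for h
  proof -
    obtain xs where xs: "B.red xs" "h = word_prod xs" using mem_H_imp_word_prod[OF h(1)] .
    then have "xs = []" using word_prod_red_notin_C[OF red_if_B_red] h(2) by blast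
    then show ?thesis using xs by simp
  qed
  then show ?thesis using generate.one by auto
qed

lemma H_separated:
  assumes "\<And>i. separated C (B i)"
  shows "separated C H"
  unfolding separated_def
proof (intro ballI impI)
  fix z z' h assume z: "z \<in> C" "z' \<in> C" and h: "h \<in> H" "h \<noteq> \<one>" and zhz: "z \<otimes> h \<otimes> z' \<in> H"
  obtain xs where xs: "B.red xs" "h = word_prod xs" using mem_H_imp_word_prod[OF h(1)] .
  obtain ys where ys: "B.red ys" "z \<otimes> h \<otimes> z' = word_prod ys" using mem_H_imp_word_prod[OF zhz] .
  have red: "red xs" "red ys" using red_if_B_red xs ys by auto
  have eq: "z \<otimes> word_prod xs = word_prod ys \<otimes> inv z'"
    using xs(2) ys(2)[symmetric] z word_prod_red[OF red(1)] by (simp add: m_assoc)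
  have "xs \<noteq> []" using h(2) xs(2) by auto
  moreover have "ys \<noteq> []"
    using red_unique_Nil_iff[OF red z(1) C_inv[OF z(2)] eq] calculation by simp
  ultimately obtain i x xs' j y ys' where words: "xs = (i, x) # xs'" "ys = (j, y) # ys'"
    by (metis list.exhaust surj_pair)
  note head = red_unique_head[OF red[unfolded words] z(1) C_inv[OF z(2)] eq[unfolded words]]
  have B: "x \<in> B i" "x \<noteq> \<one>" "y \<in> B i" using xs ys words head(1) by (auto simp: reduced_Cons)
  then have carrier: "x \<in> carrier G" "y \<in> carrier G" by auto
  have "z \<otimes> x \<otimes> inv (inv y \<otimes> z \<otimes> x) = y"
    using z carrier by (simp add: m_assoc inv_mult_group)
  then show "z = \<one>"
    using separatedD[OF assms z(1) C_inv[OF head(2)] B(1,2)] B(3) by simp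
qed

lemma cyclically_red_True_root_mem_H:
  assumes sep: "separated C (B True)" and ys: "B.red ys" "cyclically_red ys" "fst (hd ys)"
    and g: "g \<in> carrier G" "n \<ge> 1" "g [^] (n::nat) = word_prod ys"
  shows "g \<in> H"
proof (cases "n = 1")
  case True
  then show ?thesis using g ys(1) word_prod_mem_H[of ys] by (auto simp: reduced_def)
next
  case False
  note ys_red = cyclically_redD[OF ys(2)]
  have "g \<otimes> word_prod ys = word_prod ys \<otimes> g" using pow_commute_self[OF g(1), of n] g(3) by simp
  moreover have "g \<notin> C" using g(3) word_prod_red_notin_C[OF ys_red(1,2)] C_pow by metis
  ultimately obtain zs where zs: "cyclically_red zs" "g = word_prod zs"
    using commute_imp_cyclically_red[OF ys(2) g(1)] by metis
  obtain c d where root: "c \<in> C" "d \<in> C" "g = word_prod (take (length zs) ys) \<otimes> d"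
    "length zs < length ys" "fst (ys ! length zs) = fst (hd ys)"
    "snd (ys ! length zs) = d \<otimes> snd (hd ys) \<otimes> c"
    using word_prod_pow_prefix[OF zs(1) ys_red(1), of n] g False zs(2) by auto
  have B: "snd y \<in> B (fst y)" "snd y \<noteq> \<one>" if "y \<in> set ys" for y
    using ys(1) that by (auto simp: reduced_def)
  have "d \<otimes> snd (hd ys) \<otimes> c \<in> B True"
    using B(1)[OF nth_mem[OF root(4)]] root(5,6) ys(3) by simp
  then have "d = \<one>"
    using separatedD[OF sep root(2,1)] B[OF hd_in_set[OF ys_red(2)]] ys(3) by simp
  then have "g = word_prod (take (length zs) ys)"
    using root(3) reduced_take[OF ys_red(1)] by simp
  moreover have "\<forall>y\<in>set (take (length zs) ys). snd y \<in> B (fst y)"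
    using B(1) by (auto dest: in_set_takeD)
  ultimately show ?thesis using word_prod_mem_H by blast
qed

lemma conj_by_rotate_word_prod:
  assumes "B.red ((i, b) # xs)"
  shows "conj_by b (word_prod ((i, b) # xs)) = word_prod (xs @ [(i, b)])"
  using assms B.word_prod_red_append[of xs "[(i, b)]"]
  by (auto simp: conj_by_def reduced_Cons m_assoc)

lemma cyclically_red_root_mem_H:
  assumes sep: "separated C (B True)" and ys: "B.red ys" "cyclically_red ys"
    and g: "g \<in> carrier G" "n \<ge> 1" "g [^] (n::nat) = word_prod ys"
  shows "g \<in> H"
proof (cases "fst (hd ys)")
  case True
  then show ?thesis by (rule cyclically_red_True_root_mem_H[OF sep ys _ g])
next
  case False
  note ys_red = cyclically_redD[OF ys(2)]
  then obtain i b xs where word: "ys = (i, b) # xs" by (metis list.exhaust surj_pair)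
  then have xs: "xs \<noteq> []" "\<not> i" "fst (last xs)" using ys_red(3) False by (auto split: if_splits)
  have b: "b \<in> B i" "b \<noteq> \<one>" "B.red xs" "fst (hd xs) \<noteq> i"
    using ys(1) word xs(1) by (auto simp: reduced_Cons)
  let ?ys = "xs @ [(i, b)]"
  have rotated: "B.red ?ys" using xs b by (auto simp: reduced_append reduced_Cons)
  moreover have "cyclically_red ?ys"
    using red_if_B_red[OF rotated] b(4) xs(1) by (auto simp: cyclically_red_def)
  moreover have "conj_by b g [^] n = word_prod ?ys"
    using conj_by_rotate_word_prod ys(1) g b(1) unfolding word by (simp flip: conj_by_pow)
  moreover have "fst (hd ?ys)" using xs(1,2) b(4) by simp
  ultimately have "conj_by b g \<in> H"
    using cyclically_red_True_root_mem_H[OF sep] b(1) g(1,2) by simp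
  then show ?thesis using conj_by_mem_subgroup_iff[OF H_subgroup _ g(1)] b(1) B_subset_H by blast
qed

lemma root_mem_H:
  assumes iso: "isolated_amalgam G P C" and B_iso: "\<And>i. isolated_in (P i) (B i)"
    and sep: "separated C (B True)"
    and "B.red ys" "g \<in> carrier G" "g [^] (n::nat) = word_prod ys" and n: "n \<ge> 1"
  shows "g \<in> H"
  using assms(4-6)
proof (induction "length ys" arbitrary: ys g rule: less_induct)
  case less
  note ys = less.prems(1) and g = less.prems(2,3)
  consider "length ys \<le> 1" | "length ys \<ge> 2" "fst (hd ys) = fst (last ys)"
    | "length ys \<ge> 2" "fst (hd ys) \<noteq> fst (last ys)" by linarith
  then show ?case
  proof cases
    case 1
    then consider "ys = []" | y where "ys = [y]" by (cases ys) auto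
    then obtain i where i: "g [^] n \<in> B i"
      using g(2) ys by cases (auto simp: reduced_Cons)
    then have "g \<in> P i"
      using isolated_inD[OF isolated_amalgam.P_isolated[OF iso] g(1)] n B_subset_P by blast
    then show ?thesis using isolated_inD[OF B_iso _ i n] B_subset_H by blast
  next
    case 2
    obtain ys' where ys': "B.red ys'" "length ys' < length ys"
      "conj_by (snd (hd ys)) (word_prod ys) = word_prod ys'"
      using B.red_cyclic_reduction[OF ys 2] by blast
    have "ys \<noteq> []" using 2(1) by auto
    then have b: "snd (hd ys) \<in> B (fst (hd ys))" using ys by (auto simp: reduced_def)
    then have "conj_by (snd (hd ys)) g [^] n = word_prod ys'"
      using ys'(3) g by (simp flip: conj_by_pow)
    then have "conj_by (snd (hd ys)) g \<in> H"
      using less.hyps[OF ys'(2,1)] b g(1) by simp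
    then show ?thesis using conj_by_mem_subgroup_iff[OF H_subgroup _ g(1)] b B_subset_H by blast
  next
    case 3
    then have "ys \<noteq> []" by auto
    then have "cyclically_red ys" using red_if_B_red[OF ys] 3(2) by (simp add: cyclically_red_def)
    then show ?thesis by (rule cyclically_red_root_mem_H[OF sep ys _ g(1) n g(2)])
  qed
qed

lemma H_isolated:
  assumes "isolated_amalgam G P C" "\<And>i. isolated_in (P i) (B i)" "separated C (B True)"
  shows "isolated_in (carrier G) H"
proof (rule isolated_inI)
  fix g and n :: nat assume g: "g \<in> carrier G" "n \<ge> 1" and pow: "g [^] n \<in> H"
  obtain ys where "B.red ys" "g [^] n = word_prod ys" using mem_H_imp_word_prod[OF pow] .
  then show "g \<in> H" using root_mem_H[OF assms] g by blast
qed

text \<open>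
  The product of \<open>B True\<close> and \<open>B False\<close> in \<open>G\<close> is free, as their normal forms are normal forms
  of \<open>G\<close>.
\<close>

lemma hom_trivial_kernel_if_trivial_on_factors:
  assumes "group_hom M G h" "two_subgroups M P' {\<one>\<^bsub>M\<^esub>}"
    and gen: "generate M (P' True \<union> P' False) = carrier M"
    and into_B: "\<And>i x. x \<in> P' i \<Longrightarrow> h x \<in> B i"
    and kernel: "\<And>i x. x \<in> P' i \<Longrightarrow> h x = \<one> \<Longrightarrow> x = \<one>\<^bsub>M\<^esub>"
    and x: "x \<in> carrier M" "h x = \<one>"
  shows "x = \<one>\<^bsub>M\<^esub>"
proof -
  interpret M: two_subgroups M P' "{\<one>\<^bsub>M\<^esub>}" by fact
  interpret h: group_hom M G h by fact
  obtain xs where "M.represents P' {\<one>\<^bsub>M\<^esub>} xs x" using M.represents_exists x(1) gen by metis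
  then have xs: "M.red xs" "x = M.word_prod xs" by (auto elim!: M.representsE)
  have "B.red (map (map_prod id h) xs) \<and> word_prod (map (map_prod id h) xs) = h (M.word_prod xs)"
    using xs(1)
  proof (induction xs)
    case (Cons y ys)
    obtain i z where y: "y = (i, z)" by force
    have z: "z \<in> P' i" "z \<noteq> \<one>\<^bsub>M\<^esub>" "M.red ys" "ys \<noteq> [] \<Longrightarrow> i \<noteq> fst (hd ys)"
      using Cons.prems y by (auto simp: M.reduced_Cons)
    moreover have "h z \<in> B i" "h z \<noteq> \<one>" using into_B kernel z by blast+
    moreover have "h (M.word_prod (y # ys)) = h z \<otimes> h (M.word_prod ys)"
      using y z M.word_prod_red[OF z(3)] M.P_carrier[OF z(1)] by simp
    ultimately show ?case using Cons.IH y by (auto simp: reduced_Cons hd_map)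
  qed simp
  then have "map (map_prod id h) xs = []"
    using normal_form[OF red_if_B_red] x(2) xs(2) by metis
  then show ?thesis using xs(2) by simp
qed

end

subsection \<open>Presented groups\<close>

lemma gwords_iff: "w \<in> gwords X \<longleftrightarrow> fst ` set w \<subseteq> X"
  by (auto simp: gwords_def)

lemma gwords_Nil [simp]: "[] \<in> gwords X"
  and gwords_Cons [simp]: "(x, b) # w \<in> gwords X \<longleftrightarrow> x \<in> X \<and> w \<in> gwords X"
  and gwords_append [simp]: "u @ v \<in> gwords X \<longleftrightarrow> u \<in> gwords X \<and> v \<in> gwords X"
  by (auto simp: gwords_def)

lemma gwords_mono: "X \<subseteq> Y \<Longrightarrow> gwords X \<subseteq> gwords Y"
  by (auto simp: gwords_def)

lemma list_power_gwords: "w \<in> gwords X \<Longrightarrow> list_power n w \<in> gwords X"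
  by (induction n) auto

definition gword_inv :: "'a gword \<Rightarrow> 'a gword" where
  "gword_inv w = rev (map (\<lambda>(x, b). (x, \<not> b)) w)"

lemma gword_inv_Nil [simp]: "gword_inv [] = []"
  and gword_inv_Cons: "gword_inv ((x, b) # w) = gword_inv w @ [(x, \<not> b)]"
  by (simp_all add: gword_inv_def)

lemma gword_inv_gwords [simp]: "gword_inv w \<in> gwords X \<longleftrightarrow> w \<in> gwords X"
  by (induction w) (auto simp: gword_inv_Cons)

definition exponent_sum :: "'a gword \<Rightarrow> int" where
  "exponent_sum w = (\<Sum>a\<leftarrow>w. if snd a then 1 else - 1)"

lemma exponent_sum_simps [simp]:
  "exponent_sum [] = 0"
  "exponent_sum (a # w) = (if snd a then 1 else - 1) + exponent_sum w"
  "exponent_sum (u @ v) = exponent_sum u + exponent_sum v"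
  by (simp_all add: exponent_sum_def)

lemma exponent_sum_gword_inv [simp]: "exponent_sum (gword_inv w) = - exponent_sum w"
  by (induction w) (auto simp: gword_inv_Cons)

lemma exponent_sum_list_power [simp]: "exponent_sum (list_power n w) = int n * exponent_sum w"
  by (induction n) (auto simp: algebra_simps)

definition gword_eval :: "('g, 'm) monoid_scheme \<Rightarrow> ('a \<Rightarrow> 'g) \<Rightarrow> 'a gword \<Rightarrow> 'g" where
  "gword_eval G f w =
     foldr (\<lambda>a y. (if snd a then f (fst a) else inv\<^bsub>G\<^esub> (f (fst a))) \<otimes>\<^bsub>G\<^esub> y) w \<one>\<^bsub>G\<^esub>"

lemma gword_eval_Nil [simp]: "gword_eval G f [] = \<one>\<^bsub>G\<^esub>"
  and gword_eval_Cons [simp]: "gword_eval G f ((x, b) # w) =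
    (if b then f x else inv\<^bsub>G\<^esub> (f x)) \<otimes>\<^bsub>G\<^esub> gword_eval G f w"
  by (simp_all add: gword_eval_def)

lemma gword_eval_cong:
  "w \<in> gwords X \<Longrightarrow> (\<And>x. x \<in> X \<Longrightarrow> f x = g x) \<Longrightarrow> gword_eval G f w = gword_eval G g w"
  by (induction w) auto

context group
begin

lemma gword_eval_closed [simp]:
  "w \<in> gwords X \<Longrightarrow> f \<in> X \<rightarrow> carrier G \<Longrightarrow> gword_eval G f w \<in> carrier G"
proof (induction w)
  case (Cons a w)
  then show ?case by (cases a) (auto simp: Pi_iff)
qed simp

lemma gword_eval_append:
  assumes "u \<in> gwords X" "v \<in> gwords X" "f \<in> X \<rightarrow> carrier G"
  shows "gword_eval G f (u @ v) = gword_eval G f u \<otimes> gword_eval G f v"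
  using assms(1)
proof (induction u)
  case Nil
  then show ?case using assms by simp
next
  case (Cons a u)
  obtain x b where a: "a = (x, b)" by force
  have "gword_eval G f u \<in> carrier G" "gword_eval G f v \<in> carrier G" "f x \<in> carrier G"
    using assms Cons.prems a by (auto simp: Pi_iff)
  then show ?case using Cons a by (simp add: m_assoc)
qed

lemma gword_eval_inv:
  assumes "w \<in> gwords X" "f \<in> X \<rightarrow> carrier G"
  shows "gword_eval G f (gword_inv w) = inv (gword_eval G f w)"
  using assms(1)
proof (induction w)
  case (Cons a w)
  obtain x b where a: "a = (x, b)" by force
  have carrier: "gword_eval G f w \<in> carrier G" "f x \<in> carrier G" and w: "w \<in> gwords X" "x \<in> X"
    using assms Cons.prems a by (auto simp: Pi_iff)
  then show ?case
    using Cons a gword_eval_append[of "gword_inv w" X "[(x, \<not> b)]" f] assms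
    by (simp add: gword_inv_Cons inv_mult_group)
qed simp

lemma gword_eval_single_letter:
  assumes "w \<in> gwords {x}" "f x \<in> carrier G"
  shows "gword_eval G f w = f x [^] exponent_sum w"
  using assms(1)
proof (induction w)
  case (Cons a w)
  obtain b where a: "a = (x, b)" using Cons.prems by (cases a) auto
  have "gword_eval G f w = f x [^] exponent_sum w" using Cons a by simp
  moreover have "f x [^] (1 + n) = f x \<otimes> f x [^] n" for n :: int
    using int_pow_mult[OF assms(2), of 1 n] assms(2) by simp
  moreover have "f x [^] (- 1 + n) = inv (f x) \<otimes> f x [^] n" for n :: int
    using int_pow_mult[OF assms(2), of "- 1" n] assms(2) by (simp add: int_pow_neg)
  ultimately show ?case using a by simp
qed simp

lemma pres_cong_gword_eval:
  assumes f: "f \<in> X \<rightarrow> carrier G"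
    and relations: "\<And>u v. (u, v) \<in> R \<Longrightarrow> u \<in> gwords X \<Longrightarrow> v \<in> gwords X \<Longrightarrow>
      gword_eval G f u = gword_eval G f v"
    and "pres_cong X R u v"
  shows "gword_eval G f u = gword_eval G f v"
  using assms(3)
proof (induction rule: pres_cong.induct)
  case (append u u' v v')
  then show ?case using pres_cong_gwords gword_eval_append f by metis
next
  case (cancel x b)
  then have "f x \<in> carrier G" using f by blast
  then show ?case by simp
qed (use relations in auto)

end

lemma (in group_hom) gword_eval_hom:
  assumes "w \<in> gwords X" "f \<in> X \<rightarrow> carrier G"
  shows "gword_eval H (\<lambda>x. h (f x)) w = h (gword_eval G f w)"
  using assms(1)
proof (induction w)
  case (Cons a w)
  obtain x b where a: "a = (x, b)" by force
  have "gword_eval G f w \<in> carrier G" "f x \<in> carrier G"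
    using assms Cons.prems a by (auto simp: Pi_iff)
  then show ?case using Cons a by simp
qed simp

lemma carrier_presented: "carrier (presented_group X R) = pres_class X R ` gwords X"
  and one_presented: "\<one>\<^bsub>presented_group X R\<^esub> = pres_class X R []"
  by (simp_all add: presented_group_def)

lemma pres_class_closed [simp]:
  "w \<in> gwords X \<Longrightarrow> pres_class X R w \<in> carrier (presented_group X R)"
  by (simp add: carrier_presented)

lemma pres_class_eq_one_iff:
  "w \<in> gwords X \<Longrightarrow> pres_class X R w = \<one>\<^bsub>presented_group X R\<^esub> \<longleftrightarrow> pres_cong X R w []"
  by (simp add: one_presented pres_class_eq_iff)

lemma pres_cong_append_gword_inv:
  "w \<in> gwords X \<Longrightarrow> pres_cong X R (w @ gword_inv w) []"
proof (induction w)
  case Nil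
  then show ?case by (simp add: pres_cong.refl)
next
  case (Cons a w)
  obtain x b where a: "a = (x, b)" by force
  have x: "x \<in> X" "w \<in> gwords X" using Cons.prems a by auto
  have "pres_cong X R ([(x, b)] @ (w @ gword_inv w) @ [(x, \<not> b)]) ([(x, b)] @ [] @ [(x, \<not> b)])"
    using x Cons.IH by (intro pres_cong.append pres_cong.refl) auto
  then have "pres_cong X R (a # w @ gword_inv (a # w)) [(x, b), (x, \<not> b)]"
    using a by (simp add: gword_inv_Cons)
  then show ?case using pres_cong.cancel[OF x(1)] pres_cong.trans by fastforce
qed

lemma inv_pres_class:
  assumes "w \<in> gwords X"
  shows "inv\<^bsub>presented_group X R\<^esub> (pres_class X R w) = pres_class X R (gword_inv w)"
proof -
  interpret Q: group "presented_group X R" by (rule group_presented_group)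
  have "pres_class X R w \<otimes>\<^bsub>presented_group X R\<^esub> pres_class X R (gword_inv w) = \<one>\<^bsub>presented_group X R\<^esub>"
    using assms pres_cong_append_gword_inv[OF assms]
    by (simp add: presented_group_mult pres_class_eq_one_iff)
  from Q.inv_equality[OF Q.inv_comm[OF this]] show ?thesis using assms by simp
qed

lemma pres_class_eq_iff_inv_append:
  assumes "u \<in> gwords X" "v \<in> gwords X"
  shows "pres_class X R u = pres_class X R v \<longleftrightarrow> pres_cong X R (gword_inv v @ u) []"
proof -
  let ?Q = "presented_group X R"
  interpret Q: group ?Q by (rule group_presented_group)
  have "pres_cong X R (gword_inv v @ u) [] \<longleftrightarrow>
      inv\<^bsub>?Q\<^esub> (pres_class X R v) \<otimes>\<^bsub>?Q\<^esub> pres_class X R u = \<one>\<^bsub>?Q\<^esub>"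
    using assms by (simp add: inv_pres_class presented_group_mult pres_class_eq_one_iff)
  then show ?thesis using assms by (simp add: Q.inv_solve_left')
qed

lemma gword_eval_pres_class:
  assumes "w \<in> gwords U" "U \<subseteq> X"
  shows "gword_eval (presented_group X R) (\<lambda>x. pres_class X R [(x, True)]) w = pres_class X R w"
  using assms(1)
proof (induction w)
  case Nil
  then show ?case by (simp add: one_presented)
next
  case (Cons a w)
  obtain x b where a: "a = (x, b)" by force
  have x: "x \<in> X" "w \<in> gwords X" using Cons.prems a assms(2) gwords_mono by auto
  have "(if b then pres_class X R [(x, True)]
        else inv\<^bsub>presented_group X R\<^esub> (pres_class X R [(x, True)])) = pres_class X R [(x, b)]"
    using x by (simp add: inv_pres_class gword_inv_Cons)
  then show ?case
    using Cons a x presented_group_mult[of "[(x, b)]" X w R] by simp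
qed

lemma pres_class_pow:
  assumes "w \<in> gwords X"
  shows "pres_class X R w [^]\<^bsub>presented_group X R\<^esub> (n::nat) = pres_class X R (list_power n w)"
proof (induction n)
  case 0
  then show ?case by (simp add: one_presented)
next
  case (Suc n)
  interpret Q: group "presented_group X R" by (rule group_presented_group)
  show ?case
    using Suc assms Q.nat_pow_Suc2[of "pres_class X R w" n]
    by (simp add: presented_group_mult list_power_gwords del: Q.nat_pow_Suc nat_pow_Suc)
qed

definition presented_lift :: "('g, 'm) monoid_scheme \<Rightarrow> ('a \<Rightarrow> 'g) \<Rightarrow> 'a gword set \<Rightarrow> 'g" where
  "presented_lift G f A = gword_eval G f (SOME w. w \<in> A)"

context group
begin

lemma presented_lift_pres_class:
  assumes f: "f \<in> X \<rightarrow> carrier G"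
    and relations: "\<And>u v. (u, v) \<in> R \<Longrightarrow> u \<in> gwords X \<Longrightarrow> v \<in> gwords X \<Longrightarrow>
      gword_eval G f u = gword_eval G f v"
    and w: "w \<in> gwords X"
  shows "presented_lift G f (pres_class X R w) = gword_eval G f w"
proof -
  have "w \<in> pres_class X R w" using w by (simp add: pres_class_def pres_cong.refl)
  then have "(SOME v. v \<in> pres_class X R w) \<in> pres_class X R w" by (rule someI)
  then show ?thesis
    using pres_cong_gword_eval[OF f relations] by (auto simp: presented_lift_def pres_class_def)
qed

lemma group_hom_presented_lift:
  assumes f: "f \<in> X \<rightarrow> carrier G"
    and relations: "\<And>u v. (u, v) \<in> R \<Longrightarrow> u \<in> gwords X \<Longrightarrow> v \<in> gwords X \<Longrightarrow>
      gword_eval G f u = gword_eval G f v"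
  shows "group_hom (presented_group X R) G (presented_lift G f)"
proof (intro group_hom.intro group_hom_axioms.intro group_presented_group group_axioms homI)
  note lift = presented_lift_pres_class[OF f relations]
  fix x y assume "x \<in> carrier (presented_group X R)" "y \<in> carrier (presented_group X R)"
  then obtain u v where "u \<in> gwords X" "x = pres_class X R u" "v \<in> gwords X" "y = pres_class X R v"
    by (auto simp: carrier_presented)
  then show "presented_lift G f x \<in> carrier G"
    and "presented_lift G f (x \<otimes>\<^bsub>presented_group X R\<^esub> y) = presented_lift G f x \<otimes> presented_lift G f y"
    using lift f by (simp_all add: presented_group_mult gword_eval_append[OF _ _ f])
qed

end

lemma pres_cong_mono:
  assumes "pres_cong U R u v" "U \<subseteq> W"
  shows "pres_cong W R u v"
  using assms(1)
  by (induction rule: pres_cong.induct)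
    (use assms(2) gwords_mono[OF assms(2)] in \<open>auto intro: pres_cong.intros\<close>)

lemma pres_class_mono:
  assumes "U \<subseteq> W" "u \<in> gwords U" "pres_class U R u = pres_class U R v"
  shows "pres_class W R u = pres_class W R v"
proof -
  have "u \<in> gwords W" using assms(2) gwords_mono[OF assms(1)] by blast
  moreover have "pres_cong W R u v" using assms by (simp add: pres_class_eq_iff pres_cong_mono)
  ultimately show ?thesis by (simp add: pres_class_eq_iff)
qed

subsection \<open>Parabolic subgroups of presented groups\<close>

definition parabolic :: "('a gword \<times> 'a gword) set \<Rightarrow> 'a set \<Rightarrow> 'a set \<Rightarrow> 'a gword set set" where
  "parabolic R W U = pres_class W R ` gwords U"

text \<open>The natural homomorphism from the group presented on \<open>U\<close> to the one on \<open>W\<close> is injective.\<close>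

definition embeds :: "('a gword \<times> 'a gword) set \<Rightarrow> 'a set \<Rightarrow> 'a set \<Rightarrow> bool" where
  "embeds R U W \<longleftrightarrow> (\<forall>w\<in>gwords U. pres_cong W R w [] \<longrightarrow> pres_cong U R w [])"

lemma pres_class_mem_parabolic [simp, intro]: "w \<in> gwords U \<Longrightarrow> pres_class W R w \<in> parabolic R W U"
  by (simp add: parabolic_def)

lemma parabolicE:
  assumes "g \<in> parabolic R W U"
  obtains w where "w \<in> gwords U" "g = pres_class W R w"
  using assms by (auto simp: parabolic_def)

lemma parabolic_mono: "U \<subseteq> U' \<Longrightarrow> parabolic R W U \<subseteq> parabolic R W U'"
  using gwords_mono[of U U'] by (auto simp: parabolic_def)

lemma parabolic_self: "parabolic R W W = carrier (presented_group W R)"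
  by (simp add: parabolic_def carrier_presented)

lemma parabolic_empty: "parabolic R W {} = {\<one>\<^bsub>presented_group W R\<^esub>}"
  by (auto simp: parabolic_def gwords_iff one_presented)

lemma subgroup_parabolic:
  assumes "U \<subseteq> W"
  shows "subgroup (parabolic R W U) (presented_group W R)"
proof -
  interpret Q: group "presented_group W R" by (rule group_presented_group)
  note gwords = subsetD[OF gwords_mono[OF assms]]
  show ?thesis
  proof (rule Q.subgroupI)
    show "parabolic R W U \<subseteq> carrier (presented_group W R)"
      using gwords by (auto elim!: parabolicE)
    show "parabolic R W U \<noteq> {}" using gwords_Nil[of U] by blast
    show "inv\<^bsub>presented_group W R\<^esub> a \<in> parabolic R W U" if "a \<in> parabolic R W U" for a
      using that gwords by (auto simp: inv_pres_class elim!: parabolicE)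
    show "a \<otimes>\<^bsub>presented_group W R\<^esub> b \<in> parabolic R W U"
      if "a \<in> parabolic R W U" "b \<in> parabolic R W U" for a b
      using that gwords by (auto simp: presented_group_mult elim!: parabolicE)
  qed
qed

lemma generate_letters:
  assumes "U \<subseteq> W"
  shows "generate (presented_group W R) ((\<lambda>x. pres_class W R [(x, True)]) ` U) = parabolic R W U"
proof
  let ?Q = "presented_group W R" and ?letters = "(\<lambda>x. pres_class W R [(x, True)]) ` U"
  interpret Q: group ?Q by (rule group_presented_group)
  show "generate ?Q ?letters \<subseteq> parabolic R W U"
    by (rule Q.generate_subgroup_incl[OF _ subgroup_parabolic[OF assms]]) auto
  show "parabolic R W U \<subseteq> generate ?Q ?letters"
  proof
    fix a assume "a \<in> parabolic R W U"
    then obtain w where w: "w \<in> gwords U" "a = pres_class W R w" by (rule parabolicE)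
    have "gword_eval ?Q (\<lambda>x. pres_class W R [(x, True)]) w \<in> generate ?Q ?letters"
      using w(1)
    proof (induction w)
      case Nil
      then show ?case by (simp add: generate.one)
    next
      case (Cons b w)
      then show ?case by (cases b) (auto intro!: generate.eng intro: generate.incl generate.inv)
    qed
    then show "a \<in> generate ?Q ?letters" using w gword_eval_pres_class[OF w(1) assms] by simp
  qed
qed

lemma generate_parabolic:
  assumes "U1 \<union> U2 \<subseteq> W"
  shows "generate (presented_group W R) (parabolic R W U1 \<union> parabolic R W U2) = parabolic R W (U1 \<union> U2)"
proof
  let ?Q = "presented_group W R"
  interpret Q: group ?Q by (rule group_presented_group)
  show "generate ?Q (parabolic R W U1 \<union> parabolic R W U2) \<subseteq> parabolic R W (U1 \<union> U2)"
    using parabolic_mono[of _ "U1 \<union> U2" R W]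
    by (intro Q.generate_subgroup_incl[OF _ subgroup_parabolic[OF assms]]) auto
  have "(\<lambda>x. pres_class W R [(x, True)]) ` (U1 \<union> U2) \<subseteq> parabolic R W U1 \<union> parabolic R W U2"
    by auto
  then show "parabolic R W (U1 \<union> U2) \<subseteq> generate ?Q (parabolic R W U1 \<union> parabolic R W U2)"
    using Q.mono_generate generate_letters[OF assms] by metis
qed

lemma embedsD:
  assumes "embeds R U W" "U \<subseteq> W" "u \<in> gwords U" "v \<in> gwords U" "pres_class W R u = pres_class W R v"
  shows "pres_class U R u = pres_class U R v"
proof -
  have "u \<in> gwords W" "v \<in> gwords W" using assms(3,4) gwords_mono[OF assms(2)] by blast+
  then have "pres_cong W R (gword_inv v @ u) []"
    using assms(5) by (simp add: pres_class_eq_iff_inv_append)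
  then have "pres_cong U R (gword_inv v @ u) []" using assms(1,3,4) by (simp add: embeds_def)
  then show ?thesis using assms(3,4) by (simp add: pres_class_eq_iff_inv_append)
qed

lemma embeds_refl: "embeds R W W"
  by (simp add: embeds_def)

lemma embeds_empty: "embeds R {} W"
  by (auto simp: embeds_def gwords_iff intro: pres_cong.refl)

lemma embeds_trans:
  assumes "embeds R U U'" "embeds R U' W" "U \<subseteq> U'"
  shows "embeds R U W"
  using assms gwords_mono[OF assms(3)] by (auto simp: embeds_def)

definition inclusion :: "('a gword \<times> 'a gword) set \<Rightarrow> 'a set \<Rightarrow> 'a gword set \<Rightarrow> 'a gword set" where
  "inclusion R W = presented_lift (presented_group W R) (\<lambda>x. pres_class W R [(x, True)])"

lemma group_hom_inclusion:
    "U \<subseteq> W \<Longrightarrow> group_hom (presented_group U R) (presented_group W R) (inclusion R W)"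
  and inclusion_pres_class: "U \<subseteq> W \<Longrightarrow> w \<in> gwords U \<Longrightarrow> inclusion R W (pres_class U R w) = pres_class W R w"
proof -
  let ?eval = "gword_eval (presented_group W R) (\<lambda>x. pres_class W R [(x, True)])"
  assume UW: "U \<subseteq> W"
  have letters: "(\<lambda>x. pres_class W R [(x, True)]) \<in> U \<rightarrow> carrier (presented_group W R)"
    using UW by auto
  have relations: "?eval u = ?eval v" if "(u, v) \<in> R" "u \<in> gwords U" "v \<in> gwords U" for u v
  proof -
    have "pres_class U R u = pres_class U R v"
      using that by (simp add: pres_class_eq_iff pres_cong.relation)
    then have "pres_class W R u = pres_class W R v" by (rule pres_class_mono[OF UW that(2)])
    then show ?thesis using that UW by (simp add: gword_eval_pres_class)
  qed
  show "group_hom (presented_group U R) (presented_group W R) (inclusion R W)"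
    unfolding inclusion_def
    by (rule group.group_hom_presented_lift[OF group_presented_group letters relations])
  show "inclusion R W (pres_class U R w) = pres_class W R w" if "w \<in> gwords U"
    using group.presented_lift_pres_class[OF group_presented_group letters relations that] that UW
    by (simp add: inclusion_def gword_eval_pres_class)
qed

lemma inj_on_inclusion:
  assumes "embeds R U W" "U \<subseteq> W"
  shows "inj_on (inclusion R W) (carrier (presented_group U R))"
proof (rule inj_onI)
  fix x y assume xy: "x \<in> carrier (presented_group U R)" "y \<in> carrier (presented_group U R)"
    and eq: "inclusion R W x = inclusion R W y"
  obtain u v where u: "u \<in> gwords U" "x = pres_class U R u" and v: "v \<in> gwords U" "y = pres_class U R v"
    using xy by (auto simp: carrier_presented)
  have "pres_class W R u = pres_class W R v"
    using eq u v assms(2) by (simp add: inclusion_pres_class)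
  then show "x = y" using embedsD[OF assms u(1) v(1)] u(2) v(2) by simp
qed

subsection \<open>Van der Waerden's action on normal forms\<close>

type_synonym ('k, 'g) coset_form = "'k \<times> (bool \<times> 'g set) list"

locale amalgam_data =
  fixes K :: "('k, 'z) monoid_scheme" and G :: "bool \<Rightarrow> ('g, 'y) monoid_scheme"
    and f :: "bool \<Rightarrow> 'k \<Rightarrow> 'g"
  assumes hom: "\<And>i. group_hom K (G i) (f i)" and inj: "\<And>i. inj_on (f i) (carrier K)"
begin

sublocale f: group_hom K "G i" "f i" for i
  by (rule hom)

definition edge_image :: "bool \<Rightarrow> 'g set" where
  "edge_image i = f i ` carrier K"

definition preimage :: "bool \<Rightarrow> 'g \<Rightarrow> 'k" where
  "preimage i = inv_into (carrier K) (f i)"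

definition edge_coset :: "bool \<Rightarrow> 'g \<Rightarrow> 'g set" where
  "edge_coset i g = edge_image i #>\<^bsub>G i\<^esub> g"

definition rep :: "'g set \<Rightarrow> 'g" where
  "rep Y = (SOME y. y \<in> Y)"

definition coset_words :: "(bool \<times> 'g set) list set" where
  "coset_words = {l.
     (\<forall>x\<in>set l. \<exists>g\<in>carrier (G (fst x)) - edge_image (fst x). snd x = edge_coset (fst x) g) \<and>
     successively (\<lambda>x y. fst x \<noteq> fst y) l}"

definition forms :: "('k, 'g) coset_form set" where
  "forms = carrier K \<times> coset_words"

definition tails :: "bool \<Rightarrow> (bool \<times> 'g set) list set" where
  "tails i = {l \<in> coset_words. l \<noteq> [] \<longrightarrow> fst (hd l) \<noteq> i}"

definition join :: "bool \<Rightarrow> 'g \<times> (bool \<times> 'g set) list \<Rightarrow> ('k, 'g) coset_form" where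
  "join i = (\<lambda>(g, l). if g \<in> edge_image i then (preimage i g, l)
     else (preimage i (g \<otimes>\<^bsub>G i\<^esub> inv\<^bsub>G i\<^esub> (rep (edge_coset i g))), (i, edge_coset i g) # l))"

definition split :: "bool \<Rightarrow> ('k, 'g) coset_form \<Rightarrow> 'g \<times> (bool \<times> 'g set) list" where
  "split i = (\<lambda>(k, l). if l \<noteq> [] \<and> fst (hd l) = i then (f i k \<otimes>\<^bsub>G i\<^esub> rep (snd (hd l)), tl l)
     else (f i k, l))"

text \<open>
  \<open>split i\<close> identifies the normal forms with \<open>G i \<times> tails i\<close>, with inverse \<open>join i\<close>; the factor
  \<open>G i\<close> acts there by left multiplication.
\<close>

definition act :: "bool \<Rightarrow> 'g \<Rightarrow> ('k, 'g) coset_form \<Rightarrow> ('k, 'g) coset_form" where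
  "act i p w = join i (p \<otimes>\<^bsub>G i\<^esub> fst (split i w), snd (split i w))"

lemma edge_image_subgroup: "subgroup (edge_image i) (G i)"
  unfolding edge_image_def by (rule f.img_is_subgroup)

lemma edge_image_carrier [simp]: "x \<in> edge_image i \<Longrightarrow> x \<in> carrier (G i)"
  using edge_image_subgroup by (rule subgroup.mem_carrier)

lemma f_mem_edge_image [simp]: "k \<in> carrier K \<Longrightarrow> f i k \<in> edge_image i"
  by (simp add: edge_image_def)

lemma preimage_f [simp]: "k \<in> carrier K \<Longrightarrow> preimage i (f i k) = k"
  using inj by (simp add: preimage_def)

lemma f_preimage [simp]: "g \<in> edge_image i \<Longrightarrow> f i (preimage i g) = g"
  by (simp add: edge_image_def preimage_def f_inv_into_f)

lemma preimage_closed [simp]: "g \<in> edge_image i \<Longrightarrow> preimage i g \<in> carrier K"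
  by (simp add: edge_image_def preimage_def inv_into_into)

lemma rep_edge_coset:
  assumes "g \<in> carrier (G i)"
  obtains x where "x \<in> edge_image i" "rep (edge_coset i g) = x \<otimes>\<^bsub>G i\<^esub> g"
proof -
  have "g \<in> edge_coset i g"
    unfolding edge_coset_def using f.H.rcos_self[OF assms edge_image_subgroup] .
  then have "rep (edge_coset i g) \<in> edge_coset i g" unfolding rep_def by (rule someI)
  then show ?thesis using that by (auto simp: edge_coset_def r_coset_def)
qed

lemma rep_edge_coset_closed [simp]: "g \<in> carrier (G i) \<Longrightarrow> rep (edge_coset i g) \<in> carrier (G i)"
  by (rule rep_edge_coset[of g i]) auto

lemma mult_inv_rep_mem_edge_image:
  assumes "g \<in> carrier (G i)"
  shows "g \<otimes>\<^bsub>G i\<^esub> inv\<^bsub>G i\<^esub> (rep (edge_coset i g)) \<in> edge_image i"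
proof -
  obtain x where x: "x \<in> edge_image i" "rep (edge_coset i g) = x \<otimes>\<^bsub>G i\<^esub> g"
    using rep_edge_coset[OF assms] .
  then have "g \<otimes>\<^bsub>G i\<^esub> inv\<^bsub>G i\<^esub> (rep (edge_coset i g)) = inv\<^bsub>G i\<^esub> x"
    using assms by (simp add: f.H.inv_mult_group)
  then show ?thesis using x(1) edge_image_subgroup by (simp add: subgroup.m_inv_closed)
qed

lemma edge_coset_mult:
  assumes "g \<in> carrier (G i)" "x \<in> edge_image i"
  shows "edge_coset i (x \<otimes>\<^bsub>G i\<^esub> g) = edge_coset i g"
  unfolding edge_coset_def
  using assms f.H.coset_mult_assoc[of "edge_image i" i x g] subgroup.subset[OF edge_image_subgroup]
    f.H.coset_join2[OF _ edge_image_subgroup assms(2)] by simp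

lemma coset_words_cases:
  assumes "l \<in> coset_words"
  obtains "l \<in> tails i"
  | g l' where "l = (i, edge_coset i g) # l'" "g \<in> carrier (G i)" "g \<notin> edge_image i" "l' \<in> tails i"
proof (cases "l \<noteq> [] \<and> fst (hd l) = i")
  case True
  then obtain Y l' where "l = (i, Y) # l'" by (cases l) auto
  then show ?thesis
    using assms that(2) by (auto simp: coset_words_def tails_def successively_Cons)
next
  case False
  then show ?thesis using assms that(1) by (auto simp: tails_def)
qed

lemma split_tail: "l \<in> tails i \<Longrightarrow> split i (k, l) = (f i k, l)"
  by (auto simp: split_def tails_def)

lemma split_Cons: "split i (k, (i, Y) # l) = (f i k \<otimes>\<^bsub>G i\<^esub> rep Y, l)"
  by (simp add: split_def)

lemma split_mem:
  assumes "w \<in> forms"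
  shows "fst (split i w) \<in> carrier (G i)" "snd (split i w) \<in> tails i"
proof -
  obtain k l where w: "w = (k, l)" "k \<in> carrier K" "l \<in> coset_words" using assms
    by (auto simp: forms_def)
  then have "fst (split i w) \<in> carrier (G i) \<and> snd (split i w) \<in> tails i"
    by (cases rule: coset_words_cases[OF w(3), of i]) (auto simp: split_tail split_Cons)
  then show "fst (split i w) \<in> carrier (G i)" "snd (split i w) \<in> tails i" by blast+
qed

lemma join_mem:
  assumes "g \<in> carrier (G i)" "l \<in> tails i"
  shows "join i (g, l) \<in> forms"
  using assms mult_inv_rep_mem_edge_image[OF assms(1)]
  by (auto simp: join_def forms_def tails_def coset_words_def successively_Cons)

lemma split_join:
  assumes "g \<in> carrier (G i)" "l \<in> tails i"
  shows "split i (join i (g, l)) = (g, l)"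
  using assms mult_inv_rep_mem_edge_image[OF assms(1)]
  by (auto simp: join_def split_tail split_Cons f.H.m_assoc)

lemma join_split:
  assumes "w \<in> forms"
  shows "join i (split i w) = w"
proof -
  obtain k l where w: "w = (k, l)" "k \<in> carrier K" "l \<in> coset_words" using assms
    by (auto simp: forms_def)
  show ?thesis
  proof (cases rule: coset_words_cases[OF w(3), of i])
    case 1
    then show ?thesis using w by (simp add: split_tail join_def)
  next
    case (2 g l')
    obtain x where x: "x \<in> edge_image i" "rep (edge_coset i g) = x \<otimes>\<^bsub>G i\<^esub> g"
      using rep_edge_coset[OF 2(2)] .
    let ?h = "f i k \<otimes>\<^bsub>G i\<^esub> (x \<otimes>\<^bsub>G i\<^esub> g)"
    have h: "?h \<notin> edge_image i" "edge_coset i ?h = edge_coset i g"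
      using x 2 w(2) by (simp_all add: f.H.subgroup_mult_left_iff[OF edge_image_subgroup]
        edge_coset_mult)
    then have "?h \<otimes>\<^bsub>G i\<^esub> inv\<^bsub>G i\<^esub> (rep (edge_coset i ?h)) = f i k"
      using x 2 w(2) by (simp add: f.H.m_assoc)
    then show ?thesis using h w 2(1) x(2) by (simp add: split_Cons join_def)
  qed
qed

lemma act_mem:
  assumes "p \<in> carrier (G i)" "w \<in> forms"
  shows "act i p w \<in> forms"
  using join_mem split_mem[OF assms(2)] assms(1) by (simp add: act_def)

lemma act_mult:
  assumes "p \<in> carrier (G i)" "q \<in> carrier (G i)" "w \<in> forms"
  shows "act i (p \<otimes>\<^bsub>G i\<^esub> q) w = act i p (act i q w)"
  using split_join split_mem[OF assms(3)] assms(1,2) by (simp add: act_def f.H.m_assoc)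

lemma act_one:
  assumes "w \<in> forms" shows "act i \<one>\<^bsub>G i\<^esub> w = w"
  using split_mem[OF assms] join_split[OF assms] by (simp add: act_def)

definition act_hom :: "bool \<Rightarrow> 'g \<Rightarrow> ('k, 'g) coset_form \<Rightarrow> ('k, 'g) coset_form" where
  "act_hom i p = restrict (act i p) forms"

lemma group_hom_act_hom: "group_hom (G i) (BijGroup forms) (act_hom i)"
proof -
  have "act_hom i p \<in> Bij forms" if p: "p \<in> carrier (G i)" for p
  proof -
    have "bij_betw (act i p) forms forms"
    proof (rule bij_betw_byWitness[of _ "act i (inv\<^bsub>G i\<^esub> p)"])
      show "\<forall>w\<in>forms. act i (inv\<^bsub>G i\<^esub> p) (act i p w) = w"
        "\<forall>w\<in>forms. act i p (act i (inv\<^bsub>G i\<^esub> p) w) = w"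
        using p act_mult[symmetric] act_one by simp_all
    qed (use p act_mem in auto)
    then show ?thesis
      by (simp add: Bij_def act_hom_def bij_betw_cong[of forms "restrict (act i p) forms"])
  qed
  moreover have "act_hom i (p \<otimes>\<^bsub>G i\<^esub> q) = compose forms (act_hom i p) (act_hom i q)"
    if "p \<in> carrier (G i)" "q \<in> carrier (G i)" for p q
    using that by (auto simp: act_hom_def compose_def fun_eq_iff act_mult act_mem)
  ultimately have "act_hom i \<in> hom (G i) (BijGroup forms)" by (auto simp: hom_def BijGroup_def)
  then show ?thesis
    by (intro group_hom.intro group_hom_axioms.intro group_BijGroup f.H.group_axioms)
qed

lemma act_f:
  assumes "k' \<in> carrier K" "k \<in> carrier K" "l \<in> coset_words"
  shows "act i (f i k') (k, l) = (k' \<otimes>\<^bsub>K\<^esub> k, l)"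
proof -
  have "(f i k' \<otimes>\<^bsub>G i\<^esub> fst (split i (k, l)), snd (split i (k, l))) = split i (k' \<otimes>\<^bsub>K\<^esub> k, l)"
    using assms(1,2)
    by (cases rule: coset_words_cases[OF assms(3), of i]) (auto simp: split_tail split_Cons f.H.m_assoc)
  moreover have "(k' \<otimes>\<^bsub>K\<^esub> k, l) \<in> forms" using assms by (simp add: forms_def)
  ultimately show ?thesis using join_split by (simp add: act_def)
qed

lemma act_hom_agree: "k \<in> carrier K \<Longrightarrow> act_hom i (f i k) = act_hom j (f j k)"
  by (auto simp: act_hom_def fun_eq_iff forms_def act_f)

lemma Nil_mem_tails: "[] \<in> tails i"
  by (simp add: tails_def coset_words_def)

lemma base_mem_forms: "(\<one>\<^bsub>K\<^esub>, []) \<in> forms"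
  by (simp add: forms_def coset_words_def)

lemma act_hom_base_faithful:
  assumes "g \<in> carrier (G i)" "act_hom i g (\<one>\<^bsub>K\<^esub>, []) = (\<one>\<^bsub>K\<^esub>, [])"
  shows "g = \<one>\<^bsub>G i\<^esub>"
proof -
  have base: "split i (\<one>\<^bsub>K\<^esub>, []) = (\<one>\<^bsub>G i\<^esub>, [])" using split_tail[OF Nil_mem_tails] by simp
  then have "join i (g, []) = (\<one>\<^bsub>K\<^esub>, [])"
    using assms base_mem_forms by (simp add: act_hom_def act_def)
  then show ?thesis using split_join[OF assms(1) Nil_mem_tails] base by simp
qed

lemma act_hom_lengthens:
  assumes "g \<in> carrier (G i)" "g \<notin> edge_image i" "(k, l) \<in> forms" "l \<noteq> [] \<longrightarrow> fst (hd l) \<noteq> i"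
  obtains k' Y where "act_hom i g (k, l) = (k', (i, Y) # l)"
proof -
  have k: "k \<in> carrier K" and l: "l \<in> tails i" using assms(3,4) by (auto simp: forms_def tails_def)
  have "g \<otimes>\<^bsub>G i\<^esub> f i k \<notin> edge_image i"
    using assms(1,2) k f.H.subgroup_mult_right_iff[OF edge_image_subgroup] by simp
  then show ?thesis
    using that assms(3) by (auto simp: act_hom_def act_def split_tail[OF l] join_def)
qed

end

subsection \<open>Transport along injective homomorphisms\<close>

context group_hom
begin

lemma isolated_in_image:
  assumes inj: "inj_on h (carrier G)" and "A \<subseteq> carrier G" "B \<subseteq> carrier G" "group.isolated_in G A B"
  shows "group.isolated_in H (h ` A) (h ` B)"
proof (rule H.isolated_inI)
  fix g and n :: nat assume "g \<in> h ` A" "n \<ge> 1" "g [^]\<^bsub>H\<^esub> n \<in> h ` B"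
  then obtain x y where x: "x \<in> A" "g = h x" and y: "y \<in> B" "h x [^]\<^bsub>H\<^esub> n = h y" by blast
  then have "x \<in> carrier G" "y \<in> carrier G" using assms by auto
  then have "x [^] n = y" using y(2) inj_onD[OF inj, of "x [^] n" y] by (simp add: hom_nat_pow)
  then show "g \<in> h ` B" using G.isolated_inD[OF assms(4) x(1), of n] x(2) y(1) \<open>n \<ge> 1\<close> by blast
qed

lemma separated_image:
  assumes inj: "inj_on h (carrier G)" and "Z \<subseteq> carrier G" "B \<subseteq> carrier G" "group.separated G Z B"
  shows "group.separated H (h ` Z) (h ` B)"
  unfolding H.separated_def
proof (intro ballI impI)
  fix a a' b assume "a \<in> h ` Z" "a' \<in> h ` Z" "b \<in> h ` B" "b \<noteq> \<one>\<^bsub>H\<^esub>"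
    and "a \<otimes>\<^bsub>H\<^esub> b \<otimes>\<^bsub>H\<^esub> a' \<in> h ` B"
  then obtain z z' x y where z: "z \<in> Z" "a = h z" "z' \<in> Z" "a' = h z'" and x: "x \<in> B" "b = h x"
    and y: "y \<in> B" "h z \<otimes>\<^bsub>H\<^esub> h x \<otimes>\<^bsub>H\<^esub> h z' = h y" by blast
  have carrier: "z \<in> carrier G" "z' \<in> carrier G" "x \<in> carrier G" "y \<in> carrier G"
    using assms z x y by auto
  then have "z \<otimes> x \<otimes> z' = y" using y(2) inj_onD[OF inj, of "z \<otimes> x \<otimes> z'" y] by simp
  moreover have "x \<noteq> \<one>" using \<open>b \<noteq> \<one>\<^bsub>H\<^esub>\<close> x(2) by auto
  ultimately have "z = \<one>" using G.separatedD[OF assms(4) z(1,3) x(1)] y(1) by simp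
  then show "a = \<one>\<^bsub>H\<^esub>" using z(2) by simp
qed

lemma inter_image_eq_one:
  assumes inj: "inj_on h (carrier G)" and "A \<subseteq> carrier G" "B \<subseteq> carrier G" "A \<inter> B = {\<one>}"
  shows "h ` A \<inter> h ` B = {\<one>\<^bsub>H\<^esub>}"
  using inj_on_image_Int[OF inj assms(2,3)] assms(4) by simp

end

definition parabolic_isolated :: "('a gword \<times> 'a gword) set \<Rightarrow> 'a set \<Rightarrow> 'a set \<Rightarrow> bool" where
  "parabolic_isolated R U W \<longleftrightarrow>
     group.isolated_in (presented_group W R) (carrier (presented_group W R)) (parabolic R W U)"

lemma parabolic_isolatedI:
  assumes "\<And>w n. w \<in> gwords W \<Longrightarrow> n \<ge> 1 \<Longrightarrow> pres_class W R (list_power n w) \<in> parabolic R W U \<Longrightarrow>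
    pres_class W R w \<in> parabolic R W U"
  shows "parabolic_isolated R U W"
  unfolding parabolic_isolated_def
  using assms
  by (intro group.isolated_inI[OF group_presented_group]) (auto simp: carrier_presented pres_class_pow)

lemma parabolic_isolated_refl: "parabolic_isolated R W W"
  by (intro parabolic_isolatedI) (auto simp: parabolic_self)

lemma inclusion_image_parabolic:
  assumes "U \<subseteq> W" "W \<subseteq> W'"
  shows "inclusion R W' ` parabolic R W U = parabolic R W' U"
proof -
  have "inclusion R W' (pres_class W R w) = pres_class W' R w" if "w \<in> gwords U" for w
    using inclusion_pres_class[OF assms(2)] gwords_mono[OF assms(1)] that by blast
  then show ?thesis by (force simp: parabolic_def image_image)
qed

lemma parabolic_subset_carrier: "U \<subseteq> W \<Longrightarrow> parabolic R W U \<subseteq> carrier (presented_group W R)"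
  by (rule subgroup.subset[OF subgroup_parabolic])

lemma isolated_in_parabolic_if_embeds:
  assumes "parabolic_isolated R U W" "embeds R W W'" "U \<subseteq> W" "W \<subseteq> W'"
  shows "group.isolated_in (presented_group W' R) (parabolic R W' W) (parabolic R W' U)"
  using group_hom.isolated_in_image[OF group_hom_inclusion[OF assms(4)] inj_on_inclusion[OF assms(2,4)]
      subset_refl parabolic_subset_carrier[OF assms(3)]] assms(1)
  by (simp add: parabolic_isolated_def inclusion_image_parabolic assms(3,4) flip: parabolic_self)

lemma separated_parabolic_if_embeds:
  assumes "group.separated (presented_group W R) (parabolic R W Z) (parabolic R W U)"
    and "embeds R W W'" "Z \<subseteq> W" "U \<subseteq> W" "W \<subseteq> W'"
  shows "group.separated (presented_group W' R) (parabolic R W' Z) (parabolic R W' U)"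
  using group_hom.separated_image[OF group_hom_inclusion[OF assms(5)] inj_on_inclusion[OF assms(2,5)]
      parabolic_subset_carrier[OF assms(3)] parabolic_subset_carrier[OF assms(4)] assms(1)]
  by (simp add: inclusion_image_parabolic assms(3-5))

lemma parabolic_inter_eq_one_if_embeds:
  assumes "parabolic R W U \<inter> parabolic R W U' = {\<one>\<^bsub>presented_group W R\<^esub>}"
    and "embeds R W W'" "U \<subseteq> W" "U' \<subseteq> W" "W \<subseteq> W'"
  shows "parabolic R W' U \<inter> parabolic R W' U' = {\<one>\<^bsub>presented_group W' R\<^esub>}"
  using group_hom.inter_image_eq_one[OF group_hom_inclusion[OF assms(5)] inj_on_inclusion[OF assms(2,5)]
      parabolic_subset_carrier[OF assms(3)] parabolic_subset_carrier[OF assms(4)] assms(1)]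
  by (simp add: inclusion_image_parabolic assms(3-5))

lemma parabolic_isolated_trans:
  assumes "parabolic_isolated R U U'" "embeds R U' W" "parabolic_isolated R U' W" "U \<subseteq> U'" "U' \<subseteq> W"
  shows "parabolic_isolated R U W"
proof -
  interpret Q: group "presented_group W R" by (rule group_presented_group)
  show ?thesis
    using isolated_in_parabolic_if_embeds[OF assms(1,2,4,5)] assms(3)
      parabolic_mono[OF assms(4), of R W]
    unfolding parabolic_isolated_def Q.isolated_in_def by blast
qed

lemma embeds_Un_if_amalgam_subgroups:
  assumes split: "amalgam_subgroups (presented_group W R) P C (\<lambda>i. parabolic R W (L i))"
    and embeds: "\<And>i. embeds R (L i) W" and W: "L True \<union> L False \<subseteq> W"
  shows "embeds R (L True \<union> L False) W"
proof -
  let ?M = "L True \<union> L False"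
  have sub: "L i \<subseteq> ?M" "L i \<subseteq> W" for i using W by (cases i; auto)+
  have factors:
    "two_subgroups (presented_group ?M R) (\<lambda>i. parabolic R ?M (L i)) {\<one>\<^bsub>presented_group ?M R\<^esub>}"
    using subgroup.one_closed[OF subgroup_parabolic[OF sub(1)]]
    by (intro two_subgroups.intro two_subgroups_axioms.intro group_presented_group
        subgroup_parabolic sub(1)
        group.triv_subgroup[OF group_presented_group]) simp
  have gen: "generate (presented_group ?M R) (parabolic R ?M (L True) \<union> parabolic R ?M (L False))
      = carrier (presented_group ?M R)"
    using generate_parabolic[of "L True" "L False" ?M R] parabolic_self[of R ?M] by simp
  have image: "inclusion R W x \<in> parabolic R W (L i)" if "x \<in> parabolic R ?M (L i)" for x i
    using that inclusion_image_parabolic[OF sub(1) W] by blast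
  have kernel: "x = \<one>\<^bsub>presented_group ?M R\<^esub>"
    if x: "x \<in> parabolic R ?M (L i)" and one: "inclusion R W x = \<one>\<^bsub>presented_group W R\<^esub>" for x i
  proof -
    obtain u where u: "u \<in> gwords (L i)" "x = pres_class ?M R u" using x by (rule parabolicE)
    then have "u \<in> gwords ?M" using gwords_mono[OF sub(1)] by blast
    then have "pres_class W R u = pres_class W R []"
      using one u(2) inclusion_pres_class[OF W] by (simp add: one_presented)
    then have "pres_class (L i) R u = pres_class (L i) R []"
      using embedsD[OF embeds sub(2) u(1)] by simp
    then show ?thesis using pres_class_mono[OF sub(1) u(1)] u(2) by (simp add: one_presented)
  qed
  show ?thesis unfolding embeds_def
  proof (intro ballI impI)
    fix w assume w: "w \<in> gwords ?M" "pres_cong W R w []"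
    have "w \<in> gwords W" using w(1) gwords_mono[OF W] by blast
    then have "inclusion R W (pres_class ?M R w) = \<one>\<^bsub>presented_group W R\<^esub>"
      using w inclusion_pres_class[OF W] by (simp add: pres_class_eq_one_iff)
    then have "pres_class ?M R w = \<one>\<^bsub>presented_group ?M R\<^esub>"
      using amalgam_subgroups.hom_trivial_kernel_if_trivial_on_factors[OF split
          group_hom_inclusion[OF W]
          factors gen image kernel] w(1) by simp
    then show "pres_cong ?M R w []" using w(1) by (simp add: pres_class_eq_one_iff)
  qed
qed

subsection \<open>Presented groups as amalgams\<close>

locale presented_amalgam =
  fixes R :: "('a gword \<times> 'a gword) set" and U :: "bool \<Rightarrow> 'a set"
  assumes relation_cases: "\<And>u v. (u, v) \<in> R \<Longrightarrow>
      u \<in> gwords (U True \<union> U False) \<Longrightarrow> v \<in> gwords (U True \<union> U False) \<Longrightarrow>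
      \<exists>i. u \<in> gwords (U i) \<and> v \<in> gwords (U i)"
    and embeds_inter: "\<And>i. embeds R (U True \<inter> U False) (U i)"
begin

abbreviation W :: "'a set" where "W \<equiv> U True \<union> U False"
abbreviation W0 :: "'a set" where "W0 \<equiv> U True \<inter> U False"
abbreviation Q :: "'a gword set monoid" where "Q \<equiv> presented_group W R"

lemma U_subset_W: "U i \<subseteq> W" and W0_subset_U: "W0 \<subseteq> U i"
  by (cases i; auto)+

sublocale factors: amalgam_data "presented_group W0 R" "\<lambda>i. presented_group (U i) R"
  "\<lambda>i. inclusion R (U i)"
  by (intro amalgam_data.intro group_hom_inclusion inj_on_inclusion embeds_inter W0_subset_U)

sublocale Q: group Q
  by (rule group_presented_group)

abbreviation \<Omega> :: "(('a gword set, 'a gword set) coset_form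
  \<Rightarrow> ('a gword set, 'a gword set) coset_form) monoid" where
  "\<Omega> \<equiv> BijGroup factors.forms"
abbreviation base :: "('a gword set, 'a gword set) coset_form"
  where "base \<equiv> (\<one>\<^bsub>presented_group W0 R\<^esub>, [])"

lemma group_BijGroup_forms: "group \<Omega>"
  by (rule group_BijGroup)

definition letter_action :: "'a \<Rightarrow> ('a gword set, 'a gword set) coset_form
  \<Rightarrow> ('a gword set, 'a gword set) coset_form" where
  "letter_action x = (if x \<in> U True then factors.act_hom True (pres_class (U True) R [(x, True)])
     else factors.act_hom False (pres_class (U False) R [(x, True)]))"

lemma letter_action_eq:
  assumes "x \<in> U i"
  shows "letter_action x = factors.act_hom i (pres_class (U i) R [(x, True)])"
proof (cases "x \<in> W0")
  case True
  then have "factors.act_hom j (pres_class (U j) R [(x, True)])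
      = factors.act_hom i (pres_class (U i) R [(x, True)])" for j
    using factors.act_hom_agree[of "pres_class W0 R [(x, True)]" j i]
    by (simp add: inclusion_pres_class[OF W0_subset_U])
  from this[of True] show ?thesis using True by (simp add: letter_action_def)
next
  case False
  then show ?thesis using assms by (cases i) (auto simp: letter_action_def)
qed

lemma letter_action_closed: "letter_action \<in> W \<rightarrow> carrier \<Omega>"
proof
  fix x assume "x \<in> W"
  then obtain i where i: "x \<in> U i" by blast
  then show "letter_action x \<in> carrier \<Omega>"
    using group_hom.hom_closed[OF factors.group_hom_act_hom, of "pres_class (U i) R [(x, True)]" i]
    by (simp add: letter_action_eq[OF i])
qed

lemma gword_eval_letter_action:
  assumes "w \<in> gwords (U i)"
  shows "gword_eval \<Omega> letter_action w = factors.act_hom i (pres_class (U i) R w)"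
proof -
  let ?letter = "\<lambda>x. pres_class (U i) R [(x, True)]"
  have "gword_eval \<Omega> letter_action w = gword_eval \<Omega> (\<lambda>x. factors.act_hom i (?letter x)) w"
    using assms letter_action_eq by (rule gword_eval_cong)
  also have "\<dots> = factors.act_hom i (gword_eval (presented_group (U i) R) ?letter w)"
    by (rule group_hom.gword_eval_hom[OF factors.group_hom_act_hom assms]) auto
  finally show ?thesis using gword_eval_pres_class[OF assms] by simp
qed

lemma gword_eval_letter_action_relation:
  assumes "(u, v) \<in> R" "u \<in> gwords W" "v \<in> gwords W"
  shows "gword_eval \<Omega> letter_action u = gword_eval \<Omega> letter_action v"
proof -
  obtain i where i: "u \<in> gwords (U i)" "v \<in> gwords (U i)" using relation_cases[OF assms] by blast
  then have "pres_class (U i) R u = pres_class (U i) R v"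
    using assms(1) by (simp add: pres_class_eq_iff pres_cong.relation)
  then show ?thesis using i by (simp add: gword_eval_letter_action)
qed

definition action :: "'a gword set \<Rightarrow> ('a gword set, 'a gword set) coset_form
  \<Rightarrow> ('a gword set, 'a gword set) coset_form" where
  "action = presented_lift \<Omega> letter_action"

lemma group_hom_action: "group_hom Q \<Omega> action"
  unfolding action_def
  by (rule group.group_hom_presented_lift[OF group_BijGroup_forms letter_action_closed
    gword_eval_letter_action_relation])

lemma action_pres_class:
  assumes "w \<in> gwords (U i)"
  shows "action (pres_class W R w) = factors.act_hom i (pres_class (U i) R w)"
proof -
  have "w \<in> gwords W" using assms gwords_mono[OF U_subset_W] by blast
  from group.presented_lift_pres_class[OF group_BijGroup_forms letter_action_closed
    gword_eval_letter_action_relation this]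
  show ?thesis using gword_eval_letter_action[OF assms] by (simp add: action_def)
qed

sublocale action: group_hom Q \<Omega> action
  by (rule group_hom_action)

lemma one_BijGroup_apply: "w \<in> factors.forms \<Longrightarrow> \<one>\<^bsub>\<Omega>\<^esub> w = w"
  by (simp add: BijGroup_def)

lemma mult_BijGroup_apply:
  "a \<in> carrier \<Omega> \<Longrightarrow> b \<in> carrier \<Omega> \<Longrightarrow> w \<in> factors.forms \<Longrightarrow> (a \<otimes>\<^bsub>\<Omega>\<^esub> b) w = a (b w)"
  by (simp add: BijGroup_def compose_def)

lemma embeds_factor: "embeds R (U i) W"
  unfolding embeds_def
proof (intro ballI impI)
  fix w assume w: "w \<in> gwords (U i)" "pres_cong W R w []"
  then have "pres_class W R w = \<one>\<^bsub>Q\<^esub>"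
    using gwords_mono[OF U_subset_W] by (simp add: pres_class_eq_one_iff subset_iff)
  then have "factors.act_hom i (pres_class (U i) R w) base = base"
    using action_pres_class[OF w(1)] one_BijGroup_apply[OF factors.base_mem_forms] by simp
  then have "pres_class (U i) R w = \<one>\<^bsub>presented_group (U i) R\<^esub>"
    using factors.act_hom_base_faithful w(1) by simp
  then show "pres_cong (U i) R w []" using w(1) by (simp add: pres_class_eq_one_iff)
qed

lemma parabolic_diff_not_edge_image:
  assumes "w \<in> gwords (U i)" "pres_class W R w \<notin> parabolic R W W0"
  shows "pres_class (U i) R w \<notin> factors.edge_image i"
proof
  assume "pres_class (U i) R w \<in> factors.edge_image i"
  then obtain u where u: "u \<in> gwords W0" "pres_class (U i) R w = pres_class (U i) R u"
    by (auto simp: factors.edge_image_def carrier_presented inclusion_pres_class[OF W0_subset_U])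
  then have "pres_class W R w = pres_class W R u" using pres_class_mono[OF U_subset_W assms(1)] by blast
  then show False using assms(2) u(1) by simp
qed

lemma action_reduced_word:
  assumes "Q.reduced (\<lambda>i. parabolic R W (U i)) (parabolic R W W0) xs"
  obtains k l where "action (Q.word_prod xs) base = (k, l)" "length l = length xs"
proof -
  have "\<exists>k l. action (Q.word_prod xs) base = (k, l) \<and> (k, l) \<in> factors.forms \<and>
      map fst l = map fst xs"
    using assms
  proof (induction xs)
    case Nil
    then show ?case using one_BijGroup_apply[OF factors.base_mem_forms] factors.base_mem_forms by simp
  next
    case (Cons x xs)
    obtain i g where x: "x = (i, g)" by force
    have xs: "Q.reduced (\<lambda>i. parabolic R W (U i)) (parabolic R W W0) xs"
      and g: "g \<in> parabolic R W (U i)" "g \<notin> parabolic R W W0" and next_type: "xs \<noteq> [] \<Longrightarrow> i \<noteq> fst (hd xs)"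
      using Cons.prems x by (auto simp: Q.reduced_Cons)
    obtain k l where kl: "action (Q.word_prod xs) base = (k, l)" "(k, l) \<in> factors.forms"
      "map fst l = map fst xs"
      using Cons.IH[OF xs] by blast
    obtain w where w: "w \<in> gwords (U i)" "g = pres_class W R w" using g(1) by (rule parabolicE)
    have "l \<noteq> [] \<longrightarrow> fst (hd l) \<noteq> i" using kl(3) next_type by (metis hd_map list.map_disc_iff)
    then obtain k' Y where k': "factors.act_hom i (pres_class (U i) R w) (k, l) = (k', (i, Y) # l)"
      using factors.act_hom_lengthens[OF _ parabolic_diff_not_edge_image[OF w(1)] kl(2)] g(2) w by auto
    have carrier: "g \<in> carrier Q" "Q.word_prod xs \<in> carrier Q"
      using subgroup.subset[OF subgroup_parabolic[OF U_subset_W]] g(1)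
        Q.reduced_carrier[OF subgroup.subset[OF subgroup_parabolic[OF U_subset_W]] xs] by auto
    have "action (Q.word_prod (x # xs)) base = action g (action (Q.word_prod xs) base)"
      using x carrier factors.base_mem_forms
        mult_BijGroup_apply[OF action.hom_closed[OF carrier(1)] action.hom_closed[OF carrier(2)]]
      by simp
    also have "\<dots> = (k', (i, Y) # l)" using kl(1) k' w action_pres_class[OF w(1)] by simp
    finally have image: "action (Q.word_prod (x # xs)) base = (k', (i, Y) # l)" .
    have "action g \<in> Bij factors.forms" using action.hom_closed[OF carrier(1)]
      by (simp add: BijGroup_def)
    then have "action g (k, l) \<in> factors.forms" using kl(2) Bij_imp_funcset by blast
    then show ?case using image k' w kl(3) x action_pres_class[OF w(1)] by auto
  qed
  then show ?thesis using that by (metis length_map)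
qed

theorem amalgam: "amalgam Q (\<lambda>i. parabolic R W (U i)) (parabolic R W W0)"
proof (intro amalgam.intro two_subgroups.intro two_subgroups_axioms.intro amalgam_axioms.intro
  Q.group_axioms)
  show "subgroup (parabolic R W (U i)) Q" for i by (rule subgroup_parabolic[OF U_subset_W])
  show "subgroup (parabolic R W W0) Q" by (rule subgroup_parabolic) auto
  show "parabolic R W W0 \<subseteq> parabolic R W (U i)" for i by (rule parabolic_mono[OF W0_subset_U])
  show "generate Q (parabolic R W (U True) \<union> parabolic R W (U False)) = carrier Q"
    using generate_parabolic[of "U True" "U False" W R] parabolic_self[of R W] by simp
  fix xs assume xs: "Q.reduced (\<lambda>i. parabolic R W (U i)) (parabolic R W W0) xs" "xs \<noteq> []"
  show "Q.word_prod xs \<noteq> \<one>\<^bsub>Q\<^esub>"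
  proof
    assume "Q.word_prod xs = \<one>\<^bsub>Q\<^esub>"
    then have "action (Q.word_prod xs) base = base"
      using one_BijGroup_apply[OF factors.base_mem_forms] by simp
    then show False using action_reduced_word[OF xs(1)] xs(2) by (metis length_0_conv prod.inject)
  qed
qed

lemma isolated_amalgam:
  assumes "\<And>i. parabolic_isolated R W0 (U i)"
  shows "isolated_amalgam Q (\<lambda>i. parabolic R W (U i)) (parabolic R W W0)"
  using assms isolated_in_parabolic_if_embeds[OF _ embeds_factor W0_subset_U U_subset_W]
  by (intro isolated_amalgam.intro isolated_amalgam_axioms.intro amalgam) blast

end

subsection \<open>The special linear group of degree two\<close>

type_synonym 'a mat2 = "'a \<times> 'a \<times> 'a \<times> 'a"

fun mat_mult :: "'a::comm_ring_1 mat2 \<Rightarrow> 'a mat2 \<Rightarrow> 'a mat2" where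
  "mat_mult (a, b, c, d) (e, f, g, h) = (a * e + b * g, a * f + b * h, c * e + d * g, c * f + d * h)"

fun mat_det :: "'a::comm_ring_1 mat2 \<Rightarrow> 'a" where
  "mat_det (a, b, c, d) = a * d - b * c"

definition SL2 :: "'a::comm_ring_1 mat2 monoid" where
  "SL2 = \<lparr>carrier = {M. mat_det M = 1}, monoid.mult = mat_mult, one = (1, 0, 0, 1)\<rparr>"

lemma SL2_simps [simp]:
  "(a, b, c, d) \<in> carrier SL2 \<longleftrightarrow> a * d - b * c = 1"
  "(a, b, c, d) \<otimes>\<^bsub>SL2\<^esub> (e, f, g, h) = (a * e + b * g, a * f + b * h, c * e + d * g, c * f + d * h)"
  "\<one>\<^bsub>SL2\<^esub> = (1, 0, 0, 1)"
  by (simp_all add: SL2_def)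

lemma group_SL2: "group (SL2 :: 'a::comm_ring_1 mat2 monoid)"
proof (rule groupI)
  fix x y z :: "'a mat2"
  obtain a b c d where x: "x = (a, b, c, d)" by (metis prod_cases4)
  obtain e f g h where y: "y = (e, f, g, h)" by (metis prod_cases4)
  obtain k l m n where z: "z = (k, l, m, n)" by (metis prod_cases4)
  show "x \<otimes>\<^bsub>SL2\<^esub> y \<otimes>\<^bsub>SL2\<^esub> z = x \<otimes>\<^bsub>SL2\<^esub> (y \<otimes>\<^bsub>SL2\<^esub> z)"
    by (simp add: x y z algebra_simps)
  show "\<one>\<^bsub>SL2\<^esub> \<otimes>\<^bsub>SL2\<^esub> x = x" by (simp add: x)
  {
    assume "x \<in> carrier SL2" "y \<in> carrier SL2"
    then have "(a * d - b * c) * (e * h - f * g) = 1" by (simp add: x y)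
    then show "x \<otimes>\<^bsub>SL2\<^esub> y \<in> carrier SL2" by (simp add: x y algebra_simps)
  }
  {
    assume "x \<in> carrier SL2"
    then show "\<exists>y\<in>carrier SL2. y \<otimes>\<^bsub>SL2\<^esub> x = \<one>\<^bsub>SL2\<^esub>"
      by (intro bexI[of _ "(d, - b, - c, a)"]) (auto simp: x algebra_simps)
  }
qed (simp add: SL2_def)

interpretation SL2: group "SL2 :: 'a::comm_ring_1 mat2 monoid"
  by (rule group_SL2)

lemma inv_SL2 [simp]:
  assumes "(a, b, c, d) \<in> carrier SL2"
  shows "inv\<^bsub>SL2\<^esub> (a, b, c, d) = (d, - b, - c, a)"
  using assms by (intro SL2.inv_equality) (auto simp: algebra_simps)

text \<open>\<open>cheb t k\<close> is the value at \<open>t/2\<close> of the Chebyshev polynomial \<open>U\<close> of degree \<open>k - 1\<close>.\<close>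

fun cheb :: "'a::comm_ring_1 \<Rightarrow> nat \<Rightarrow> 'a" where
  "cheb t 0 = 0"
| "cheb t (Suc 0) = 1"
| "cheb t (Suc (Suc k)) = t * cheb t (Suc k) - cheb t k"

lemma SL2_pow:
  assumes "(a, b, c, d) \<in> carrier SL2"
  shows "(a, b, c, d) [^]\<^bsub>SL2\<^esub> Suc k = (cheb (a + d) (Suc k) * a - cheb (a + d) k,
    cheb (a + d) (Suc k) * b, cheb (a + d) (Suc k) * c, cheb (a + d) (Suc k) * d - cheb (a + d) k)"
proof (induction k)
  case 0
  then show ?case using assms by simp
next
  case (Suc k)
  define u v where "u = cheb (a + d) (Suc k)" and "v = cheb (a + d) k"
  have det: "a * d - b * c = 1" using assms by simp
  have entries: "(u * a - v) * a + u * b * c = ((a + d) * u - v) * a - u * (a * d - b * c)"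
    "(u * a - v) * b + u * b * d = ((a + d) * u - v) * b"
    "u * c * a + (u * d - v) * c = ((a + d) * u - v) * c"
    "u * c * b + (u * d - v) * d = ((a + d) * u - v) * d - u * (a * d - b * c)"
    by (simp_all add: algebra_simps)
  have "(a, b, c, d) [^]\<^bsub>SL2\<^esub> Suc (Suc k) = (a, b, c, d) [^]\<^bsub>SL2\<^esub> Suc k \<otimes>\<^bsub>SL2\<^esub> (a, b, c, d)"
    by (rule SL2.nat_pow_Suc)
  then show ?case
    unfolding Suc u_def[symmetric] v_def[symmetric] cheb.simps
    by (simp only: SL2_simps entries det mult_1_right)
qed

lemma cheb_two: "cheb 2 k = of_nat k"
  by (induction "2 :: 'a::comm_ring_1" k rule: cheb.induct) (auto simp: algebra_simps)

lemma cheb_const_poly: "cheb [:r:] k = [:cheb r k:]"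
  by (induction r k rule: cheb.induct) (auto simp: one_pCons)

lemma cheb_cos_sin: "cheb (2 * cos \<theta>) k * sin \<theta> = sin (real k * \<theta>)"
proof (induction "2 * cos \<theta>" k rule: cheb.induct)
  case (3 k)
  have "sin (real (Suc (Suc k)) * \<theta>) = sin (real (Suc k) * \<theta> + \<theta>)"
    "sin (real k * \<theta>) = sin (real (Suc k) * \<theta> - \<theta>)"
    by (simp_all add: algebra_simps)
  then have "sin (real (Suc (Suc k)) * \<theta>) = 2 * cos \<theta> * sin (real (Suc k) * \<theta>) - sin (real k * \<theta>)"
    by (simp only: sin_add sin_diff) (simp add: algebra_simps)
  then show ?case using 3 by (simp only: cheb.simps left_diff_distrib mult.assoc)
qed auto

lemma degree_cheb:
  fixes t :: "'a::idom poly"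
  assumes "degree t \<ge> 1"
  shows "cheb t (Suc k) \<noteq> 0 \<and> degree (cheb t (Suc k)) = k * degree t"
proof (induction k rule: less_induct)
  case (less k)
  consider "k = 0" | "k = 1" | j where "k = Suc (Suc j)" by (metis One_nat_def not0_implies_Suc)
  then show ?case
  proof cases
    case 1
    then show ?thesis by simp
  next
    case 2
    then show ?thesis using assms by auto
  next
    case (3 j)
    have IH: "cheb t (Suc (Suc j)) \<noteq> 0" "degree (cheb t (Suc (Suc j))) = Suc j * degree t"
      "degree (cheb t (Suc j)) = j * degree t"
      using less[of "Suc j"] less[of j] 3 by auto
    have leading: "degree (t * cheb t (Suc (Suc j))) = k * degree t"
      using IH assms 3 by (subst degree_mult_eq) auto
    then have "degree (cheb t (Suc j)) < degree (t * cheb t (Suc (Suc j)))"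
      using IH(3) assms 3 by simp
    then have "degree (cheb t (Suc k)) = k * degree t"
      using leading 3 degree_add_eq_left[of "- cheb t (Suc j)" "t * cheb t (Suc (Suc j))"] by simp
    moreover have "k * degree t \<noteq> 0" using 3 assms by simp
    ultimately show ?thesis by force
  qed
qed

lemma SL2_commute_pow:
  fixes M N :: "'a::idom poly mat2"
  assumes M: "M \<in> carrier SL2" "M = (a, b, c, d)" "degree (a + d) \<ge> 1"
    and N: "N \<in> carrier SL2" and "n \<ge> 1"
    and commute: "N \<otimes>\<^bsub>SL2\<^esub> M [^]\<^bsub>SL2\<^esub> (n::nat) = M [^]\<^bsub>SL2\<^esub> n \<otimes>\<^bsub>SL2\<^esub> N"
  shows "N \<otimes>\<^bsub>SL2\<^esub> M = M \<otimes>\<^bsub>SL2\<^esub> N"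
proof -
  obtain k where k: "n = Suc k" using \<open>n \<ge> 1\<close> by (metis Suc_le_D One_nat_def)
  obtain e f g h where N_eq: "N = (e, f, g, h)" by (metis prod_cases4)
  define u where "u = cheb (a + d) (Suc k)"
  have u: "u \<noteq> 0" using degree_cheb[OF M(3)] by (simp add: u_def)
  have "N \<otimes>\<^bsub>SL2\<^esub> (u * a - cheb (a + d) k, u * b, u * c, u * d - cheb (a + d) k)
      = (u * a - cheb (a + d) k, u * b, u * c, u * d - cheb (a + d) k) \<otimes>\<^bsub>SL2\<^esub> N"
    using commute SL2_pow[of a b c d k] M k by (simp add: u_def)
  then have "u * (f * c) = u * (b * g)" "u * (e * b + f * d) = u * (a * f + b * h)"
    "u * (g * a + h * c) = u * (c * e + d * g)" "u * (g * b) = u * (c * f)"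
    unfolding N_eq by (auto simp: algebra_simps)
  then have "f * c = b * g" "e * b + f * d = a * f + b * h"
    "g * a + h * c = c * e + d * g" "g * b = c * f"
    unfolding mult_left_cancel[OF u] by blast+
  then show ?thesis unfolding N_eq M(2) by (simp add: algebra_simps)
qed

lemma SL2_commute_int_pow:
  fixes M N :: "'a::idom poly mat2"
  assumes M: "M \<in> carrier SL2" "M = (a, b, c, d)" "degree (a + d) \<ge> 1"
    and N: "N \<in> carrier SL2" and "k \<noteq> 0"
    and commute: "N \<otimes>\<^bsub>SL2\<^esub> M [^]\<^bsub>SL2\<^esub> (k::int) = M [^]\<^bsub>SL2\<^esub> k \<otimes>\<^bsub>SL2\<^esub> N"
  shows "N \<otimes>\<^bsub>SL2\<^esub> M = M \<otimes>\<^bsub>SL2\<^esub> N"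
proof (cases k rule: int_cases2)
  case (nonneg n)
  then have "n \<ge> 1" using \<open>k \<noteq> 0\<close> by simp
  then show ?thesis
    using SL2_commute_pow[OF M N] commute unfolding nonneg int_pow_int by blast
next
  case (nonpos n)
  then have "n \<ge> 1" using \<open>k \<noteq> 0\<close> by simp
  moreover have "inv\<^bsub>SL2\<^esub> (M [^]\<^bsub>SL2\<^esub> k) = M [^]\<^bsub>SL2\<^esub> n"
    using M(1) nonpos by (simp add: SL2.int_pow_neg_int)
  then have "N \<otimes>\<^bsub>SL2\<^esub> M [^]\<^bsub>SL2\<^esub> n = M [^]\<^bsub>SL2\<^esub> n \<otimes>\<^bsub>SL2\<^esub> N"
    using SL2.commute_inv[OF SL2.int_pow_closed[OF M(1)] N commute[symmetric]] by simp
  ultimately show ?thesis using SL2_commute_pow[OF M N] by blast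
qed

lemma unipotent_nat_pow:
  assumes M: "(a, b, c, d) \<in> carrier SL2" "a + d = 2"
  shows "(a, b, c, d) [^]\<^bsub>SL2\<^esub> (n::nat)
    = (1 + of_nat n * (a - 1), of_nat n * b, of_nat n * c, 1 + of_nat n * (d - 1))"
proof (cases n)
  case (Suc m)
  show ?thesis unfolding Suc SL2_pow[OF M(1)] M(2) cheb_two by (simp add: algebra_simps)
qed simp

lemma SL2_torsion_degree_trace:
  fixes a b c d :: "'a::idom poly"
  assumes M: "(a, b, c, d) \<in> carrier SL2" and "(a, b, c, d) [^]\<^bsub>SL2\<^esub> Suc k = \<one>\<^bsub>SL2\<^esub>"
  shows "degree (a + d) = 0"
proof (rule ccontr)
  assume "degree (a + d) \<noteq> 0"
  then have degree: "degree (a + d) \<ge> 1" by simp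
  define u where "u = cheb (a + d) (Suc k)"
  have u: "u \<noteq> 0" using degree_cheb[OF degree] by (simp add: u_def)
  have "u * a = u * d" "u * b = 0" "u * c = 0"
    using SL2_pow[OF M, of k] assms(2) by (simp_all add: u_def algebra_simps)
  then have "b = 0" "c = 0" "a = d" using u by auto
  then have "a * a = 1" using M by simp
  then have "a \<noteq> 0" "degree (a * a) = 0" by auto
  then have "degree a = 0" by (simp add: degree_mult_eq)
  then show False using degree \<open>a = d\<close> degree_add_le[of a 0 d] by simp
qed

lemma SL2_torsion_trivial:
  fixes M :: "'a::{idom,ring_char_0} poly mat2"
  assumes M: "M \<in> carrier SL2" "M = (a, b, c, d)" "poly (a + d) 0 = 2"
    and "n \<ge> 1" "M [^]\<^bsub>SL2\<^esub> (n::nat) = \<one>\<^bsub>SL2\<^esub>"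
  shows "M = \<one>\<^bsub>SL2\<^esub>"
proof -
  obtain k where k: "n = Suc k" using \<open>n \<ge> 1\<close> by (metis Suc_le_D One_nat_def)
  have "degree (a + d) = 0" using SL2_torsion_degree_trace[of a b c d k] M assms(5) k by simp
  then obtain r where "a + d = [:r:]" by (rule degree_eq_zeroE)
  then have "a + d = 2" using M(3) by (simp add: numeral_poly)
  then have "(1 + of_nat n * (a - 1), of_nat n * b, of_nat n * c, 1 + of_nat n * (d - 1))
    = (1, 0, 0, 1)"
    using unipotent_nat_pow[of a b c d n] M(1,2) assms(5) by simp
  moreover have "(of_nat n :: 'a poly) \<noteq> 0" using \<open>n \<ge> 1\<close> by simp
  ultimately show ?thesis using M(2) by simp
qed

lemma unipotent_int_pow:
  assumes M: "(a, b, c, d) \<in> carrier SL2" "a + d = 2"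
  shows "(a, b, c, d) [^]\<^bsub>SL2\<^esub> (k::int)
    = (1 + of_int k * (a - 1), of_int k * b, of_int k * c, 1 + of_int k * (d - 1))"
proof (cases k rule: int_cases2)
  case (nonneg n)
  then show ?thesis using unipotent_nat_pow[OF M, of n] by (simp add: int_pow_int)
next
  case (nonpos n)
  have "(a, b, c, d) [^]\<^bsub>SL2\<^esub> n \<in> carrier SL2" using M(1) by (rule SL2.nat_pow_closed)
  then have "(a, b, c, d) [^]\<^bsub>SL2\<^esub> k
      = (1 + of_nat n * (d - 1), - (of_nat n * b), - (of_nat n * c), 1 + of_nat n * (a - 1))"
    using inv_SL2 unfolding nonpos SL2.int_pow_neg_int[OF M(1)] unipotent_nat_pow[OF M] by blast
  also have "\<dots> = (1 + of_int k * (a - 1), of_int k * b, of_int k * c, 1 + of_int k * (d - 1))"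
    using M(2) unfolding nonpos by (simp add: right_diff_distrib eq_diff_eq[symmetric])
  finally show ?thesis .
qed

fun mat_poly :: "'a::comm_ring_1 \<Rightarrow> 'a poly mat2 \<Rightarrow> 'a mat2" where
  "mat_poly x (a, b, c, d) = (poly a x, poly b x, poly c x, poly d x)"

lemma group_hom_mat_poly: "group_hom SL2 SL2 (mat_poly x)"
proof (intro group_hom.intro group_hom_axioms.intro group_SL2 homI)
  fix M N :: "'a poly mat2" assume M: "M \<in> carrier SL2" and "N \<in> carrier SL2"
  obtain a b c d where M_eq: "M = (a, b, c, d)" by (metis prod_cases4)
  have "poly (a * d - b * c) x = 1" using M M_eq by simp
  then show "mat_poly x M \<in> carrier SL2" using M_eq by simp
  show "mat_poly x (M \<otimes>\<^bsub>SL2\<^esub> N) = mat_poly x M \<otimes>\<^bsub>SL2\<^esub> mat_poly x N"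
    by (cases M; cases N) auto
qed

subsection \<open>Alternating products\<close>

lemma alternating_word_Suc:
  "alternating_word s t (Suc k) = (s, True) # alternating_word t s k"
  unfolding alternating_word_def
  by (simp add: upt_conv_Cons map_Suc_upt[symmetric] del: upt_Suc map_Suc_upt)

lemma alternating_word_0 [simp]: "alternating_word s t 0 = []"
  by (simp add: alternating_word_def)

lemma alternating_word_gwords: "alternating_word s t k \<in> gwords {s, t}"
  by (auto simp: gwords_iff alternating_word_def)

lemma alternating_word_letters:
  assumes "k \<ge> 2" "alternating_word s t k \<in> gwords X"
  shows "s \<in> X" "t \<in> X"
proof -
  obtain j where "k = Suc (Suc j)" using assms(1) by (metis add_2_eq_Suc le_Suc_ex)
  then show "s \<in> X" "t \<in> X" using assms(2) by (simp_all add: alternating_word_Suc)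
qed

lemma exponent_sum_alternating_word [simp]: "exponent_sum (alternating_word s t k) = int k"
  by (induction k arbitrary: s t) (simp_all add: alternating_word_Suc)

context group
begin

fun alt_prod :: "'a \<Rightarrow> 'a \<Rightarrow> nat \<Rightarrow> 'a" where
  "alt_prod x y 0 = \<one>"
| "alt_prod x y (Suc k) = x \<otimes> alt_prod y x k"

lemma alt_prod_closed [simp]:
  "x \<in> carrier G \<Longrightarrow> y \<in> carrier G \<Longrightarrow> alt_prod x y k \<in> carrier G"
  by (induction k arbitrary: x y) auto

lemma gword_eval_alternating_word:
  "gword_eval G f (alternating_word s t k) = alt_prod (f s) (f t) k"
  by (induction k arbitrary: s t) (simp_all add: alternating_word_Suc)

lemma mult_pow_slide:
  assumes "x \<in> carrier G" "j \<in> carrier G"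
  shows "(j \<otimes> x) [^] (n::nat) \<otimes> j = j \<otimes> (x \<otimes> j) [^] n"
proof (induction n)
  case (Suc n)
  have "(j \<otimes> x) [^] Suc n \<otimes> j = ((j \<otimes> x) [^] n \<otimes> j) \<otimes> (x \<otimes> j)"
    using assms by (simp add: m_assoc)
  then show ?case using Suc assms by (simp add: m_assoc)
qed (use assms in simp)

lemma alt_prod_twist:
  assumes "x \<in> carrier G" "y \<in> carrier G" "j \<in> carrier G" "x \<otimes> j = j \<otimes> y" "y \<otimes> j = j \<otimes> x"
  shows "alt_prod x y k \<otimes> j [^] k = (x \<otimes> j) [^] k"
  using assms
proof (induction k arbitrary: x y)
  case (Suc k)
  have "alt_prod x y (Suc k) \<otimes> j [^] Suc k = x \<otimes> (alt_prod y x k \<otimes> j [^] k) \<otimes> j"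
    using Suc.prems by (simp add: m_assoc)
  also have "\<dots> = x \<otimes> ((j \<otimes> x) [^] k \<otimes> j)"
    using Suc.IH[of y x] Suc.prems by (simp add: m_assoc)
  also have "\<dots> = (x \<otimes> j) \<otimes> (x \<otimes> j) [^] k"
    using Suc.prems(1,3) mult_pow_slide[of x j k] by (simp add: m_assoc)
  also have "\<dots> = (x \<otimes> j) [^] Suc k"
    using Suc.prems(1,3) by (intro nat_pow_Suc2[symmetric]) simp
  finally show ?case .
qed simp

end

subsection \<open>A linear quotient of the dihedral Artin groups\<close>

text \<open>
  \<open>dih_a p\<close> and \<open>dih_b p\<close> are \<open>q J\<^sup>-\<^sup>1\<close> and \<open>J\<^sup>-\<^sup>1 q\<close> for the quarter turn \<open>J\<close> and the conjugate \<open>q\<close>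
  of the rotation by \<open>\<pi>/p\<close> by the unipotent matrix with parameter \<open>x\<close>.  Since \<open>J\<^sup>2 = q\<^sup>p = -1\<close>, they
  satisfy the braid relation of length \<open>p\<close>.  At \<open>x = 0\<close> they coincide.
\<close>

definition dih_a :: "nat \<Rightarrow> real poly mat2" where
  "dih_a p = (let s = sin (pi / p); c = cos (pi / p) in ([:s, 0, s:], [:c, s:], [:- c, s:], [:s:]))"

definition dih_b :: "nat \<Rightarrow> real poly mat2" where
  "dih_b p = (let s = sin (pi / p); c = cos (pi / p) in ([:s:], [:c, - s:], [:- c, - s:], [:s, 0, s:]))"

definition quarter_turn :: "real poly mat2" where
  "quarter_turn = (0, - 1, 1, 0)"

lemma dih_closed [simp]: "dih_a p \<in> carrier SL2" "dih_b p \<in> carrier SL2"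
  using sin_cos_squared_add3[of "pi / p"]
  by (auto simp: dih_a_def dih_b_def Let_def one_pCons algebra_simps)

lemma quarter_turn_closed [simp]: "quarter_turn \<in> carrier SL2"
  by (simp add: quarter_turn_def)

lemma quarter_turn_swap:
  "dih_b p \<otimes>\<^bsub>SL2\<^esub> quarter_turn = quarter_turn \<otimes>\<^bsub>SL2\<^esub> dih_a p"
  "dih_a p \<otimes>\<^bsub>SL2\<^esub> quarter_turn = quarter_turn \<otimes>\<^bsub>SL2\<^esub> dih_b p"
  by (simp_all add: dih_a_def dih_b_def quarter_turn_def Let_def)

lemma sin_pi_div_pos:
  assumes "p \<ge> 2" shows "sin (pi / real p) > 0"
proof -
  have "pi / real p > 0" "pi / real p < pi"
    using assms by (auto simp: divide_less_eq)
  then show ?thesis by (rule sin_gt_zero)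
qed

lemma cheb_cos_pi_div:
  assumes "p \<ge> 2"
  shows "cheb (2 * cos (pi / real p)) p = 0" "cheb (2 * cos (pi / real p)) (p - 1) = 1"
proof -
  have sin: "sin (pi / real p) > 0" using sin_pi_div_pos[OF assms] .
  show "cheb (2 * cos (pi / real p)) p = 0"
    using cheb_cos_sin[of "pi / real p" p] sin assms by simp
  have "real (p - 1) * (pi / real p) = pi - pi / real p" using assms by (simp add: field_simps)
  then have "cheb (2 * cos (pi / real p)) (p - 1) * sin (pi / real p) = 1 * sin (pi / real p)"
    using cheb_cos_sin[of "pi / real p" "p - 1"] by simp
  then show "cheb (2 * cos (pi / real p)) (p - 1) = 1" using sin by (subst (asm) mult_right_cancel) auto
qed

lemma SL2_pow_trace_cos:
  assumes p: "p \<ge> 2" and M: "(a, b, c, d) \<in> carrier SL2" "a + d = [:2 * cos (pi / real p):]"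
  shows "(a, b, c, d) [^]\<^bsub>SL2\<^esub> p = (- 1, 0, 0, - 1)"
proof -
  obtain k where k: "p = Suc k" using p by (metis Suc_le_D numeral_2_eq_2)
  then have "cheb (a + d) (Suc k) = 0" "cheb (a + d) k = 1"
    using cheb_cos_pi_div[OF p] M(2) by (simp_all add: cheb_const_poly one_pCons)
  then show ?thesis using SL2_pow[OF M(1), of k] k by simp
qed

lemma dih_mult_quarter_turn_pow:
  assumes "p \<ge> 2"
  shows "(dih_a p \<otimes>\<^bsub>SL2\<^esub> quarter_turn) [^]\<^bsub>SL2\<^esub> p = (- 1, 0, 0, - 1)"
    "(dih_b p \<otimes>\<^bsub>SL2\<^esub> quarter_turn) [^]\<^bsub>SL2\<^esub> p = (- 1, 0, 0, - 1)"
proof -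
  have closed: "dih_a p \<otimes>\<^bsub>SL2\<^esub> quarter_turn \<in> carrier SL2" "dih_b p \<otimes>\<^bsub>SL2\<^esub> quarter_turn \<in> carrier SL2"
    by (simp_all only: SL2.m_closed dih_closed quarter_turn_closed)
  obtain a b c d where a: "dih_a p \<otimes>\<^bsub>SL2\<^esub> quarter_turn = (a, b, c, d)" by (metis prod_cases4)
  obtain a' b' c' d' where b: "dih_b p \<otimes>\<^bsub>SL2\<^esub> quarter_turn = (a', b', c', d')" by (metis prod_cases4)
  have "a + d = [:2 * cos (pi / p):]" "a' + d' = [:2 * cos (pi / p):]"
    using a b by (auto simp: dih_a_def dih_b_def quarter_turn_def Let_def)
  then show "(dih_a p \<otimes>\<^bsub>SL2\<^esub> quarter_turn) [^]\<^bsub>SL2\<^esub> p = (- 1, 0, 0, - 1)"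
    "(dih_b p \<otimes>\<^bsub>SL2\<^esub> quarter_turn) [^]\<^bsub>SL2\<^esub> p = (- 1, 0, 0, - 1)"
    using closed SL2_pow_trace_cos[OF assms] unfolding a b by blast+
qed

lemma dih_braid:
  assumes "p \<ge> 2"
  shows "SL2.alt_prod (dih_a p) (dih_b p) p = SL2.alt_prod (dih_b p) (dih_a p) p"
proof -
  let ?J = quarter_turn
  have "SL2.alt_prod (dih_a p) (dih_b p) p \<otimes>\<^bsub>SL2\<^esub> ?J [^]\<^bsub>SL2\<^esub> p
      = SL2.alt_prod (dih_b p) (dih_a p) p \<otimes>\<^bsub>SL2\<^esub> ?J [^]\<^bsub>SL2\<^esub> p"
    using dih_mult_quarter_turn_pow[OF assms] by (simp add: SL2.alt_prod_twist quarter_turn_swap)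
  then show ?thesis by (simp add: SL2.right_cancel)
qed

definition dih_eval :: "nat \<Rightarrow> 'v \<Rightarrow> 'v gword \<Rightarrow> real poly mat2" where
  "dih_eval p s w = gword_eval SL2 (\<lambda>v. if v = s then dih_a p else dih_b p) w"

lemma dih_letters_closed: "(\<lambda>v. if v = s then dih_a p else dih_b p) \<in> X \<rightarrow> carrier SL2"
  by auto

lemma gwords_UNIV: "w \<in> gwords UNIV"
  by (simp add: gwords_iff)

lemma dih_eval_closed [simp]: "dih_eval p s w \<in> carrier SL2"
  unfolding dih_eval_def by (rule SL2.gword_eval_closed[OF gwords_UNIV dih_letters_closed])

lemma dih_eval_Nil [simp]: "dih_eval p s [] = \<one>\<^bsub>SL2\<^esub>"
  by (simp add: dih_eval_def)

lemma dih_eval_append: "dih_eval p s (u @ v) = dih_eval p s u \<otimes>\<^bsub>SL2\<^esub> dih_eval p s v"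
  unfolding dih_eval_def by (rule SL2.gword_eval_append[OF gwords_UNIV gwords_UNIV dih_letters_closed])

lemma dih_eval_gword_inv: "dih_eval p s (gword_inv w) = inv\<^bsub>SL2\<^esub> (dih_eval p s w)"
  unfolding dih_eval_def by (rule SL2.gword_eval_inv[OF gwords_UNIV dih_letters_closed])

lemma dih_eval_list_power: "dih_eval p s (list_power n w) = dih_eval p s w [^]\<^bsub>SL2\<^esub> n"
proof (induction n)
  case (Suc n)
  then show ?case
    using SL2.nat_pow_Suc2[of "dih_eval p s w" n]
    by (simp add: dih_eval_append del: SL2.nat_pow_Suc)
qed simp

lemma dih_eval_single_letter:
  assumes "w \<in> gwords {v}"
  shows "dih_eval p s w = (if v = s then dih_a p else dih_b p) [^]\<^bsub>SL2\<^esub> exponent_sum w"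
  unfolding dih_eval_def by (rule SL2.gword_eval_single_letter[OF assms]) auto

lemma dih_eval_alternating_word:
  assumes "p \<ge> 2" "s \<noteq> t"
  shows "dih_eval p s (alternating_word s t p) = dih_eval p s (alternating_word t s p)"
  using assms dih_braid by (simp add: dih_eval_def SL2.gword_eval_alternating_word)

lemma dih_eval_swap:
  assumes "w \<in> gwords {s, t}" "s \<noteq> t"
  shows "dih_eval p t w = \<one>\<^bsub>SL2\<^esub> \<longleftrightarrow> dih_eval p s w = \<one>\<^bsub>SL2\<^esub>"
proof -
  let ?J = quarter_turn
  let ?conj = "SL2.conj_by (inv\<^bsub>SL2\<^esub> ?J)"
  interpret conj: group_hom SL2 SL2 ?conj by (rule SL2.group_hom_conj_by) simp
  have "?conj (dih_a p) = (?J \<otimes>\<^bsub>SL2\<^esub> dih_a p) \<otimes>\<^bsub>SL2\<^esub> inv\<^bsub>SL2\<^esub> ?J"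
    "?conj (dih_b p) = (?J \<otimes>\<^bsub>SL2\<^esub> dih_b p) \<otimes>\<^bsub>SL2\<^esub> inv\<^bsub>SL2\<^esub> ?J"
    by (simp_all add: SL2.conj_by_def)
  then have letters: "?conj (dih_a p) = dih_b p" "?conj (dih_b p) = dih_a p"
    unfolding quarter_turn_swap[symmetric] by (simp_all add: SL2.m_assoc)
  have "dih_eval p t w = gword_eval SL2 (\<lambda>v. ?conj (if v = s then dih_a p else dih_b p)) w"
    unfolding dih_eval_def using assms letters by (intro gword_eval_cong[OF assms(1)]) auto
  also have "\<dots> = ?conj (dih_eval p s w)"
    unfolding dih_eval_def by (rule conj.gword_eval_hom[OF assms(1) dih_letters_closed])
  finally show ?thesis
    using SL2.conj_by_eq_one_iff[OF SL2.inv_closed[OF quarter_turn_closed] dih_eval_closed] by metis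
qed

lemma dih_at_0:
  assumes "\<beta> = pi / real p - pi / 2" "M \<in> {dih_a p, dih_b p}"
  shows "mat_poly 0 M = (cos \<beta>, - sin \<beta>, sin \<beta>, cos \<beta>)"
    and "mat_poly 0 (inv\<^bsub>SL2\<^esub> M) = (cos \<beta>, sin \<beta>, - sin \<beta>, cos \<beta>)"
proof -
  interpret mat_poly: group_hom SL2 SL2 "mat_poly (0::real)" by (rule group_hom_mat_poly)
  have "cos \<beta> = sin (pi / real p)" "sin \<beta> = - cos (pi / real p)"
    by (simp_all add: assms(1) cos_diff sin_diff)
  then show eval: "mat_poly 0 M = (cos \<beta>, - sin \<beta>, sin \<beta>, cos \<beta>)"
    using assms(2) by (auto simp: dih_a_def dih_b_def Let_def)
  have "(cos \<beta>, - sin \<beta>, sin \<beta>, cos \<beta>) \<in> carrier SL2"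
    using sin_cos_squared_add3[of \<beta>] by (simp add: algebra_simps)
  then show "mat_poly 0 (inv\<^bsub>SL2\<^esub> M) = (cos \<beta>, sin \<beta>, - sin \<beta>, cos \<beta>)"
    using mat_poly.hom_inv[of M] assms(2) inv_SL2[of "cos \<beta>" "- sin \<beta>" "sin \<beta>" "cos \<beta>"]
    unfolding eval by auto
qed

lemma dih_eval_at_0:
  fixes \<beta> :: real
  assumes "\<beta> = pi / real p - pi / 2"
  shows "mat_poly 0 (dih_eval p s w) =
    (cos (exponent_sum w * \<beta>), - sin (exponent_sum w * \<beta>),
     sin (exponent_sum w * \<beta>), cos (exponent_sum w * \<beta>))"
proof (induction w)
  case Nil
  then show ?case by simp
next
  case (Cons a w)
  interpret mat_poly: group_hom SL2 SL2 "mat_poly (0::real)" by (rule group_hom_mat_poly)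
  obtain x b where a: "a = (x, b)" by force
  let ?g = "if x = s then dih_a p else dih_b p"
  have "dih_eval p s (a # w) = (if b then ?g else inv\<^bsub>SL2\<^esub> ?g) \<otimes>\<^bsub>SL2\<^esub> dih_eval p s w"
    by (simp add: a dih_eval_def)
  then have product: "mat_poly 0 (dih_eval p s (a # w))
      = mat_poly 0 (if b then ?g else inv\<^bsub>SL2\<^esub> ?g) \<otimes>\<^bsub>SL2\<^esub> mat_poly 0 (dih_eval p s w)"
    by (simp add: mat_poly.hom_mult)
  have letter: "mat_poly 0 ?g = (cos \<beta>, - sin \<beta>, sin \<beta>, cos \<beta>)"
    "mat_poly 0 (inv\<^bsub>SL2\<^esub> ?g) = (cos \<beta>, sin \<beta>, - sin \<beta>, cos \<beta>)"
    using dih_at_0[OF assms, of ?g] by simp_all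
  show ?case
  proof (cases b)
    case True
    then have sum: "exponent_sum (a # w) * \<beta> = \<beta> + exponent_sum w * \<beta>" using a
      by (simp add: algebra_simps)
    show ?thesis unfolding product sum Cons.IH using True letter
      by (simp add: cos_add sin_add algebra_simps)
  next
    case False
    then have sum: "exponent_sum (a # w) * \<beta> = exponent_sum w * \<beta> - \<beta>" using a
      by (simp add: algebra_simps)
    show ?thesis unfolding product sum Cons.IH using False letter
      by (simp add: cos_diff sin_diff algebra_simps)
  qed
qed

lemma dih_eval_torsion:
  assumes "exponent_sum w = 0" "n \<ge> 1" "dih_eval p s w [^]\<^bsub>SL2\<^esub> (n::nat) = \<one>\<^bsub>SL2\<^esub>"
  shows "dih_eval p s w = \<one>\<^bsub>SL2\<^esub>"
proof -
  obtain a b c d where M: "dih_eval p s w = (a, b, c, d)" by (metis prod_cases4)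
  have "poly (a + d) 0 = 2" using dih_eval_at_0[OF HOL.refl, of p s w] assms(1) M by simp
  then show ?thesis using SL2_torsion_trivial[OF dih_eval_closed M _ assms(2,3)] by simp
qed

definition letter_power :: "'a \<Rightarrow> int \<Rightarrow> 'a gword" where
  "letter_power t e = replicate (nat \<bar>e\<bar>) (t, e \<ge> 0)"

lemma letter_power_gwords [simp]: "letter_power t e \<in> gwords X \<longleftrightarrow> e = 0 \<or> t \<in> X"
  by (cases "e = 0") (auto simp: letter_power_def gwords_iff)

lemma exponent_sum_letter_power [simp]: "exponent_sum (letter_power t e) = e"
  by (auto simp: letter_power_def exponent_sum_def sum_list_replicate)

lemma dih_eval_letter_power:
  "dih_eval p s (letter_power v e) = (if v = s then dih_a p else dih_b p) [^]\<^bsub>SL2\<^esub> e"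
  using dih_eval_single_letter[of "letter_power v e" v p s] by simp

lemma dih_b_trace:
  assumes "p \<ge> 2"
  obtains a b c d where "dih_b p = (a, b, c, d)" "degree (a + d) \<ge> 1"
proof -
  have "sin (pi / real p) \<noteq> 0" using sin_pi_div_pos[OF assms] by simp
  then show ?thesis using that[of "[:sin (pi / p):]" "[:cos (pi / p), - sin (pi / p):]"
      "[:- cos (pi / p), - sin (pi / p):]" "[:sin (pi / p), 0, sin (pi / p):]"]
    by (simp add: dih_b_def Let_def)
qed

lemma dih_b_commute_int_pow:
  assumes "p \<ge> 2" "g \<in> carrier SL2" "k \<noteq> 0"
    and "g \<otimes>\<^bsub>SL2\<^esub> dih_b p [^]\<^bsub>SL2\<^esub> (k::int) = dih_b p [^]\<^bsub>SL2\<^esub> k \<otimes>\<^bsub>SL2\<^esub> g"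
  shows "dih_b p \<otimes>\<^bsub>SL2\<^esub> g = g \<otimes>\<^bsub>SL2\<^esub> dih_b p"
proof -
  obtain a b c d where "dih_b p = (a, b, c, d)" "degree (a + d) \<ge> 1"
    using dih_b_trace[OF assms(1)] .
  then show ?thesis using SL2_commute_int_pow[OF dih_closed(2) _ _ assms(2-4)] by metis
qed

lemma dih_eval_root:
  assumes p: "p \<ge> 2" and "s \<noteq> t" and n: "n \<ge> 1"
    and pow: "dih_eval p s w [^]\<^bsub>SL2\<^esub> (n::nat) = dih_b p [^]\<^bsub>SL2\<^esub> (int n * exponent_sum w)"
  shows "dih_eval p s w = dih_b p [^]\<^bsub>SL2\<^esub> exponent_sum w"
proof -
  define g e where "g = dih_eval p s w" and "e = exponent_sum w"
  have g: "g \<in> carrier SL2" by (simp add: g_def)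
  have bpow: "dih_b p [^]\<^bsub>SL2\<^esub> k \<in> carrier SL2" for k :: int by (simp del: SL2_simps)
  have pow: "g [^]\<^bsub>SL2\<^esub> n = dih_b p [^]\<^bsub>SL2\<^esub> (int n * e)" using pow by (simp add: g_def e_def)
  have commute: "dih_b p [^]\<^bsub>SL2\<^esub> (- e) \<otimes>\<^bsub>SL2\<^esub> g = g \<otimes>\<^bsub>SL2\<^esub> dih_b p [^]\<^bsub>SL2\<^esub> (- e)"
  proof (cases "e = 0")
    case True
    then show ?thesis using g SL2.l_one SL2.r_one by (simp del: SL2_simps)
  next
    case False
    then have "int n * e \<noteq> 0" using n by simp
    moreover have "g \<otimes>\<^bsub>SL2\<^esub> dih_b p [^]\<^bsub>SL2\<^esub> (int n * e) = dih_b p [^]\<^bsub>SL2\<^esub> (int n * e) \<otimes>\<^bsub>SL2\<^esub> g"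
      using SL2.pow_commute_self[OF g, of n] pow by simp
    ultimately have "dih_b p \<otimes>\<^bsub>SL2\<^esub> g = g \<otimes>\<^bsub>SL2\<^esub> dih_b p" using dih_b_commute_int_pow[OF p g] by blast
    then show ?thesis by (rule SL2.commute_int_pow[OF dih_closed(2) g])
  qed
  define u where "u = w @ letter_power t (- e)"
  have u: "dih_eval p s u = g \<otimes>\<^bsub>SL2\<^esub> dih_b p [^]\<^bsub>SL2\<^esub> (- e)"
    using \<open>s \<noteq> t\<close> by (simp add: u_def dih_eval_append dih_eval_letter_power g_def)
  have "dih_eval p s u [^]\<^bsub>SL2\<^esub> n = \<one>\<^bsub>SL2\<^esub>"
    unfolding u by (rule SL2.mult_int_pow_neg_pow_eq_one[OF g dih_closed(2) commute[symmetric] pow])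
  then have "dih_eval p s u = \<one>\<^bsub>SL2\<^esub>"
    by (rule dih_eval_torsion[OF _ n, rotated]) (simp add: u_def e_def)
  then have "g \<otimes>\<^bsub>SL2\<^esub> inv\<^bsub>SL2\<^esub> (dih_b p [^]\<^bsub>SL2\<^esub> e) = \<one>\<^bsub>SL2\<^esub>"
    using u by (simp add: SL2.int_pow_neg del: SL2_simps)
  then have "g = dih_b p [^]\<^bsub>SL2\<^esub> e"
    using g bpow[of e] SL2.inv_solve_right'[of "\<one>\<^bsub>SL2\<^esub>" g "dih_b p [^]\<^bsub>SL2\<^esub> e"] SL2.l_one[OF bpow]
    by (metis SL2.one_closed)
  then show ?thesis by (simp add: g_def e_def)
qed

lemma dih_a_pow_ne_dih_b_pow:
  assumes "p \<ge> 2"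
  shows "dih_a p [^]\<^bsub>SL2\<^esub> Suc m \<noteq> dih_b p [^]\<^bsub>SL2\<^esub> Suc m"
proof
  assume eq: "dih_a p [^]\<^bsub>SL2\<^esub> Suc m = dih_b p [^]\<^bsub>SL2\<^esub> Suc m"
  define s c where "s = sin (pi / p)" and "c = cos (pi / p)"
  have s: "s > 0" using sin_pi_div_pos[OF assms] by (simp add: s_def)
  have entries: "dih_a p = ([:s, 0, s:], [:c, s:], [:- c, s:], [:s:])"
    "dih_b p = ([:s:], [:c, - s:], [:- c, - s:], [:s, 0, s:])"
    by (simp_all add: dih_a_def dih_b_def s_def c_def Let_def)
  define t where "t = [:s, 0, s:] + [:s:]"
  have t: "degree t \<ge> 1" "[:s:] + [:s, 0, s:] = t" using s by (simp_all add: t_def)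
  have "fst (snd (dih_a p [^]\<^bsub>SL2\<^esub> Suc m)) = cheb t (Suc m) * [:c, s:]"
    unfolding entries(1) SL2_pow[OF dih_closed(1)[of p, unfolded entries]] t_def[symmetric]
    by (simp only: fst_conv snd_conv)
  moreover have "fst (snd (dih_b p [^]\<^bsub>SL2\<^esub> Suc m)) = cheb t (Suc m) * [:c, - s:]"
    unfolding entries(2) SL2_pow[OF dih_closed(2)[of p, unfolded entries]] t(2)
    by (simp only: fst_conv snd_conv)
  ultimately have "cheb t (Suc m) * [:c, s:] = cheb t (Suc m) * [:c, - s:]" using eq by simp
  then have "[:c, s:] = [:c, - s:]" using degree_cheb[OF t(1), of m] mult_left_cancel by blast
  then show False using s by simp
qed

lemma dih_int_pow_eq_imp_zero:
  assumes "p \<ge> 2" and eq: "dih_a p [^]\<^bsub>SL2\<^esub> (k::int) = dih_b p [^]\<^bsub>SL2\<^esub> k"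
  shows "k = 0"
proof (cases k rule: int_cases2)
  case (nonneg n)
  then have "dih_a p [^]\<^bsub>SL2\<^esub> n = dih_b p [^]\<^bsub>SL2\<^esub> n" using eq by (simp only: int_pow_int)
  then show ?thesis using nonneg dih_a_pow_ne_dih_b_pow[OF assms(1)] by (cases n) auto
next
  case (nonpos n)
  then have "inv\<^bsub>SL2\<^esub> (dih_a p [^]\<^bsub>SL2\<^esub> n) = inv\<^bsub>SL2\<^esub> (dih_b p [^]\<^bsub>SL2\<^esub> n)"
    using eq by (simp only: SL2.int_pow_neg_int dih_closed)
  then have "dih_a p [^]\<^bsub>SL2\<^esub> n = dih_b p [^]\<^bsub>SL2\<^esub> n"
    by (metis SL2.inv_inv SL2.nat_pow_closed dih_closed)
  then show ?thesis using nonpos dih_a_pow_ne_dih_b_pow[OF assms(1)] by (cases n) auto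
qed

text \<open>\<open>x\<close> is the parameter at which the common trace of the two generators is 2.\<close>

lemma dih_unipotent_specialization:
  assumes "p \<ge> 3"
  obtains x c y e where "c > 0" "y > 0"
    "mat_poly x (dih_a p) = (1 + e, c + y, y - c, 1 - e)"
    "mat_poly x (dih_b p) = (1 - e, c - y, - c - y, 1 + e)"
proof -
  define s c where "s = sin (pi / p)" and "c = cos (pi / p)"
  have "0 < pi / p" "pi / p < pi / 2" using assms by (auto simp: field_simps)
  then have s: "0 < s" and c: "0 < c"
    using sin_pi_div_pos[of p] assms by (simp_all add: s_def c_def cos_gt_zero)
  have "s\<^sup>2 < 1"
    using zero_less_power[OF c, of 2] sin_cos_squared_add[of "pi / p"]
    unfolding s_def[symmetric] c_def[symmetric] by linarith
  then have "s < 1" using s power2_less_imp_less[of s 1] by simp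
  define x where "x = sqrt (2 / s - 2)"
  have "2 / s - 2 > 0" using s \<open>s < 1\<close> by (simp add: field_simps)
  then have x: "x > 0" "s * (x * x) = 2 - 2 * s" using s by (simp_all add: x_def field_simps)
  have "mat_poly x (dih_a p) = (1 + (1 - s), c + s * x, s * x - c, 1 - (1 - s))"
    "mat_poly x (dih_b p) = (1 - (1 - s), c - s * x, - c - s * x, 1 + (1 - s))"
    using x(2) by (simp_all add: dih_a_def dih_b_def Let_def algebra_simps flip: s_def c_def)
  then show ?thesis using that[of c "s * x" x "1 - s"] s c x(1) by simp
qed

lemma unipotent_products_eq_imp_zero:
  fixes k j l n e c y :: real
  assumes "c > 0" "y > 0" and sum: "k + j = l + n" and j: "j \<noteq> 0"
    and entry11: "(1 + k * e) * (1 - j * e) + k * (c + y) * (j * (- c - y))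
      = (1 - l * e) * (1 + n * e) + l * (c - y) * (n * (y - c))"
    and entry12: "(1 + k * e) * (j * (c - y)) + k * (c + y) * (1 + j * e)
      = (1 - l * e) * (n * (c + y)) + l * (c - y) * (1 - n * e)"
    and entry22: "k * (y - c) * (j * (c - y)) + (1 - k * e) * (1 + j * e)
      = l * (- c - y) * (n * (c + y)) + (1 + l * e) * (1 - n * e)"
  shows "k = 0"
proof -
  have "(k * j - l * n) * (2 * e\<^sup>2 + 2 * c\<^sup>2 + 2 * y\<^sup>2) = 0"
    using entry11 entry22 by (simp add: algebra_simps power2_eq_square)
  moreover have "2 * e\<^sup>2 + 2 * c\<^sup>2 + 2 * y\<^sup>2 > 0"
    using assms(1) by (simp add: add_nonneg_pos add_pos_nonneg)
  ultimately have product: "k * j = l * n" by simp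
  have "(k - n) * (k - l) = k * (k - (l + n)) + l * n" by (simp add: algebra_simps)
  also have "\<dots> = 0" using sum[symmetric] product[symmetric] by (simp add: algebra_simps)
  finally consider "k = n" | "k = l" by auto
  then show ?thesis
  proof cases
    case 1
    then have "j = l" using sum by simp
    then have "k * j * (4 * c * y) = 0" using entry11 1 by (simp add: algebra_simps)
    then show ?thesis using assms by simp
  next
    case 2
    then have "n = j" using sum by simp
    have e_eq: "(k - j) * e = 2 * (k * j * c * y)"
      using entry11 unfolding \<open>n = j\<close> 2[symmetric] by (simp add: algebra_simps)
    have y_eq: "(k - j) * y = - 2 * (k * j * e * c)"
      using entry12 unfolding \<open>n = j\<close> 2[symmetric] by (simp add: algebra_simps)
    have "(k - j) * (e\<^sup>2 + y\<^sup>2) = ((k - j) * e) * e + ((k - j) * y) * y"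
      by (simp add: algebra_simps power2_eq_square)
    also have "\<dots> = 0" unfolding e_eq y_eq by (simp add: algebra_simps)
    finally have "k = j" using assms(2) by (auto simp: add_nonneg_pos sum_power2_eq_zero_iff)
    then show ?thesis using e_eq assms by simp
  qed
qed

lemma dih_separated:
  assumes p: "p \<ge> 3" and j: "j \<noteq> 0" and sum: "k + j + n = l"
    and eq: "dih_a p [^]\<^bsub>SL2\<^esub> k \<otimes>\<^bsub>SL2\<^esub> dih_b p [^]\<^bsub>SL2\<^esub> j \<otimes>\<^bsub>SL2\<^esub> dih_a p [^]\<^bsub>SL2\<^esub> (n::int)
        = dih_b p [^]\<^bsub>SL2\<^esub> (l::int)"
  shows "k = 0"
proof -
  obtain x c y e where positive: "c > 0" "y > 0"
    and A: "mat_poly x (dih_a p) = (1 + e, c + y, y - c, 1 - e)"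
    and B: "mat_poly x (dih_b p) = (1 - e, c - y, - c - y, 1 + e)"
    using dih_unipotent_specialization[OF p] .
  interpret mat_poly: group_hom SL2 SL2 "mat_poly x" by (rule group_hom_mat_poly)
  have A_pow: "mat_poly x (dih_a p [^]\<^bsub>SL2\<^esub> i) = (1 + i * e, i * (c + y), i * (y - c), 1 - i * e)"
    for i :: int
    using unipotent_int_pow[of "1 + e" "c + y" "y - c" "1 - e" i]
      mat_poly.hom_closed[OF dih_closed(1), of p]
    unfolding A mat_poly.hom_int_pow[OF dih_closed(1)] by simp
  have B_pow: "mat_poly x (dih_b p [^]\<^bsub>SL2\<^esub> i) = (1 - i * e, i * (c - y), i * (- c - y), 1 + i * e)"
    for i :: int
    using unipotent_int_pow[of "1 - e" "c - y" "- c - y" "1 + e" i]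
      mat_poly.hom_closed[OF dih_closed(2), of p]
    unfolding B mat_poly.hom_int_pow[OF dih_closed(2)] by simp
  have "dih_a p [^]\<^bsub>SL2\<^esub> k \<otimes>\<^bsub>SL2\<^esub> dih_b p [^]\<^bsub>SL2\<^esub> j = dih_b p [^]\<^bsub>SL2\<^esub> l \<otimes>\<^bsub>SL2\<^esub> dih_a p [^]\<^bsub>SL2\<^esub> (- n)"
    unfolding eq[symmetric] by (simp add: SL2.m_assoc SL2.int_pow_neg)
  then have entries: "mat_poly x (dih_a p [^]\<^bsub>SL2\<^esub> k) \<otimes>\<^bsub>SL2\<^esub> mat_poly x (dih_b p [^]\<^bsub>SL2\<^esub> j)
      = mat_poly x (dih_b p [^]\<^bsub>SL2\<^esub> l) \<otimes>\<^bsub>SL2\<^esub> mat_poly x (dih_a p [^]\<^bsub>SL2\<^esub> (- n))"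
    using mat_poly.hom_mult SL2.int_pow_closed[OF dih_closed(1)] SL2.int_pow_closed[OF dih_closed(2)]
    by metis
  have "real_of_int k = 0"
  proof (rule unipotent_products_eq_imp_zero[OF positive, of k j l "- real_of_int n" e])
    show "real_of_int k + real_of_int j = real_of_int l + - real_of_int n" using sum by linarith
    show "real_of_int j \<noteq> 0" using j by simp
  qed (use entries in \<open>simp_all add: A_pow B_pow algebra_simps\<close>)
  then show ?thesis by simp
qed

subsection \<open>Isolated parabolic subgroups over triangle-free graphs\<close>

text \<open>
  Imposing all relations of the matrices, not only the braid relation, makes the edge groups linear
  without a proof that the representation of the dihedral Artin group is faithful.
\<close>

definition edge_relations :: "'v set set \<Rightarrow> ('v set \<Rightarrow> nat) \<Rightarrow> ('v gword \<times> 'v gword) set" where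
  "edge_relations E lab = {(w, []) | w s t. {s, t} \<in> E \<and> s \<noteq> t \<and> w \<in> gwords {s, t} \<and>
     exponent_sum w = 0 \<and> dih_eval (lab {s, t}) s w = \<one>\<^bsub>SL2\<^esub>}"

locale triangle_free_graph =
  fixes E :: "'v set set" and lab :: "'v set \<Rightarrow> nat"
  assumes lab_ge_2: "\<And>e. e \<in> E \<Longrightarrow> lab e \<ge> 2" and card_edge: "\<And>e. e \<in> E \<Longrightarrow> card e = 2"
    and triangle_free: "triangle_free E" and two_two_free: "two_two_free E lab"
begin

abbreviation R :: "('v gword \<times> 'v gword) set" where "R \<equiv> edge_relations E lab"

abbreviation Q :: "'v set \<Rightarrow> 'v gword set monoid" where "Q W \<equiv> presented_group W R"

abbreviation cl :: "'v set \<Rightarrow> 'v gword \<Rightarrow> 'v gword set" where "cl W \<equiv> pres_class W R"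

abbreviation par :: "'v set \<Rightarrow> 'v set \<Rightarrow> 'v gword set set" where "par \<equiv> parabolic R"

lemma edge_distinct: "{s, t} \<in> E \<Longrightarrow> s \<noteq> t"
  using card_edge[of "{s, t}"] by auto

lemma exponent_sum_pres_cong: "pres_cong W R u v \<Longrightarrow> exponent_sum u = exponent_sum v"
  by (induction rule: pres_cong.induct) (auto simp: edge_relations_def)

lemma exponent_sum_cl: "u \<in> gwords W \<Longrightarrow> cl W u = cl W v \<Longrightarrow> exponent_sum u = exponent_sum v"
  using exponent_sum_pres_cong[of W u v] by (simp add: pres_class_eq_iff)

lemma cl_single_letter:
  assumes "w \<in> gwords {a}" "a \<in> W"
  shows "cl W w = cl W [(a, True)] [^]\<^bsub>Q W\<^esub> exponent_sum w"
proof -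
  interpret Q: group "Q W" by (rule group_presented_group)
  have "cl W [(a, True)] \<in> carrier (Q W)" using assms by simp
  then show ?thesis
    using Q.gword_eval_single_letter[OF assms(1), of "\<lambda>x. cl W [(x, True)]"]
      gword_eval_pres_class[OF assms(1), of W R] assms(2)
    by simp
qed

lemma cl_single_letter_eq_one:
  assumes "w \<in> gwords {a}" "a \<in> W" "exponent_sum w = 0"
  shows "cl W w = \<one>\<^bsub>Q W\<^esub>"
  using cl_single_letter[OF assms(1,2)] assms(3) by simp

lemma embeds_single: "a \<in> W \<Longrightarrow> embeds R {a} W"
  unfolding embeds_def
proof (intro ballI impI)
  fix w assume w: "w \<in> gwords {a}" "pres_cong W R w []"
  then have "exponent_sum w = 0" using exponent_sum_pres_cong by fastforce
  then have "cl {a} w = \<one>\<^bsub>Q {a}\<^esub>" using cl_single_letter_eq_one w(1) by blast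
  then show "pres_cong {a} R w []" using w(1) by (simp add: pres_class_eq_one_iff)
qed

lemma parabolic_isolated_empty_single: "parabolic_isolated R {} {a}"
proof (rule parabolic_isolatedI)
  fix w and n :: nat assume w: "w \<in> gwords {a}" "n \<ge> 1" "cl {a} (list_power n w) \<in> par {a} {}"
  then have "cl {a} (list_power n w) = cl {a} []" by (simp add: parabolic_empty one_presented)
  then have "int n * exponent_sum w = 0"
    using exponent_sum_cl[OF list_power_gwords[OF w(1)]] by fastforce
  then show "cl {a} w \<in> par {a} {}"
    using cl_single_letter_eq_one[OF w(1)] w(2) by (simp add: parabolic_empty)
qed

lemma dih_eval_relation_eq_one:
  assumes edge: "{s, t} \<in> E" and rel: "(u, v) \<in> R" "u \<in> gwords {s, t}"
  shows "v = []" "dih_eval (lab {s, t}) s u = \<one>\<^bsub>SL2\<^esub>"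
proof -
  obtain s' t' where st: "v = []" "{s', t'} \<in> E" "s' \<noteq> t'" "u \<in> gwords {s', t'}" "exponent_sum u = 0"
      "dih_eval (lab {s', t'}) s' u = \<one>\<^bsub>SL2\<^esub>"
    using rel(1) by (auto simp: edge_relations_def)
  show "v = []" by fact
  note distinct = edge_distinct[OF edge]
  consider "s' = s" "t' = t" | "s' = t" "t' = s" | "{s', t'} \<noteq> {s, t}"
    by (metis doubleton_eq_iff)
  then show "dih_eval (lab {s, t}) s u = \<one>\<^bsub>SL2\<^esub>"
  proof cases
    case 1
    then show ?thesis using st by simp
  next
    case 2
    then show ?thesis using st(6) dih_eval_swap[OF rel(2) distinct] by (simp add: insert_commute)
  next
    case 3
    have "fst ` set u \<subseteq> {s, t} \<inter> {s', t'}" using rel(2) st(4) by (simp add: gwords_iff)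
    then have "\<exists>x. u \<in> gwords {x}" using 3 st(3) distinct unfolding gwords_iff by blast
    then show ?thesis using dih_eval_single_letter[of u _ "lab {s, t}" s] st(5) by fastforce
  qed
qed

lemma dih_eval_cl:
  assumes edge: "{s, t} \<in> E" and "u \<in> gwords {s, t}" "cl {s, t} u = cl {s, t} v"
  shows "dih_eval (lab {s, t}) s u = dih_eval (lab {s, t}) s v"
proof -
  have "pres_cong {s, t} R u v" using assms(2,3) by (simp add: pres_class_eq_iff)
  then show ?thesis
    unfolding dih_eval_def
  proof (rule SL2.pres_cong_gword_eval[OF dih_letters_closed, rotated])
    fix u v assume rel: "(u, v) \<in> R" "u \<in> gwords {s, t}"
    show "gword_eval SL2 (\<lambda>v. if v = s then dih_a (lab {s, t}) else dih_b (lab {s, t})) u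
        = gword_eval SL2 (\<lambda>v. if v = s then dih_a (lab {s, t}) else dih_b (lab {s, t})) v"
      using dih_eval_relation_eq_one[OF edge rel] by (simp add: dih_eval_def)
  qed
qed

lemma cl_edge_eq_if_dih_eval_eq:
  assumes edge: "{s, t} \<in> E" and uv: "u \<in> gwords {s, t}" "v \<in> gwords {s, t}"
    and "exponent_sum u = exponent_sum v" "dih_eval (lab {s, t}) s u = dih_eval (lab {s, t}) s v"
  shows "cl {s, t} u = cl {s, t} v"
proof -
  have "dih_eval (lab {s, t}) s (gword_inv v @ u) = \<one>\<^bsub>SL2\<^esub>"
    using assms(5) SL2.l_inv[OF dih_eval_closed]
    by (simp add: dih_eval_append dih_eval_gword_inv del: SL2_simps)
  moreover have word: "gword_inv v @ u \<in> gwords {s, t}" using uv by simp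
  moreover have "exponent_sum (gword_inv v @ u) = 0" using assms(4) by simp
  ultimately have "(gword_inv v @ u, []) \<in> R"
    using edge edge_distinct[OF edge] unfolding edge_relations_def by blast
  then have "pres_cong {s, t} R (gword_inv v @ u) []" using word by (intro pres_cong.relation) auto
  then show ?thesis using pres_class_eq_iff_inv_append[OF uv] by blast
qed

lemma edge_parabolic_inter:
  assumes edge: "{a, b} \<in> E"
  shows "par {a, b} {b} \<inter> par {a, b} {a} = {\<one>\<^bsub>Q {a, b}\<^esub>}"
proof
  show "par {a, b} {b} \<inter> par {a, b} {a} \<subseteq> {\<one>\<^bsub>Q {a, b}\<^esub>}"
  proof
    fix g assume "g \<in> par {a, b} {b} \<inter> par {a, b} {a}"
    then obtain u v where uv: "u \<in> gwords {b}" "v \<in> gwords {a}" "g = cl {a, b} u"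
      "cl {a, b} u = cl {a, b} v"
      by (auto elim!: parabolicE)
    have u: "u \<in> gwords {a, b}" using uv(1) gwords_mono[of "{b}" "{a, b}"] by blast
    have "dih_b (lab {a, b}) [^]\<^bsub>SL2\<^esub> exponent_sum u = dih_a (lab {a, b}) [^]\<^bsub>SL2\<^esub> exponent_sum v"
      using dih_eval_cl[OF edge u uv(4)] edge_distinct[OF edge]
      by (simp add: dih_eval_single_letter[OF uv(1)] dih_eval_single_letter[OF uv(2)])
    then have "exponent_sum u = 0"
      using dih_int_pow_eq_imp_zero[OF lab_ge_2[OF edge]] exponent_sum_cl[OF u uv(4)] by simp
    then show "g \<in> {\<one>\<^bsub>Q {a, b}\<^esub>}" using cl_single_letter_eq_one[OF uv(1), of "{a, b}"] uv(3) by simp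
  qed
  show "{\<one>\<^bsub>Q {a, b}\<^esub>} \<subseteq> par {a, b} {b} \<inter> par {a, b} {a}"
    using subgroup.one_closed[OF subgroup_parabolic, of _ "{a, b}" R] by auto
qed

lemma edge_parabolic_isolated:
  assumes edge: "{a, b} \<in> E"
  shows "parabolic_isolated R {b} {a, b}"
proof (rule parabolic_isolatedI)
  fix w and n :: nat assume w: "w \<in> gwords {a, b}" "n \<ge> 1"
    and "cl {a, b} (list_power n w) \<in> par {a, b} {b}"
  then obtain u where u: "u \<in> gwords {b}" "cl {a, b} (list_power n w) = cl {a, b} u"
    by (auto elim: parabolicE)
  let ?p = "lab {a, b}"
  have power: "list_power n w \<in> gwords {a, b}" using w list_power_gwords by blast
  have "int n * exponent_sum w = exponent_sum u" using exponent_sum_cl[OF power u(2)] by simp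
  then have "dih_eval ?p a w [^]\<^bsub>SL2\<^esub> n = dih_b ?p [^]\<^bsub>SL2\<^esub> (int n * exponent_sum w)"
    using dih_eval_cl[OF edge power u(2)] edge_distinct[OF edge]
    by (simp add: dih_eval_list_power dih_eval_single_letter[OF u(1)])
  then have "dih_eval ?p a w = dih_b ?p [^]\<^bsub>SL2\<^esub> exponent_sum w"
    by (rule dih_eval_root[OF lab_ge_2[OF edge] edge_distinct[OF edge] w(2)])
  also have "\<dots> = dih_eval ?p a (letter_power b (exponent_sum w))"
    using edge_distinct[OF edge] by (simp add: dih_eval_letter_power)
  finally have "cl {a, b} w = cl {a, b} (letter_power b (exponent_sum w))"
    by (intro cl_edge_eq_if_dih_eval_eq[OF edge w(1)]) simp_all
  then show "cl {a, b} w \<in> par {a, b} {b}" by auto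
qed

lemma edge_parabolic_separated:
  assumes edge: "{a, b} \<in> E" and lab: "lab {a, b} \<ge> 3"
  shows "group.separated (Q {a, b}) (par {a, b} {a}) (par {a, b} {b})"
proof -
  let ?W = "{a, b}" and ?p = "lab {a, b}"
  interpret Q: group "Q ?W" by (rule group_presented_group)
  show ?thesis unfolding Q.separated_def
  proof (intro ballI impI)
    fix z z' g assume "z \<in> par ?W {a}" "z' \<in> par ?W {a}" "g \<in> par ?W {b}" and g: "g \<noteq> \<one>\<^bsub>Q ?W\<^esub>"
      and zgz: "z \<otimes>\<^bsub>Q ?W\<^esub> g \<otimes>\<^bsub>Q ?W\<^esub> z' \<in> par ?W {b}"
    then obtain u u' v where u: "u \<in> gwords {a}" "z = cl ?W u" "u' \<in> gwords {a}" "z' = cl ?W u'"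
        "v \<in> gwords {b}" "g = cl ?W v" by (auto elim!: parabolicE)
    have words: "u \<in> gwords ?W" "u' \<in> gwords ?W" "v \<in> gwords ?W"
      using u gwords_mono[of "{a}" ?W] gwords_mono[of "{b}" ?W] by blast+
    obtain v' where v': "v' \<in> gwords {b}" "cl ?W (u @ v @ u') = cl ?W v'"
      using zgz u words by (auto simp: presented_group_mult elim: parabolicE)
    have product: "u @ v @ u' \<in> gwords ?W" using words by simp
    have sum: "exponent_sum u + exponent_sum v + exponent_sum u' = exponent_sum v'"
      using exponent_sum_cl[OF product v'(2)] by simp
    have "exponent_sum v \<noteq> 0" using g u cl_single_letter_eq_one[of v b ?W] by auto
    moreover have "dih_a ?p [^]\<^bsub>SL2\<^esub> exponent_sum u \<otimes>\<^bsub>SL2\<^esub> dih_b ?p [^]\<^bsub>SL2\<^esub> exponent_sum v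
        \<otimes>\<^bsub>SL2\<^esub> dih_a ?p [^]\<^bsub>SL2\<^esub> exponent_sum u' = dih_b ?p [^]\<^bsub>SL2\<^esub> exponent_sum v'"
      using dih_eval_cl[OF edge product v'(2)] edge_distinct[OF edge]
      by (simp add: dih_eval_append SL2.m_assoc dih_eval_single_letter[OF u(1)]
        dih_eval_single_letter[OF u(3)]
          dih_eval_single_letter[OF u(5)] dih_eval_single_letter[OF v'(1)])
    ultimately have "exponent_sum u = 0" using dih_separated[OF lab _ sum] by blast
    then show "z = \<one>\<^bsub>Q ?W\<^esub>" using u(2) cl_single_letter_eq_one[OF u(1)] by simp
  qed
qed

lemma presented_amalgamI:
  assumes edges: "\<And>s t. {s, t} \<in> E \<Longrightarrow> {s, t} \<subseteq> U True \<union> U False \<Longrightarrow> \<exists>i. {s, t} \<subseteq> U i"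
    and "\<And>i. embeds R (U True \<inter> U False) (U i)"
  shows "presented_amalgam R U"
proof
  fix u v assume uv: "(u, v) \<in> R" "u \<in> gwords (U True \<union> U False)"
  then obtain s t where st: "v = []" "{s, t} \<in> E" "u \<in> gwords {s, t}"
    by (auto simp: edge_relations_def)
  obtain i where "{s, t} \<inter> (U True \<union> U False) \<subseteq> U i"
    using edges[OF st(2)] by (cases "s \<in> U True \<union> U False"; cases "t \<in> U True \<union> U False") blast+
  moreover have "fst ` set u \<subseteq> {s, t} \<inter> (U True \<union> U False)" using uv(2) st(3) by (simp add: gwords_iff)
  ultimately have "u \<in> gwords (U i)" unfolding gwords_iff by blast
  then show "\<exists>i. u \<in> gwords (U i) \<and> v \<in> gwords (U i)" using st(1) by auto
qed (use assms(2) in blast)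

definition independent :: "'v set \<Rightarrow> bool" where
  "independent N \<longleftrightarrow> (\<forall>x\<in>N. \<forall>y\<in>N. {x, y} \<notin> E)"

definition is_star :: "'v \<Rightarrow> 'v set \<Rightarrow> bool" where
  "is_star a N \<longleftrightarrow> finite N \<and> a \<notin> N \<and> independent N \<and> (\<forall>b\<in>N. {a, b} \<in> E)"

lemma is_star_subset: "is_star a N \<Longrightarrow> N' \<subseteq> N \<Longrightarrow> is_star a N'"
  by (auto simp: is_star_def independent_def finite_subset)

lemma star_presented_amalgam:
  assumes "a \<notin> L True \<union> L False" "L True \<inter> L False = {}" "independent (L True \<union> L False)"
  shows "presented_amalgam R (\<lambda>i. insert a (L i))"
proof (rule presented_amalgamI)
  have centre: "insert a (L True) \<inter> insert a (L False) = {a}" using assms(1,2) by blast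
  show "embeds R (insert a (L True) \<inter> insert a (L False)) (insert a (L i))" for i
    unfolding centre by (rule embeds_single) simp
  fix s t assume "{s, t} \<in> E" and st: "{s, t} \<subseteq> insert a (L True) \<union> insert a (L False)"
  then have "s = a \<or> t = a" using assms(3) by (auto simp: independent_def)
  then consider "{s, t} \<subseteq> insert a (L True)" | "{s, t} \<subseteq> insert a (L False)" using st by blast
  then show "\<exists>i. {s, t} \<subseteq> insert a (L i)" by cases blast+
qed

lemma star_amalgam_subgroups:
  assumes L: "a \<notin> L True \<union> L False" "L True \<inter> L False = {}" "independent (L True \<union> L False)"
    and W: "W = insert a (L True \<union> L False)"
    and inter: "\<And>i. par (insert a (L i)) (L i) \<inter> par (insert a (L i)) {a} = {\<one>\<^bsub>Q (insert a (L i))\<^esub>}"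
  shows "amalgam_subgroups (Q W) (\<lambda>i. par W (insert a (L i))) (par W {a}) (\<lambda>i. par W (L i))"
    and "embeds R (insert a (L i)) W"
    and "generate (Q W) (par W (L True) \<union> par W (L False)) = par W (L True \<union> L False)"
proof -
  interpret star: presented_amalgam R "\<lambda>i. insert a (L i)" by (rule star_presented_amalgam[OF L])
  have W_eq: "insert a (L True) \<union> insert a (L False) = W" "insert a (L True) \<inter> insert a (L False) = {a}"
    using L(1,2) W by auto
  show embeds: "embeds R (insert a (L i)) W" for i using star.embeds_factor[of i] W_eq(1) by simp
  have sub: "insert a (L i) \<subseteq> W" for i using W by (cases i) auto
  have amalgam: "amalgam (Q W) (\<lambda>i. par W (insert a (L i))) (par W {a})"
    using star.amalgam unfolding W_eq .
  have sub_L: "L i \<subseteq> W" for i using sub by blast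
  have "par W (L i) \<inter> par W {a} = {\<one>\<^bsub>Q W\<^esub>}" for i
    using parabolic_inter_eq_one_if_embeds[OF inter embeds _ _ sub] by blast
  then show "amalgam_subgroups (Q W) (\<lambda>i. par W (insert a (L i))) (par W {a}) (\<lambda>i. par W (L i))"
    by (intro amalgam_subgroups.intro amalgam_subgroups_axioms.intro amalgam
        subgroup_parabolic[OF sub_L] parabolic_mono subset_insertI)
  show "generate (Q W) (par W (L True) \<union> par W (L False)) = par W (L True \<union> L False)"
    by (rule generate_parabolic) (use W in auto)
qed

text \<open>Hanging the leaf \<open>b\<close> on the star with centre \<open>a\<close> and set of leaves \<open>N\<close>.\<close>

abbreviation leaf_partition :: "'v set \<Rightarrow> 'v \<Rightarrow> bool \<Rightarrow> 'v set" where
  "leaf_partition N b i \<equiv> (if i then N else {b})"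

lemma star_insert_amalgam_subgroups:
  assumes star: "is_star a (insert b N)" and b: "b \<notin> N"
    and inter: "par (insert a N) N \<inter> par (insert a N) {a} = {\<one>\<^bsub>Q (insert a N)\<^esub>}"
    and W: "W = insert a (insert b N)"
  shows "amalgam_subgroups (Q W) (\<lambda>i. par W (insert a (leaf_partition N b i))) (par W {a})
      (\<lambda>i. par W (leaf_partition N b i))"
    and "embeds R (insert a (leaf_partition N b i)) W"
    and "generate (Q W) (par W (leaf_partition N b True) \<union> par W (leaf_partition N b False))
      = par W (insert b N)"
proof -
  have "{a, b} \<in> E" using star by (simp add: is_star_def)
  then have inter_i: "par (insert a (leaf_partition N b i)) (leaf_partition N b i)
      \<inter> par (insert a (leaf_partition N b i)) {a} = {\<one>\<^bsub>Q (insert a (leaf_partition N b i))\<^esub>}" for i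
    using inter edge_parabolic_inter[of a b] by (cases i) simp_all
  have L: "a \<notin> leaf_partition N b True \<union> leaf_partition N b False"
    "leaf_partition N b True \<inter> leaf_partition N b False = {}"
    "independent (leaf_partition N b True \<union> leaf_partition N b False)"
    "W = insert a (leaf_partition N b True \<union> leaf_partition N b False)"
    using star b W by (auto simp: is_star_def)
  note split = star_amalgam_subgroups[OF L inter_i]
  show "amalgam_subgroups (Q W) (\<lambda>i. par W (insert a (leaf_partition N b i))) (par W {a})
      (\<lambda>i. par W (leaf_partition N b i))"
    and "embeds R (insert a (leaf_partition N b i)) W"
    and "generate (Q W) (par W (leaf_partition N b True) \<union> par W (leaf_partition N b False))
      = par W (insert b N)"
    using split by simp_all
qed

lemma star_parabolic_inter:
  assumes "is_star a N"
  shows "par (insert a N) N \<inter> par (insert a N) {a} = {\<one>\<^bsub>Q (insert a N)\<^esub>}"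
proof -
  have "finite N" using assms by (simp add: is_star_def)
  then show ?thesis
    using assms
  proof (induction N rule: finite_induct)
    case empty
    have "\<one>\<^bsub>Q {a}\<^esub> \<in> par {a} {a}"
      using subgroup.one_closed[OF subgroup_parabolic, of "{a}" "{a}" R] by simp
    then show ?case by (simp add: parabolic_empty)
  next
    case (insert b N)
    have "is_star a N" using is_star_subset[OF insert.prems] by blast
    note split = star_insert_amalgam_subgroups[OF insert.prems insert.hyps(2)
        insert.IH[OF this] HOL.refl]
    show ?case using amalgam_subgroups.H_inter_C[OF split(1)] unfolding split(3) .
  qed
qed

lemma star_parabolic_separated:
  assumes "is_star a N" "\<And>b. b \<in> N \<Longrightarrow> lab {a, b} \<ge> 3"
  shows "group.separated (Q (insert a N)) (par (insert a N) {a}) (par (insert a N) N)"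
proof -
  have "finite N" using assms by (simp add: is_star_def)
  then show ?thesis
    using assms
  proof (induction N rule: finite_induct)
    case empty
    then show ?case by (simp add: group.separated_def[OF group_presented_group] parabolic_empty)
  next
    case (insert b N)
    let ?W = "insert a (insert b N)"
    have star: "is_star a N" using is_star_subset[OF insert.prems(1)] by blast
    note split = star_insert_amalgam_subgroups[OF insert.prems(1) insert.hyps(2)
        star_parabolic_inter[OF star] HOL.refl]
    have "{a, b} \<in> E" using insert.prems(1) by (simp add: is_star_def)
    then have "group.separated (Q (insert a (leaf_partition N b i)))
        (par (insert a (leaf_partition N b i)) {a})
        (par (insert a (leaf_partition N b i)) (leaf_partition N b i))" for i
      using insert.IH[OF star] edge_parabolic_separated[of a b] insert.prems(2) by simp
    then have "group.separated (Q ?W) (par ?W {a}) (par ?W (leaf_partition N b i))" for i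
      by (rule separated_parabolic_if_embeds[OF _ split(2)]) auto
    then show ?case using amalgam_subgroups.H_separated[OF split(1)] unfolding split(3) by blast
  qed
qed

lemma star_embeds_leaves:
  assumes "is_star a N"
  shows "embeds R N (insert a N)"
proof -
  have "finite N" using assms by (simp add: is_star_def)
  then show ?thesis
    using assms
  proof (induction N rule: finite_induct)
    case empty
    show ?case by (rule embeds_empty)
  next
    case (insert b N)
    have star: "is_star a N" using is_star_subset[OF insert.prems] by blast
    note split = star_insert_amalgam_subgroups[OF insert.prems insert.hyps(2)
        star_parabolic_inter[OF star] HOL.refl]
    have "embeds R (leaf_partition N b i) (insert a (leaf_partition N b i))" for i
      using insert.IH[OF star] embeds_single[of b "{a, b}"] by simp
    from embeds_trans[OF this split(2)]
    have "embeds R (leaf_partition N b i) (insert a (insert b N))" for i by blast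
    from embeds_Un_if_amalgam_subgroups[OF split(1) this] show ?case by auto
  qed
qed

lemma exists_leaf_other_labels_ge_3:
  assumes star: "is_star a N" and "N \<noteq> {}"
  obtains b where "b \<in> N" "\<And>x. x \<in> N - {b} \<Longrightarrow> lab {a, x} \<ge> 3"
proof -
  have edge: "{a, x} \<in> E" if "x \<in> N" for x using star that by (simp add: is_star_def)
  have unique: "x = b" if "b \<in> N" "x \<in> N" "lab {a, b} = 2" "lab {a, x} = 2" for b x
  proof (rule ccontr)
    assume "x \<noteq> b"
    then have "{a, x} \<noteq> {a, b}" by (simp add: doubleton_eq_iff)
    then have "\<exists>e\<in>E. \<exists>e'\<in>E. e \<noteq> e' \<and> e \<inter> e' \<noteq> {} \<and> lab e = 2 \<and> lab e' = 2"
      using edge that by (intro bexI[of _ "{a, x}"] bexI[of _ "{a, b}"]) auto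
    then show False using two_two_free unfolding two_two_free_def by contradiction
  qed
  have label: "lab {a, x} = 2 \<or> lab {a, x} \<ge> 3" if "x \<in> N" for x
    using lab_ge_2[OF edge[OF that]] by linarith
  show ?thesis
  proof (cases "\<exists>b\<in>N. lab {a, b} = 2")
    case True
    then show ?thesis using that unique label by blast
  next
    case False
    then show ?thesis using that label \<open>N \<noteq> {}\<close> by blast
  qed
qed

lemma star_insert_parabolic_isolated:
  assumes star: "is_star a (insert b N)" and b: "b \<notin> N" and "N \<noteq> {}"
    and labels: "\<And>x. x \<in> N \<Longrightarrow> lab {a, x} \<ge> 3"
    and proper: "\<And>U W. W \<subset> insert a (insert b N) \<Longrightarrow> U \<subseteq> W \<Longrightarrow> parabolic_isolated R U W"
  shows "parabolic_isolated R (insert b N) (insert a (insert b N))"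
proof -
  let ?W = "insert a (insert b N)" and ?L = "leaf_partition N b"
  let ?P = "\<lambda>i. par ?W (insert a (?L i))"
  have star_N: "is_star a N" using is_star_subset[OF star] by blast
  note split = star_insert_amalgam_subgroups[OF star b star_parabolic_inter[OF star_N] HOL.refl]
  interpret A: amalgam_subgroups "Q ?W" ?P "par ?W {a}" "\<lambda>i. par ?W (?L i)" by (rule split(1))
  have sub: "insert a (?L i) \<subset> ?W" for i
    using star b \<open>N \<noteq> {}\<close> by (cases i) (auto simp: is_star_def)
  have isolated: "A.isolated_in (?P i) (par ?W U)" if "U \<subseteq> insert a (?L i)" for i U
    using isolated_in_parabolic_if_embeds[OF proper[OF sub that] split(2) that] sub by blast
  have "isolated_amalgam (Q ?W) ?P (par ?W {a})"
    by (intro isolated_amalgam.intro isolated_amalgam_axioms.intro A.amalgam_axioms isolated) simp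
  moreover have "A.isolated_in (?P i) (par ?W (?L i))" for i
    by (rule isolated) blast
  moreover have "A.separated (par ?W {a}) (par ?W (?L True))"
    by (rule separated_parabolic_if_embeds[OF _ split(2)[of True]])
      (use star_parabolic_separated[OF star_N labels] in auto)
  ultimately have "A.isolated_in (carrier (Q ?W)) A.H" by (rule A.H_isolated)
  then show ?thesis unfolding split(3) parabolic_isolated_def .
qed

lemma star_parabolic_isolated:
  assumes star: "is_star a N"
    and proper: "\<And>U W. W \<subset> insert a N \<Longrightarrow> U \<subseteq> W \<Longrightarrow> parabolic_isolated R U W"
  shows "parabolic_isolated R N (insert a N)"
proof (cases "N = {}")
  case True
  then show ?thesis using parabolic_isolated_empty_single by simp
next
  case False
  then obtain b where b: "b \<in> N" "\<And>x. x \<in> N - {b} \<Longrightarrow> lab {a, x} \<ge> 3"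
    using exists_leaf_other_labels_ge_3[OF star] by blast
  then have N: "N = insert b (N - {b})" by blast
  show ?thesis
  proof (cases "N - {b} = {}")
    case True
    then have "N = {b}" using b(1) by blast
    then show ?thesis using edge_parabolic_isolated[of a b] star by (simp add: is_star_def)
  next
    case False
    have "is_star a (insert b (N - {b}))" using star N by simp
    from star_insert_parabolic_isolated[OF this _ False b(2)] proper N show ?thesis by simp
  qed
qed

definition nbrs :: "'v set \<Rightarrow> 'v \<Rightarrow> 'v set" where
  "nbrs W a = {b \<in> W. b \<noteq> a \<and> {a, b} \<in> E}"

lemma nbrs_subset: "nbrs W a \<subseteq> W - {a}"
  by (auto simp: nbrs_def)

lemma is_star_nbrs:
  assumes "finite W"
  shows "is_star a (nbrs W a)"
proof -
  have "{x, y} \<notin> E" if "x \<in> nbrs W a" "y \<in> nbrs W a" for x y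
  proof
    assume xy: "{x, y} \<in> E"
    have "distinct [x, a, y] \<and> {x, a} \<in> E \<and> {a, y} \<in> E \<and> {x, y} \<in> E"
      using that xy edge_distinct[OF xy] by (auto simp: nbrs_def insert_commute)
    then show False using triangle_free unfolding triangle_free_def by blast
  qed
  then show ?thesis using assms by (auto simp: is_star_def independent_def nbrs_def)
qed

abbreviation vertex_cover :: "'v set \<Rightarrow> 'v \<Rightarrow> bool \<Rightarrow> 'v set" where
  "vertex_cover W a i \<equiv> (if i then insert a (nbrs W a) else W - {a})"

lemma vertex_cover_Un_Int:
  assumes "a \<in> W"
  shows "vertex_cover W a True \<union> vertex_cover W a False = W"
    "vertex_cover W a True \<inter> vertex_cover W a False = nbrs W a"
  using assms by (auto simp: nbrs_def)

lemma vertex_presented_amalgam: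
  assumes W: "finite W" "a \<in> W" and embeds: "embeds R (nbrs W a) (W - {a})"
  shows "presented_amalgam R (vertex_cover W a)"
proof (rule presented_amalgamI)
  note cover = vertex_cover_Un_Int[OF W(2)]
  show "embeds R (vertex_cover W a True \<inter> vertex_cover W a False) (vertex_cover W a i)" for i
    unfolding cover using star_embeds_leaves[OF is_star_nbrs[OF W(1)]] embeds by simp
  fix s t assume "{s, t} \<in> E" "{s, t} \<subseteq> vertex_cover W a True \<union> vertex_cover W a False"
  then have "{s, t} \<subseteq> vertex_cover W a True \<or> {s, t} \<subseteq> vertex_cover W a False"
    unfolding cover(1) using edge_distinct[of s t]
    by (cases "s = a"; cases "t = a") (auto simp: nbrs_def insert_commute)
  then show "\<exists>i. {s, t} \<subseteq> vertex_cover W a i" by blast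
qed

lemma vertex_amalgam:
  assumes W: "finite W" "a \<in> W" and "embeds R (nbrs W a) (W - {a})"
  shows "amalgam (Q W) (\<lambda>i. par W (vertex_cover W a i)) (par W (nbrs W a))"
    and "embeds R (vertex_cover W a i) W"
  using presented_amalgam.amalgam[OF vertex_presented_amalgam[OF assms]]
    presented_amalgam.embeds_factor[OF vertex_presented_amalgam[OF assms], of i]
  unfolding vertex_cover_Un_Int[OF W(2)] .

lemma vertex_isolated_amalgam:
  assumes W: "finite W" "a \<in> W" and "embeds R (nbrs W a) (W - {a})"
    and "\<And>i. parabolic_isolated R (nbrs W a) (vertex_cover W a i)"
  shows "isolated_amalgam (Q W) (\<lambda>i. par W (vertex_cover W a i)) (par W (nbrs W a))"
  using presented_amalgam.isolated_amalgam[OF vertex_presented_amalgam[OF assms(1-3)]] assms(4)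
  unfolding vertex_cover_Un_Int[OF W(2)] by blast

lemma vertex_complement_embeds_isolated:
  assumes W: "finite W" "a \<in> W"
    and proper: "\<And>U W'. W' \<subset> W \<Longrightarrow> U \<subseteq> W' \<Longrightarrow> embeds R U W' \<and> parabolic_isolated R U W'"
  shows "embeds R (W - {a}) W \<and> parabolic_isolated R (W - {a}) W"
proof (cases "nbrs W a = W - {a}")
  case True
  then have W_eq: "W = insert a (nbrs W a)" using W(2) by blast
  note star = is_star_nbrs[OF W(1), of a]
  have "parabolic_isolated R (nbrs W a) W"
    using star_parabolic_isolated[OF star] proper unfolding W_eq[symmetric] by blast
  moreover have "embeds R (nbrs W a) W"
    using star_embeds_leaves[OF star] unfolding W_eq[symmetric] .
  ultimately show ?thesis unfolding True by blast
next
  case False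
  then have cover: "vertex_cover W a i \<subset> W" "nbrs W a \<subseteq> vertex_cover W a i" for i
    using W(2) nbrs_subset[of W a] by (cases i; auto)+
  have embeds: "embeds R (nbrs W a) (W - {a})"
    using proper[OF cover(1)[of False], of "nbrs W a"] cover(2)[of False] by simp
  interpret isolated_amalgam "Q W" "\<lambda>i. par W (vertex_cover W a i)" "par W (nbrs W a)"
    using proper[OF cover] by (intro vertex_isolated_amalgam[OF W embeds]) blast
  show ?thesis
    using P_isolated[of False] vertex_amalgam(2)[OF W embeds, of False]
    by (simp add: parabolic_isolated_def)
qed

theorem parabolic_embeds_isolated:
  assumes "finite W" "U \<subseteq> W"
  shows "embeds R U W \<and> parabolic_isolated R U W"
  using assms
proof (induction "card W" arbitrary: W U rule: less_induct)
  case less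
  have proper: "embeds R U W' \<and> parabolic_isolated R U W'" if "W' \<subset> W" "U \<subseteq> W'" for U W'
    using less.hyps[OF psubset_card_mono[OF less.prems(1) that(1)]
        finite_subset[OF _ less.prems(1)] that(2)] that(1)
    by auto
  show ?case
  proof (cases "U = W")
    case True
    then show ?thesis using embeds_refl parabolic_isolated_refl by blast
  next
    case False
    then obtain a where a: "a \<in> W" "U \<subseteq> W - {a}" using less.prems(2) by blast
    then have U: "embeds R U (W - {a})" "parabolic_isolated R U (W - {a})"
      using proper[of "W - {a}" U] by auto
    have complement: "embeds R (W - {a}) W" "parabolic_isolated R (W - {a}) W"
      using vertex_complement_embeds_isolated[OF less.prems(1) a(1) proper] by blast+
    show ?thesis
      using embeds_trans[OF U(1) complement(1) a(2)] parabolic_isolated_trans[OF U(2) complement a(2)]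
      by blast
  qed
qed

lemma letter_notin_complement_parabolic:
  assumes W: "finite W" "x \<in> W"
  shows "cl W [(x, True)] \<notin> par W (W - {x})"
proof
  let ?N = "nbrs W x"
  have embeds: "embeds R ?N (W - {x})"
    using parabolic_embeds_isolated[of "W - {x}" ?N] W nbrs_subset by blast
  interpret A: amalgam "Q W" "\<lambda>i. par W (vertex_cover W x i)" "par W ?N"
    by (rule vertex_amalgam(1)[OF W embeds])
  assume "cl W [(x, True)] \<in> par W (W - {x})"
  then have "cl W [(x, True)] \<in> par W (vertex_cover W x i)" for i by simp
  from A.mem_C_if_mem_both[OF this[of True] this[of False]]
  have "cl W [(x, True)] \<in> par W ?N \<inter> par W {x}" by simp
  moreover have "par W ?N \<inter> par W {x} = {\<one>\<^bsub>Q W\<^esub>}"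
    using vertex_amalgam(2)[OF W embeds, of True] W(2) nbrs_subset[of W x]
    by (intro parabolic_inter_eq_one_if_embeds[OF star_parabolic_inter[OF is_star_nbrs[OF W(1)]]]) auto
  ultimately have "cl W [(x, True)] = cl W []" by (simp add: one_presented)
  then have "exponent_sum [(x, True)] = exponent_sum ([] :: 'v gword)"
    using W(2) by (intro exponent_sum_cl[of _ W]) auto
  then show False by simp
qed

lemma parabolic_ne_carrier:
  assumes "finite W" "U \<subseteq> W - {x}" "x \<in> W"
  shows "par W U \<noteq> carrier (Q W)"
proof -
  have "cl W [(x, True)] \<notin> par W U"
    using letter_notin_complement_parabolic[OF assms(1,3)] parabolic_mono[OF assms(2), of R W] by blast
  moreover have "cl W [(x, True)] \<in> carrier (Q W)" using assms(3) by simp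
  ultimately show ?thesis by blast
qed

theorem quotient_noncommuting_powers:
  assumes V: "finite V" "a \<in> V" "c \<in> V" "a \<noteq> c" "{a, c} \<notin> E"
    and S: "finite S" "S \<subseteq> carrier (Q V)" "generate (Q V) S = carrier (Q V)" and m: "m \<ge> 1"
  obtains s t where "s \<in> S" "t \<in> S"
    "s [^]\<^bsub>Q V\<^esub> (m::nat) \<otimes>\<^bsub>Q V\<^esub> t [^]\<^bsub>Q V\<^esub> m \<noteq> t [^]\<^bsub>Q V\<^esub> m \<otimes>\<^bsub>Q V\<^esub> s [^]\<^bsub>Q V\<^esub> m"
proof -
  have finite_cover: "finite (vertex_cover V a i)" "nbrs V a \<subseteq> vertex_cover V a i" for i
    using V(1) finite_subset[OF nbrs_subset[of V a]] nbrs_subset[of V a] by auto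
  have embeds: "embeds R (nbrs V a) (V - {a})"
    using parabolic_embeds_isolated[OF finite_cover[of False]] by simp
  have isolated: "parabolic_isolated R (nbrs V a) (vertex_cover V a i)" for i
    using parabolic_embeds_isolated[OF finite_cover[of i]] by blast
  interpret A: isolated_amalgam "Q V" "\<lambda>i. par V (vertex_cover V a i)" "par V (nbrs V a)"
    by (rule vertex_isolated_amalgam[OF V(1,2) embeds isolated])
  have proper: "par V (vertex_cover V a i) \<noteq> carrier (Q V)" for i
  proof (cases i)
    case True
    have "insert a (nbrs V a) \<subseteq> V - {c}" using V by (auto simp: nbrs_def)
    then show ?thesis using parabolic_ne_carrier[OF V(1) _ V(3)] True by simp
  next
    case False
    then show ?thesis using parabolic_ne_carrier[OF V(1) _ V(2)] by simp
  qed
  let ?letters = "(\<lambda>x. cl V [(x, True)]) ` V"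
  have "generate (Q V) ?letters = carrier (Q V)"
    using generate_letters[of V V R] parabolic_self[of R V] by simp
  moreover have "x \<in> vertex_cover V a True \<or> x \<in> vertex_cover V a False" if "x \<in> V" for x
    using vertex_cover_Un_Int(1)[OF V(2)] that by blast
  then have "?letters \<subseteq> par V (vertex_cover V a True) \<union> par V (vertex_cover V a False)"
    by fastforce
  ultimately show ?thesis
    using A.noncommuting_powers_in_finite_generating_set[OF proper finite_imageI[OF V(1)] _ _ S m] that
    by blast
qed

end

subsection \<open>From the quotient back to the Artin group\<close>

context group
begin

lemma generate_finite_subset:
  assumes "x \<in> generate G S"
  obtains F where "finite F" "F \<subseteq> S" "x \<in> generate G F"
proof -
  have "\<exists>F. finite F \<and> F \<subseteq> S \<and> x \<in> generate G F"
    using assms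
  proof (induction rule: generate.induct)
    case one
    show ?case by (intro exI[of _ "{}"]) (auto intro: generate.one)
  next
    case (incl h)
    then show ?case by (intro exI[of _ "{h}"]) (auto intro: generate.incl)
  next
    case (inv h)
    then show ?case by (intro exI[of _ "{h}"]) (auto intro: generate.inv)
  next
    case (eng h1 h2)
    then obtain F1 F2 where F: "finite F1" "F1 \<subseteq> S" "h1 \<in> generate G F1"
        "finite F2" "F2 \<subseteq> S" "h2 \<in> generate G F2"
      by blast
    have "h1 \<in> generate G (F1 \<union> F2)" "h2 \<in> generate G (F1 \<union> F2)"
      using F mono_generate[of F1 "F1 \<union> F2"] mono_generate[of F2 "F1 \<union> F2"] by auto
    then show ?case using F by (intro exI[of _ "F1 \<union> F2"]) (auto intro: generate.eng)
  qed
  then show ?thesis using that by blast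
qed

lemma finite_generating_subset:
  assumes T: "finite T" "T \<subseteq> carrier G" "generate G T = carrier G"
    and S: "S \<subseteq> carrier G" "generate G S = carrier G"
  obtains F where "finite F" "F \<subseteq> S" "generate G F = carrier G"
proof -
  have "\<forall>x\<in>T. \<exists>F. finite F \<and> F \<subseteq> S \<and> x \<in> generate G F"
    using generate_finite_subset T(2) S(2) by (metis subsetD)
  then obtain F where F: "\<And>x. x \<in> T \<Longrightarrow> finite (F x) \<and> F x \<subseteq> S \<and> x \<in> generate G (F x)" by metis
  define F' where "F' = (\<Union>x\<in>T. F x)"
  have F': "finite F'" "F' \<subseteq> S" "F' \<subseteq> carrier G" using F T(1) S(1) by (auto simp: F'_def)
  have "x \<in> generate G F'" if "x \<in> T" for x
    using F[OF that] mono_generate[of "F x" F'] that by (auto simp: F'_def)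
  then have "T \<subseteq> generate G F'" by (rule subsetI)
  then have "generate G T \<subseteq> generate G F'"
    by (rule generate_subgroup_incl[OF _ generate_is_subgroup[OF F'(3)]])
  then have "carrier G \<subseteq> generate G F'" unfolding T(3) .
  then have "generate G F' = carrier G" using generate_incl[OF F'(3)] by (rule subset_antisym[rotated])
  then show ?thesis by (rule that[OF F'(1,2)])
qed

end

lemma generates_artin_gens: "generates (artin_group V E lab) (artin_gen V E lab ` V)"
proof -
  have "artin_gen V E lab = (\<lambda>x. pres_class V (artin_relations E lab) [(x, True)])"
    by (simp add: artin_gen_def fun_eq_iff)
  moreover have "(\<lambda>x. pres_class V (artin_relations E lab) [(x, True)]) ` V
      \<subseteq> carrier (artin_group V E lab)"
    by (auto simp: artin_group_def)
  moreover have "generate (artin_group V E lab)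
      ((\<lambda>x. pres_class V (artin_relations E lab) [(x, True)]) ` V)
      = carrier (artin_group V E lab)"
    unfolding artin_group_def by (simp only: generate_letters[OF subset_refl] parabolic_self)
  ultimately show ?thesis unfolding generates_def by simp
qed

context triangle_free_graph
begin

definition artin_quotient_map :: "'v set \<Rightarrow> 'v gword set \<Rightarrow> 'v gword set" where
  "artin_quotient_map V = presented_lift (Q V) (\<lambda>x. cl V [(x, True)])"

lemma group_hom_artin_quotient_map: "group_hom (artin_group V E lab) (Q V) (artin_quotient_map V)"
  and artin_quotient_map_pres_class:
    "w \<in> gwords V \<Longrightarrow> artin_quotient_map V (pres_class V (artin_relations E lab) w) = cl V w"
proof -
  let ?eval = "gword_eval (Q V) (\<lambda>x. cl V [(x, True)])"
  have letters: "(\<lambda>x. cl V [(x, True)]) \<in> V \<rightarrow> carrier (Q V)" by auto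
  have relations: "?eval u = ?eval v"
    if rel: "(u, v) \<in> artin_relations E lab" and uv: "u \<in> gwords V" "v \<in> gwords V" for u v
  proof -
    obtain s t where st: "{s, t} \<in> E" "u = alternating_word s t (lab {s, t})"
        "v = alternating_word t s (lab {s, t})"
      using rel by (auto simp: artin_relations_def)
    have sub: "{s, t} \<subseteq> V" using alternating_word_letters[OF lab_ge_2[OF st(1)]] uv(1) st(2) by auto
    have words: "u \<in> gwords {s, t}" "v \<in> gwords {s, t}"
      using alternating_word_gwords[of s t] alternating_word_gwords[of t s] st
      by (simp_all add: insert_commute)
    have "cl {s, t} u = cl {s, t} v"
      using dih_eval_alternating_word[OF lab_ge_2[OF st(1)] edge_distinct[OF st(1)]] st
      by (intro cl_edge_eq_if_dih_eval_eq[OF st(1) words]) simp_all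
    then have "cl V u = cl V v" by (rule pres_class_mono[OF sub words(1)])
    then show ?thesis using uv by (simp add: gword_eval_pres_class)
  qed
  show "group_hom (artin_group V E lab) (Q V) (artin_quotient_map V)"
    unfolding artin_group_def artin_quotient_map_def
    by (rule group.group_hom_presented_lift[OF group_presented_group letters relations])
  show "artin_quotient_map V (pres_class V (artin_relations E lab) w) = cl V w" if "w \<in> gwords V"
    using group.presented_lift_pres_class[OF group_presented_group letters relations that] that
    by (simp add: artin_quotient_map_def gword_eval_pres_class)
qed

lemma artin_quotient_map_surj: "artin_quotient_map V ` carrier (artin_group V E lab) = carrier (Q V)"
  using artin_quotient_map_pres_class by (force simp: artin_group_def carrier_presented image_image)

end

lemma (in group_hom) commute_pow_image:
  assumes "s \<in> carrier G" "t \<in> carrier G" "s [^] (m::nat) \<otimes> t [^] m = t [^] m \<otimes> s [^] m"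
  shows "h s [^]\<^bsub>H\<^esub> m \<otimes>\<^bsub>H\<^esub> h t [^]\<^bsub>H\<^esub> m = h t [^]\<^bsub>H\<^esub> m \<otimes>\<^bsub>H\<^esub> h s [^]\<^bsub>H\<^esub> m"
  using assms by (metis G.nat_pow_closed hom_mult hom_nat_pow)

theorem artin_noncommuting_powers:
  fixes E :: "'v set set"
  assumes graph: "presentation_graph V E lab" "triangle_free E" "two_two_free E lab"
    and nonadjacent: "a \<in> V" "c \<in> V" "a \<noteq> c" "{a, c} \<notin> E"
    and S: "generates (artin_group V E lab) S" and m: "m \<ge> 1"
  obtains s t where "s \<in> S" "t \<in> S"
    "s [^]\<^bsub>artin_group V E lab\<^esub> (m::nat) \<otimes>\<^bsub>artin_group V E lab\<^esub> t [^]\<^bsub>artin_group V E lab\<^esub> m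
      \<noteq> t [^]\<^bsub>artin_group V E lab\<^esub> m \<otimes>\<^bsub>artin_group V E lab\<^esub> s [^]\<^bsub>artin_group V E lab\<^esub> m"
proof -
  interpret triangle_free_graph E lab
    using graph by unfold_locales (auto simp: presentation_graph_def)
  interpret q: group_hom "artin_group V E lab" "Q V" "artin_quotient_map V"
    by (rule group_hom_artin_quotient_map)
  have V: "finite V" using graph by (simp add: presentation_graph_def)
  obtain F where F: "finite F" "F \<subseteq> S"
    "generate (artin_group V E lab) F = carrier (artin_group V E lab)"
    using q.G.finite_generating_subset[OF finite_imageI[OF V]
        generates_artin_gens[unfolded generates_def, THEN conjunct1]
        generates_artin_gens[unfolded generates_def, THEN conjunct2]
        S[unfolded generates_def, THEN conjunct1] S[unfolded generates_def, THEN conjunct2]] .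
  have F_carrier: "F \<subseteq> carrier (artin_group V E lab)" using F(2) S by (auto simp: generates_def)
  let ?q = "artin_quotient_map V"
  have image: "?q ` F \<subseteq> carrier (Q V)" "generate (Q V) (?q ` F) = carrier (Q V)"
    using F_carrier q.generate_img[OF F_carrier] F(3) artin_quotient_map_surj by auto
  obtain s' t' where "s' \<in> ?q ` F" "t' \<in> ?q ` F"
    "s' [^]\<^bsub>Q V\<^esub> m \<otimes>\<^bsub>Q V\<^esub> t' [^]\<^bsub>Q V\<^esub> m \<noteq> t' [^]\<^bsub>Q V\<^esub> m \<otimes>\<^bsub>Q V\<^esub> s' [^]\<^bsub>Q V\<^esub> m"
    using quotient_noncommuting_powers[OF V nonadjacent finite_imageI[OF F(1)] image m] .
  then obtain s t where st: "s \<in> F" "t \<in> F"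
    "?q s [^]\<^bsub>Q V\<^esub> m \<otimes>\<^bsub>Q V\<^esub> ?q t [^]\<^bsub>Q V\<^esub> m \<noteq> ?q t [^]\<^bsub>Q V\<^esub> m \<otimes>\<^bsub>Q V\<^esub> ?q s [^]\<^bsub>Q V\<^esub> m" by blast
  then have "s \<in> S" "t \<in> S" "s \<in> carrier (artin_group V E lab)" "t \<in> carrier (artin_group V E lab)"
    using F(2) F_carrier by auto
  then show ?thesis using that q.commute_pow_image st(3) by blast
qed

subsection \<open>Finiteness of dihedral Coxeter groups\<close>

context group
begin

definition alt_prods :: "'a \<Rightarrow> 'a \<Rightarrow> nat \<Rightarrow> 'a set" where
  "alt_prods x y p = alt_prod x y ` {..p} \<union> alt_prod y x ` {..p}"

lemma alt_prods_commute: "alt_prods y x p = alt_prods x y p"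
  by (auto simp: alt_prods_def)

lemma involution_mult_alt_prods:
  assumes xy: "x \<in> carrier G" "y \<in> carrier G" "x \<otimes> x = \<one>" and p: "p \<ge> 1"
    and braid: "alt_prod x y p = alt_prod y x p" and g: "g \<in> alt_prods x y p"
  shows "x \<otimes> g \<in> alt_prods x y p"
proof -
  have cancel: "x \<otimes> (x \<otimes> z) = z" if "z \<in> carrier G" for z
    using xy that by (simp flip: m_assoc)
  obtain j where j: "j \<le> p" "g = alt_prod x y j \<or> g = alt_prod y x j"
    using g by (auto simp: alt_prods_def)
  consider k where "Suc k \<le> p" "g = alt_prod x y (Suc k)" | k where "Suc k \<le> p" "g = alt_prod y x k"
  proof (cases "j = p")
    case True
    then have "g = alt_prod x y p" using j braid by auto
    then show ?thesis using that(1)[of "p - 1"] p by simp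
  next
    case False
    then have "Suc j \<le> p" using j(1) by simp
    show ?thesis
    proof (cases "g = alt_prod y x j")
      case True
      then show ?thesis using that(2) \<open>Suc j \<le> p\<close> by blast
    next
      case False
      then have g: "g = alt_prod x y j" using j(2) by blast
      then obtain k where "j = Suc k" using False by (cases j) auto
      then show ?thesis using that(1)[of k] g j(1) by simp
    qed
  qed
  then show ?thesis
  proof cases
    case (1 k)
    then have "x \<otimes> g = alt_prod y x k" using xy cancel by simp
    then show ?thesis using 1 by (auto simp: alt_prods_def)
  next
    case (2 k)
    then have "x \<otimes> g = alt_prod x y (Suc k)" by simp
    then show ?thesis using 2 unfolding alt_prods_def by blast
  qed
qed

lemma finite_generate_two_involutions:
  assumes xy: "x \<in> carrier G" "y \<in> carrier G" "x \<otimes> x = \<one>" "y \<otimes> y = \<one>" and p: "p \<ge> 1"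
    and braid: "alt_prod x y p = alt_prod y x p"
  shows "finite (generate G {x, y})"
proof -
  have carrier: "alt_prods x y p \<subseteq> carrier G" using xy by (auto simp: alt_prods_def)
  have letter: "h \<otimes> f \<in> alt_prods x y p" if "h \<in> {x, y}" "f \<in> alt_prods x y p" for h f
    using that involution_mult_alt_prods[OF xy(1-3) p braid]
      involution_mult_alt_prods[OF xy(2,1,4) p braid[symmetric]] by (auto simp: alt_prods_commute)
  have self_inv: "inv h = h" if "h \<in> {x, y}" for h using xy that by (auto intro: inv_equality)
  have closed: "g \<otimes> f \<in> alt_prods x y p" if "g \<in> generate G {x, y}" "f \<in> alt_prods x y p" for g f
    using that
  proof (induction arbitrary: f rule: generate.induct)
    case one
    then show ?case using carrier by auto
  next
    case (incl h)
    then show ?case by (rule letter)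
  next
    case (inv h)
    then show ?case using letter unfolding self_inv[OF inv.hyps] by blast
  next
    case (eng h1 h2)
    have "h1 \<in> carrier G" "h2 \<in> carrier G" using generate_in_carrier[of "{x, y}"] xy eng by auto
    then have "h1 \<otimes> h2 \<otimes> f = h1 \<otimes> (h2 \<otimes> f)" using eng carrier by (auto simp: m_assoc)
    then show ?case using eng by simp
  qed
  have "alt_prod x y 0 \<in> alt_prods x y p" unfolding alt_prods_def by blast
  then have "g \<in> alt_prods x y p" if "g \<in> generate G {x, y}" for g
    using closed[OF that, of \<one>] generate_in_carrier[OF _ that] xy by simp
  then have "generate G {x, y} \<subseteq> alt_prods x y p" by blast
  then show ?thesis by (rule finite_subset) (simp add: alt_prods_def)
qed

lemma normal_closure_normal:
  assumes "S \<subseteq> carrier G"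
  shows "normal_closure G S \<lhd> G"
proof -
  have "carrier G \<lhd> G" using normal_inv_iff subgroup_self by auto
  then have "subgroup (\<Inter>{N. N \<lhd> G \<and> S \<subseteq> N}) G"
    using assms by (intro subgroups_Inter) (auto simp: normal_inv_iff)
  then show ?thesis unfolding normal_closure_def by (auto simp: normal_inv_iff)
qed

end

lemma triangle_free_complete_graph_cases:
  assumes "triangle_free E" and complete: "\<And>x y. x \<in> V \<Longrightarrow> y \<in> V \<Longrightarrow> x \<noteq> y \<Longrightarrow> {x, y} \<in> E"
  obtains "V = {}" | a where "V = {a}" | a b where "V = {a, b}" "a \<noteq> b"
proof (cases "\<exists>a b. a \<in> V \<and> b \<in> V \<and> a \<noteq> b")
  case True
  then obtain a b where ab: "a \<in> V" "b \<in> V" "a \<noteq> b" by blast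
  have "V \<subseteq> {a, b}"
  proof
    fix c assume "c \<in> V"
    show "c \<in> {a, b}"
    proof (rule ccontr)
      assume "c \<notin> {a, b}"
      then have "distinct [a, b, c] \<and> {a, b} \<in> E \<and> {b, c} \<in> E \<and> {a, c} \<in> E"
        using ab \<open>c \<in> V\<close> complete by auto
      then show False using assms(1) unfolding triangle_free_def by blast
    qed
  qed
  then have "V = {a, b}" using ab by blast
  then show ?thesis using that(3) ab(3) by blast
next
  case False
  then show ?thesis using that(1,2) by blast
qed

lemma artin_gen_braid:
  assumes "{a, b} \<in> E" "a \<in> V" "b \<in> V"
  shows "group.alt_prod (artin_group V E lab) (artin_gen V E lab a) (artin_gen V E lab b) (lab {a, b})
    = group.alt_prod (artin_group V E lab) (artin_gen V E lab b) (artin_gen V E lab a) (lab {a, b})"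
proof -
  let ?A = "artin_group V E lab" and ?R = "artin_relations E lab"
  let ?u = "alternating_word a b (lab {a, b})" and ?v = "alternating_word b a (lab {a, b})"
  interpret A: group ?A by (rule group_artin_group)
  have words: "?u \<in> gwords V" "?v \<in> gwords V"
    using alternating_word_gwords[of a b] alternating_word_gwords[of b a] gwords_mono[of "{a, b}" V]
      assms(2,3)
    by (auto simp: insert_commute)
  have "(?u, ?v) \<in> ?R" using assms(1) by (auto simp: artin_relations_def)
  then have "pres_class V ?R ?u = pres_class V ?R ?v"
    using words by (simp add: pres_class_eq_iff pres_cong.relation)
  then have "gword_eval ?A (artin_gen V E lab) ?u = gword_eval ?A (artin_gen V E lab) ?v"
    using words gword_eval_pres_class[of _ V V ?R] by (simp add: artin_group_def artin_gen_def[abs_def])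
  then show ?thesis by (simp add: A.gword_eval_alternating_word)
qed

lemma (in group_hom) alt_prod_hom:
  "x \<in> carrier G \<Longrightarrow> y \<in> carrier G \<Longrightarrow> h (G.alt_prod x y k) = H.alt_prod (h x) (h y) k"
  by (induction k arbitrary: x y) auto

lemma coxeter_group_generated_by_involutions:
  obtains r where "group_hom (artin_group V E lab) (coxeter_group V E lab) r"
    "generate (coxeter_group V E lab) (r ` artin_gen V E lab ` V) = carrier (coxeter_group V E lab)"
    "\<forall>s\<in>V. r (artin_gen V E lab s) \<otimes>\<^bsub>coxeter_group V E lab\<^esub> r (artin_gen V E lab s)
      = \<one>\<^bsub>coxeter_group V E lab\<^esub>"
proof -
  let ?A = "artin_group V E lab" and ?gen = "artin_gen V E lab"
  define N where "N = normal_closure ?A {?gen s [^]\<^bsub>?A\<^esub> (2::nat) | s. s \<in> V}"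
  interpret A: group ?A by (rule group_artin_group)
  have gen: "?gen s \<in> carrier ?A" if "s \<in> V" for s
    using that by (simp add: artin_gen_def artin_group_def)
  interpret N: normal N ?A unfolding N_def using gen by (intro A.normal_closure_normal) auto
  define r where "r g = N #>\<^bsub>?A\<^esub> g" for g
  interpret r: group_hom ?A "?A Mod N" r
    unfolding r_def
    by (intro group_hom.intro group_hom_axioms.intro A.group_axioms N.factorgroup_is_group
      N.r_coset_hom_Mod)
  have "generate (?A Mod N) (r ` ?gen ` V) = r ` carrier ?A"
    using r.generate_img[of "?gen ` V"] generates_artin_gens[of V E lab] by (simp add: generates_def)
  also have "\<dots> = carrier (?A Mod N)" by (auto simp: r_def FactGroup_def RCOSETS_def)
  finally have generated: "generate (?A Mod N) (r ` ?gen ` V) = carrier (?A Mod N)" .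
  have "r (?gen s) \<otimes>\<^bsub>?A Mod N\<^esub> r (?gen s) = \<one>\<^bsub>?A Mod N\<^esub>" if s: "s \<in> V" for s
  proof -
    have "?gen s [^]\<^bsub>?A\<^esub> (2::nat) \<in> N" using s by (auto simp: N_def normal_closure_def)
    then have "r (?gen s [^]\<^bsub>?A\<^esub> (2::nat)) = N"
      using gen[OF s] by (simp add: r_def A.coset_join2 N.subgroup_axioms)
    then show ?thesis using gen[OF s] by (simp add: numeral_2_eq_2 FactGroup_def)
  qed
  then show ?thesis
    using that r.group_hom_axioms generated unfolding coxeter_group_def N_def by blast
qed

lemma complete_graph_spherical:
  assumes graph: "presentation_graph V E lab" "triangle_free E"
    and complete: "\<And>x y. x \<in> V \<Longrightarrow> y \<in> V \<Longrightarrow> x \<noteq> y \<Longrightarrow> {x, y} \<in> E"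
  shows "spherical_type V E lab"
proof -
  let ?W = "coxeter_group V E lab" and ?gen = "artin_gen V E lab"
  obtain r where "group_hom (artin_group V E lab) ?W r"
    and generated: "generate ?W (r ` ?gen ` V) = carrier ?W"
    and involution: "\<forall>s\<in>V. r (?gen s) \<otimes>\<^bsub>?W\<^esub> r (?gen s) = \<one>\<^bsub>?W\<^esub>"
    using coxeter_group_generated_by_involutions .
  then interpret r: group_hom "artin_group V E lab" ?W r by simp
  have gen: "?gen s \<in> carrier (artin_group V E lab)" if "s \<in> V" for s
    using that by (simp add: artin_gen_def artin_group_def)
  consider "V = {}" | a where "V = {a}" | a b where "V = {a, b}" "a \<noteq> b"
    using triangle_free_complete_graph_cases[OF graph(2) complete] by blast
  then have "finite (generate ?W (r ` ?gen ` V))"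
  proof cases
    case 1
    then show ?thesis using r.H.generate_empty by simp
  next
    case (2 a)
    then have a: "r (?gen a) \<in> carrier ?W" "r (?gen a) \<otimes>\<^bsub>?W\<^esub> r (?gen a) = \<one>\<^bsub>?W\<^esub>"
      using r.hom_closed[OF gen] involution by blast+
    show ?thesis
      using r.H.finite_generate_two_involutions[OF a(1) a(1) a(2) a(2), of 1] by (simp add: 2)
  next
    case (3 a b)
    then have edge: "{a, b} \<in> E" and ab: "a \<in> V" "b \<in> V" using complete by auto
    then have "lab {a, b} \<ge> 1" using graph(1) by (auto simp: presentation_graph_def)
    moreover have "r.H.alt_prod (r (?gen a)) (r (?gen b)) (lab {a, b})
        = r.H.alt_prod (r (?gen b)) (r (?gen a)) (lab {a, b})"
      unfolding r.alt_prod_hom[OF gen[OF ab(1)] gen[OF ab(2)], symmetric]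
        r.alt_prod_hom[OF gen[OF ab(2)] gen[OF ab(1)], symmetric]
      by (rule arg_cong[OF artin_gen_braid[OF edge ab]])
    ultimately have "finite (generate ?W {r (?gen a), r (?gen b)})"
      by (intro r.H.finite_generate_two_involutions r.hom_closed gen bspec[OF involution] ab)
    then show ?thesis by (simp add: 3(1))
  qed
  then show ?thesis unfolding generated spherical_type_def .
qed

subsection \<open>Generating pairs of free groups\<close>

definition free_group_map :: "('a \<Rightarrow> 'b) \<Rightarrow> 'b set \<Rightarrow> 'a gword set \<Rightarrow> 'b gword set" where
  "free_group_map f Y = presented_lift (free_group Y) (\<lambda>x. pres_class Y {} [(f x, True)])"

lemma group_free_group: "group (free_group X)"
  unfolding free_group_def by (rule group_presented_group)

lemma carrier_free_group: "carrier (free_group X) = pres_class X {} ` gwords X"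
  by (simp add: free_group_def carrier_presented)

lemma free_group_letters_closed:
  "f \<in> X \<rightarrow> Y \<Longrightarrow> (\<lambda>x. pres_class Y {} [(f x, True)]) \<in> X \<rightarrow> carrier (free_group Y)"
  by (fastforce simp: carrier_free_group gwords_iff)

lemma group_hom_free_group_map:
  assumes "f \<in> X \<rightarrow> Y"
  shows "group_hom (free_group X) (free_group Y) (free_group_map f Y)"
  using group.group_hom_presented_lift[OF group_free_group free_group_letters_closed[OF assms], of "{}"]
  by (simp add: free_group_map_def free_group_def)

lemma free_group_map_pres_class:
  assumes "f \<in> X \<rightarrow> Y" "w \<in> gwords X"
  shows "free_group_map f Y (pres_class X {} w) = pres_class Y {} (map (apfst f) w)"
proof -
  let ?letter = "\<lambda>x. pres_class Y {} [(f x, True)]"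
  have "gword_eval (free_group Y) ?letter w = pres_class Y {} (map (apfst f) w)
      \<and> map (apfst f) w \<in> gwords Y"
    using assms(2)
  proof (induction w)
    case Nil
    then show ?case by (simp add: free_group_def one_presented)
  next
    case (Cons a w)
    obtain x b where a: "a = (x, b)" by force
    then have closed: "f x \<in> Y" "w \<in> gwords X" using Cons.prems assms(1) by auto
    with Cons.IH have IH: "gword_eval (free_group Y) ?letter w = pres_class Y {} (map (apfst f) w)"
      "map (apfst f) w \<in> gwords Y" by auto
    have "pres_class Y {} [(f x, b)] \<otimes>\<^bsub>free_group Y\<^esub> pres_class Y {} (map (apfst f) w)
        = pres_class Y {} ((f x, b) # map (apfst f) w)"
      using closed(1) IH(2) by (simp add: free_group_def presented_group_mult)
    then show ?case
      using IH closed a by (cases b) (simp_all add: free_group_def inv_pres_class gword_inv_Cons)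
  qed
  then show ?thesis
    using group.presented_lift_pres_class[OF group_free_group
        free_group_letters_closed[OF assms(1)] _ assms(2), of "{}"]
    by (simp add: free_group_map_def)
qed

lemma free_group_map_inverse:
  assumes "f \<in> X \<rightarrow> Y" "g \<in> Y \<rightarrow> X" "\<And>x. x \<in> X \<Longrightarrow> g (f x) = x" "a \<in> carrier (free_group X)"
  shows "free_group_map g X (free_group_map f Y a) = a"
proof -
  obtain w where w: "w \<in> gwords X" "a = pres_class X {} w" using assms(4)
    by (auto simp: carrier_free_group)
  have "map (apfst f) w \<in> gwords Y" "map (apfst g \<circ> apfst f) w = w"
    using w(1) assms(1,3) by (fastforce simp: gwords_iff intro!: map_idI)+
  then show ?thesis using w assms(1,2) by (simp add: free_group_map_pres_class)
qed

lemma free_group_iso_if_bij_betw: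
  assumes f: "bij_betw f X Y"
  shows "free_group X \<cong> free_group Y"
proof -
  define g where "g = inv_into X f"
  have maps: "f \<in> X \<rightarrow> Y" "g \<in> Y \<rightarrow> X"
    using bij_betw_imp_funcset[OF f] bij_betw_imp_funcset[OF bij_betw_inv_into[OF f]]
    by (simp_all add: g_def)
  have inverse: "\<And>x. x \<in> X \<Longrightarrow> g (f x) = x" "\<And>y. y \<in> Y \<Longrightarrow> f (g y) = y"
    using f by (simp_all add: g_def bij_betw_inv_into_left bij_betw_inv_into_right)
  interpret f: group_hom "free_group X" "free_group Y" "free_group_map f Y"
    by (rule group_hom_free_group_map[OF maps(1)])
  interpret g: group_hom "free_group Y" "free_group X" "free_group_map g X"
    by (rule group_hom_free_group_map[OF maps(2)])
  have "bij_betw (free_group_map f Y) (carrier (free_group X)) (carrier (free_group Y))"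
    using free_group_map_inverse[OF maps inverse(1)] free_group_map_inverse[OF maps(2,1) inverse(2)]
    by (intro bij_betw_byWitness[of _ "free_group_map g X"]) auto
  then have "free_group_map f Y \<in> iso (free_group X) (free_group Y)" using f.homh by (simp add: iso_def)
  then show ?thesis by (rule is_isoI)
qed

lemma hom_eq_on_generate:
  assumes "group_hom G H h" "group_hom G H k" "S \<subseteq> carrier G"
    and eq: "\<And>s. s \<in> S \<Longrightarrow> h s = k s" and x: "x \<in> generate G S"
  shows "h x = k x"
proof -
  interpret h: group_hom G H h by fact
  interpret k: group_hom G H k by fact
  show ?thesis using x
  proof (induction rule: generate.induct)
    case (eng h1 h2)
    then have "h1 \<in> carrier G" "h2 \<in> carrier G" using h.G.generate_in_carrier[OF assms(3)] by auto
    then show ?case using eng by simp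
  qed (use eq assms(3) in auto)
qed

text \<open>
  As in the proof that finitely generated residually finite groups are Hopfian: sending a
  homomorphism \<open>F\<^sub>2 \<rightarrow> \<Gamma>\<close> to its values on the pair is an injection of the finite set \<open>\<Gamma> \<times> \<Gamma>\<close> into
  itself, hence onto.
\<close>

lemma free_group_generating_pair_hom_exists:
  fixes \<Gamma> :: "('g, 'm) monoid_scheme"
  assumes \<Gamma>: "group \<Gamma>" "finite (carrier \<Gamma>)" "a \<in> carrier \<Gamma>" "b \<in> carrier \<Gamma>"
    and pair: "x \<in> carrier (free_group (UNIV :: bool set))"
      "y \<in> carrier (free_group (UNIV :: bool set))"
      "generate (free_group (UNIV :: bool set)) {x, y} = carrier (free_group (UNIV :: bool set))"
  obtains \<theta> where "group_hom (free_group (UNIV :: bool set)) \<Gamma> \<theta>" "\<theta> x = a" "\<theta> y = b"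
proof -
  let ?F = "free_group (UNIV :: bool set)" and ?\<Gamma>\<Gamma> = "carrier \<Gamma> \<times> carrier \<Gamma>"
  define lift where "lift g = presented_lift \<Gamma> (\<lambda>b. if b then fst g else snd g)" for g :: "'g \<times> 'g"
  have letters: "(\<lambda>b. if b then fst g else snd g) \<in> UNIV \<rightarrow> carrier \<Gamma>" if "g \<in> ?\<Gamma>\<Gamma>" for g
    using that by auto
  have lift_hom: "group_hom ?F \<Gamma> (lift g)" if "g \<in> ?\<Gamma>\<Gamma>" for g
    using group.group_hom_presented_lift[OF \<Gamma>(1) letters[OF that], of "{}"]
    by (simp add: lift_def free_group_def)
  have lift_letter: "lift g (pres_class UNIV {} [(b, True)]) = (if b then fst g else snd g)"
    if g: "g \<in> ?\<Gamma>\<Gamma>" for g b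
    using group.presented_lift_pres_class[OF \<Gamma>(1) letters[OF g], of "{}" "[(b, True)]"] g
      monoid.r_one[OF group.is_monoid[OF \<Gamma>(1)]]
    by (auto simp: lift_def)
  define eval_pair where "eval_pair g = (lift g x, lift g y)" for g
  have "inj_on eval_pair ?\<Gamma>\<Gamma>"
  proof (rule inj_onI)
    fix g g' assume g: "g \<in> ?\<Gamma>\<Gamma>" "g' \<in> ?\<Gamma>\<Gamma>" and eq: "eval_pair g = eval_pair g'"
    have "lift g z = lift g' z" if "z \<in> carrier ?F" for z
      by (rule hom_eq_on_generate[OF lift_hom[OF g(1)] lift_hom[OF g(2)], of "{x, y}"])
        (use eq pair that in \<open>auto simp: eval_pair_def\<close>)
    then have "(if b then fst g else snd g) = (if b then fst g' else snd g')" for b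
      using lift_letter[OF g(1), of b] lift_letter[OF g(2), of b]
      by (simp add: carrier_free_group gwords_iff)
    from this[of True] this[of False] show "g = g'" by (simp add: prod_eq_iff)
  qed
  moreover have "eval_pair ` ?\<Gamma>\<Gamma> \<subseteq> ?\<Gamma>\<Gamma>"
    using group_hom.hom_closed[OF lift_hom] pair(1,2) by (auto simp: eval_pair_def)
  ultimately have "eval_pair ` ?\<Gamma>\<Gamma> = ?\<Gamma>\<Gamma>" using \<Gamma>(2) by (intro endo_inj_surj) auto
  then have "(a, b) \<in> eval_pair ` ?\<Gamma>\<Gamma>" using \<Gamma>(3,4) by simp
  then obtain g where g: "g \<in> ?\<Gamma>\<Gamma>" "eval_pair g = (a, b)" by auto
  show ?thesis by (rule that[OF lift_hom[OF g(1)]]) (use g(2) in \<open>simp_all add: eval_pair_def\<close>)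
qed

definition positive_prod :: "('g, 'm) monoid_scheme \<Rightarrow> 'g \<Rightarrow> 'g \<Rightarrow> bool list \<Rightarrow> 'g" where
  "positive_prod G x y u = foldr (\<lambda>b z. (if b then x else y) \<otimes>\<^bsub>G\<^esub> z) u \<one>\<^bsub>G\<^esub>"

lemma positive_prod_Nil [simp]: "positive_prod G x y [] = \<one>\<^bsub>G\<^esub>"
  and positive_prod_Cons [simp]:
    "positive_prod G x y (b # u) = (if b then x else y) \<otimes>\<^bsub>G\<^esub> positive_prod G x y u"
  by (simp_all add: positive_prod_def)

lemma (in monoid) positive_prod_closed [simp]:
  "x \<in> carrier G \<Longrightarrow> y \<in> carrier G \<Longrightarrow> positive_prod G x y u \<in> carrier G"
  by (induction u) auto

lemma (in group_hom) positive_prod_hom: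
  "x \<in> carrier G \<Longrightarrow> y \<in> carrier G \<Longrightarrow> h (positive_prod G x y u) = positive_prod H (h x) (h y) u"
  by (induction u) auto

lemma positive_prod_subgroup_generated [simp]:
  "positive_prod (subgroup_generated G S) x y = positive_prod G x y"
  by (simp add: positive_prod_def fun_eq_iff)

lemma finite_carrier_BijGroup:
  assumes "finite L"
  shows "finite (carrier (BijGroup L))"
proof (rule finite_subset)
  show "carrier (BijGroup L) \<subseteq> L \<rightarrow>\<^sub>E L"
    using Bij_imp_funcset Bij_imp_extensional by (auto simp: BijGroup_def PiE_def)
qed (use assms in \<open>simp add: finite_PiE\<close>)

lemma prepend_permutation_exists:
  fixes b :: bool
  defines "L n \<equiv> {l :: bool list. length l \<le> n}"
  obtains \<sigma> where "\<sigma> \<in> Bij (L n)" "\<And>l. length l < n \<Longrightarrow> \<sigma> l = b # l"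
proof -
  define A where "A = {l :: bool list. length l < n}"
  have fin: "finite (L n)" using finite_lists_length_le[of "UNIV :: bool set" n] by (simp add: L_def)
  have A: "A \<subseteq> L n" "(#) b ` A \<subseteq> L n" by (auto simp: A_def L_def)
  have inj: "inj_on ((#) b) A" by (auto simp: inj_on_def)
  have "card (L n - A) = card (L n - (#) b ` A)"
    using A fin card_image[OF inj] by (simp add: card_Diff_subset finite_subset[OF _ fin])
  then obtain g where g: "bij_betw g (L n - A) (L n - (#) b ` A)"
    using finite_same_card_bij fin by (metis finite_Diff)
  define \<sigma> where "\<sigma> = (\<lambda>l\<in>L n. if l \<in> A then b # l else g l)"
  have "bij_betw \<sigma> A ((#) b ` A)"
    using A by (intro bij_betw_cong[THEN iffD1, OF _ inj_on_imp_bij_betw[OF inj]]) (auto simp: \<sigma>_def)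
  moreover have "bij_betw \<sigma> (L n - A) (L n - (#) b ` A)"
    by (rule bij_betw_cong[THEN iffD1, OF _ g]) (auto simp: \<sigma>_def)
  ultimately have "bij_betw \<sigma> (A \<union> (L n - A)) ((#) b ` A \<union> (L n - (#) b ` A))"
    by (rule bij_betw_combine) auto
  moreover have "A \<union> (L n - A) = L n" "(#) b ` A \<union> (L n - (#) b ` A) = L n" using A by auto
  ultimately have "\<sigma> \<in> Bij (L n)" by (simp add: Bij_def \<sigma>_def)
  moreover have "\<sigma> l = b # l" if "length l < n" for l using that by (simp add: \<sigma>_def A_def L_def)
  ultimately show ?thesis using that by blast
qed

lemma positive_prod_separated_by_finite_group:
  fixes n :: nat
  obtains \<Gamma> :: "(bool list \<Rightarrow> bool list) monoid" and \<sigma> \<tau>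
  where "group \<Gamma>" "finite (carrier \<Gamma>)" "\<sigma> \<in> carrier \<Gamma>" "\<tau> \<in> carrier \<Gamma>"
    "inj_on (positive_prod \<Gamma> \<sigma> \<tau>) {u. length u \<le> n}"
proof -
  define L where "L = {l :: bool list. length l \<le> n}"
  define \<Gamma> where "\<Gamma> = BijGroup L"
  interpret \<Gamma>: group \<Gamma> unfolding \<Gamma>_def by (rule group_BijGroup)
  obtain \<sigma> where \<sigma>: "\<sigma> \<in> Bij L" "\<And>l. length l < n \<Longrightarrow> \<sigma> l = True # l"
    using prepend_permutation_exists[of n True] unfolding L_def by metis
  obtain \<tau> where \<tau>: "\<tau> \<in> Bij L" "\<And>l. length l < n \<Longrightarrow> \<tau> l = False # l"
    using prepend_permutation_exists[of n False] unfolding L_def by metis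
  have \<Gamma>_simps: "carrier \<Gamma> = Bij L" "\<one>\<^bsub>\<Gamma>\<^esub> [] = []"
    "\<And>f g. f \<in> Bij L \<Longrightarrow> g \<in> Bij L \<Longrightarrow> (f \<otimes>\<^bsub>\<Gamma>\<^esub> g) [] = f (g [])"
    by (simp_all add: \<Gamma>_def BijGroup_def compose_def L_def)
  have closed: "\<sigma> \<in> carrier \<Gamma>" "\<tau> \<in> carrier \<Gamma>" using \<sigma>(1) \<tau>(1) by (simp_all add: \<Gamma>_simps(1))
  have "positive_prod \<Gamma> \<sigma> \<tau> u [] = u" if "length u \<le> n" for u
    using that
  proof (induction u)
    case Nil
    then show ?case by (simp add: \<Gamma>_simps(2))
  next
    case (Cons b u)
    have "positive_prod \<Gamma> \<sigma> \<tau> u \<in> Bij L"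
      using \<Gamma>.positive_prod_closed[OF closed, of u] unfolding \<Gamma>_simps(1) .
    then have "positive_prod \<Gamma> \<sigma> \<tau> (b # u) [] = (if b then \<sigma> else \<tau>) u"
      using Cons \<sigma>(1) \<tau>(1) by (simp add: \<Gamma>_simps(3))
    then show ?case using Cons.prems \<sigma>(2)[of u] \<tau>(2)[of u] by simp
  qed
  then have "inj_on (positive_prod \<Gamma> \<sigma> \<tau>) {u. length u \<le> n}"
    by (intro inj_on_inverseI[of _ "\<lambda>g. g []"]) simp
  moreover have "finite (carrier \<Gamma>)"
    unfolding \<Gamma>_def L_def using finite_lists_length_le[of "UNIV :: bool set" n]
    by (intro finite_carrier_BijGroup) simp
  ultimately show ?thesis using that \<Gamma>.group_axioms closed by blast
qed

lemma free_generating_pair_positive_prod_inj: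
  assumes "group H" "x \<in> carrier H" "y \<in> carrier H" "generate H {x, y} = carrier H"
    and "H \<cong> free_group (UNIV :: bool set)"
  shows "inj (positive_prod H x y)"
proof (rule injI)
  let ?F = "free_group (UNIV :: bool set)"
  fix u v assume eq: "positive_prod H x y u = positive_prod H x y v"
  obtain \<phi> where \<phi>: "\<phi> \<in> iso H ?F" using assms(5) by (auto simp: is_iso_def)
  interpret \<phi>: group_hom H ?F \<phi>
    using \<phi> assms(1) group_free_group by (simp add: group_hom_def group_hom_axioms_def iso_def)
  have pair: "\<phi> x \<in> carrier ?F" "\<phi> y \<in> carrier ?F" "generate ?F {\<phi> x, \<phi> y} = carrier ?F"
    using \<phi>.generate_img[of "{x, y}"] assms(2-4) \<phi> by (auto simp: iso_def bij_betw_def)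
  obtain \<Gamma> :: "(bool list \<Rightarrow> bool list) monoid" and \<sigma> \<tau>
    where \<Gamma>: "group \<Gamma>" "finite (carrier \<Gamma>)" "\<sigma> \<in> carrier \<Gamma>" "\<tau> \<in> carrier \<Gamma>"
      and inj: "inj_on (positive_prod \<Gamma> \<sigma> \<tau>) {w. length w \<le> max (length u) (length v)}"
    using positive_prod_separated_by_finite_group .
  obtain \<theta> where \<theta>: "group_hom ?F \<Gamma> \<theta>" "\<theta> (\<phi> x) = \<sigma>" "\<theta> (\<phi> y) = \<tau>"
    using free_group_generating_pair_hom_exists[OF \<Gamma> pair] .
  have "\<theta> (\<phi> (positive_prod H x y w)) = positive_prod \<Gamma> \<sigma> \<tau> w" for w
    using \<phi>.positive_prod_hom[OF assms(2,3)] group_hom.positive_prod_hom[OF \<theta>(1) pair(1,2)] \<theta>(2,3)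
    by simp
  then have "positive_prod \<Gamma> \<sigma> \<tau> u = positive_prod \<Gamma> \<sigma> \<tau> v" using eq by metis
  then show "u = v" using inj_onD[OF inj] by simp
qed

lemma is_free_group_if_free_generating_pair:
  assumes "subgroup_generated G {x, y} \<cong> free_group (UNIV :: bool set)" "x \<noteq> y"
  shows "is_free_group (subgroup_generated G {x, y})"
proof -
  have "bij_betw (\<lambda>b. if b then x else y) UNIV {x, y}"
    using assms(2) by (auto simp: bij_betw_def inj_def UNIV_bool split: if_splits)
  then show ?thesis
    unfolding is_free_group_def using iso_trans[OF assms(1) free_group_iso_if_bij_betw] by blast
qed

subsection \<open>Growth\<close>

context group
begin

lemma not_comm_group_subgroup_generated:
  assumes "x \<in> S" "y \<in> S" "S \<subseteq> carrier G" "x \<otimes> y \<noteq> y \<otimes> x"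
  shows "\<not> comm_group (subgroup_generated G S)"
proof
  assume "comm_group (subgroup_generated G S)"
  then interpret H: comm_group "subgroup_generated G S" .
  have "x \<in> carrier (subgroup_generated G S)" "y \<in> carrier (subgroup_generated G S)"
    using assms(1-3) by (auto simp: carrier_subgroup_generated intro: generate.incl)
  from H.m_comm[OF this] show False using assms(4) by simp
qed

lemma generate_subgroup_generated:
  assumes "S \<subseteq> carrier G"
  shows "generate (subgroup_generated G S) S = carrier (subgroup_generated G S)"
proof -
  have "S \<subseteq> carrier (subgroup_generated G S)"
    using assms by (auto simp: carrier_subgroup_generated intro: generate.incl)
  then show ?thesis
    using arg_cong[OF subgroup_generated2[of S], of carrier]
      carrier_subgroup_generated[of "subgroup_generated G S" S]
    by (simp add: Int_absorb1)
qed

lemma funpow_mult_left: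
  assumes "s \<in> carrier G" "z \<in> carrier G"
  shows "((\<otimes>) s ^^ m) z = s [^] m \<otimes> z"
proof (induction m)
  case 0
  then show ?case using assms by simp
next
  case (Suc m)
  then show ?case using assms nat_pow_Suc2[of s m] by (simp add: m_assoc del: nat_pow_Suc)
qed

lemma positive_prod_pow_in_word_ball:
  assumes st: "s \<in> S" "t \<in> S" "S \<subseteq> carrier G" and length: "m * length u \<le> n"
  shows "positive_prod G (s [^] m) (t [^] m) u \<in> word_ball G S n"
proof -
  define expand where "expand u = concat (map (\<lambda>b. replicate m (if b then s else t)) u)" for u
  have letters: "set (expand u) \<subseteq> S" for u using st by (auto simp: expand_def split: if_splits)
  have "length (expand u) = m * length u" for u by (induction u) (auto simp: expand_def)
  then have "expand u \<in> {ws \<in> lists (S \<union> m_inv G ` S). length ws \<le> n}"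
    using letters[of u] length by (auto simp: lists_eq_set)
  moreover have "positive_prod G (s [^] m) (t [^] m) u = foldr (\<otimes>) (expand u) \<one>"
  proof (induction u)
    case Nil
    then show ?case by (simp add: expand_def)
  next
    case (Cons b u)
    have "expand (b # u) = replicate m (if b then s else t) @ expand u" by (simp add: expand_def)
    moreover have "foldr (\<otimes>) (expand u) \<one> \<in> carrier G"
      using st unfolding Cons.IH[symmetric] by (intro positive_prod_closed) auto
    moreover have "(if b then s else t) \<in> carrier G" using st by auto
    ultimately show ?case using Cons.IH by (simp add: funpow_mult_left)
  qed
  ultimately show ?thesis unfolding word_ball_def by (rule image_eqI[rotated])
qed

lemma card_word_ball_ge:
  assumes S: "finite S" "S \<subseteq> carrier G" and st: "s \<in> S" "t \<in> S"
    and inj: "inj (positive_prod G (s [^] (m :: nat)) (t [^] m))"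
  shows "2 ^ (n div m) \<le> card (word_ball G S n)"
proof -
  let ?words = "{u :: bool list. length u = n div m}" and ?prod = "positive_prod G (s [^] m) (t [^] m)"
  have "m * (n div m) \<le> n" by simp
  then have "?prod ` ?words \<subseteq> word_ball G S n"
    using positive_prod_pow_in_word_ball[OF st S(2)] by auto
  moreover have "finite (word_ball G S n)"
    unfolding word_ball_def using finite_lists_length_le[of "S \<union> m_inv G ` S" n] S(1)
    by (simp add: lists_eq_set)
  ultimately have "card (?prod ` ?words) \<le> card (word_ball G S n)" by (intro card_mono)
  moreover have "card (?prod ` ?words) = card ?words"
    by (rule card_image) (rule inj_on_subset[OF inj], simp)
  ultimately show ?thesis using card_lists_length_eq[of "UNIV :: bool set" "n div m"] by simp
qed

end

lemma exp_growth_rate_ge: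
  assumes m: "m \<ge> 1" and ball: "\<And>n. 2 ^ (n div m) \<le> card (word_ball G S n)"
  shows "ereal (2 powr (1 / (2 * real m))) \<le> exp_growth_rate G S"
proof -
  have "2 powr (1 / (2 * real m)) \<le> root n (real (card (word_ball G S n)))" if n: "n \<ge> m" for n
  proof -
    define d where "d = n div m"
    have n_pos: "n > 0" and "d \<ge> 1" using n m by (simp_all add: d_def div_greater_zero_iff Suc_le_eq)
    then have "m \<le> m * d" by (metis mult.right_neutral mult_le_mono2)
    moreover have "n < m + m * d" using dividend_less_times_div[of m n] m by (simp add: d_def)
    ultimately have "n \<le> 2 * (m * d)" by linarith
    then have "real n \<le> real (2 * (m * d))" by (rule of_nat_mono)
    then have "1 / (2 * real m) \<le> real d / real n" using n_pos m by (simp add: field_simps)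
    then have "2 powr (1 / (2 * real m)) \<le> 2 powr (real d / real n)" by simp
    also have "\<dots> = root n (2 ^ d)"
      using n_pos by (simp add: root_powr_inverse powr_powr flip: powr_realpow)
    also have "\<dots> \<le> root n (real (card (word_ball G S n)))"
      using ball[of n] n_pos by (simp add: d_def)
    finally show ?thesis .
  qed
  then have "\<forall>\<^sub>F n in sequentially.
      ereal (2 powr (1 / (2 * real m))) \<le> ereal (root n (real (card (word_ball G S n))))"
    by (auto simp: eventually_sequentially intro!: exI[of _ m])
  then show ?thesis unfolding exp_growth_rate_def by (intro le_Limsup) auto
qed

lemma (in group) exp_growth_rate_ge_if_free_powers:
  assumes S: "finite S" "S \<subseteq> carrier G" and st: "s \<in> S" "t \<in> S" and m: "m \<ge> 1"
    and free: "subgroup_generated G {s [^] (m :: nat), t [^] m} \<cong> free_group (UNIV :: bool set)"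
  shows "ereal (2 powr (1 / (2 * real m))) \<le> exp_growth_rate G S"
proof (rule exp_growth_rate_ge[OF m])
  let ?H = "subgroup_generated G {s [^] m, t [^] m}"
  have powers: "{s [^] m, t [^] m} \<subseteq> carrier G" using S(2) st by auto
  then have "s [^] m \<in> carrier ?H" "t [^] m \<in> carrier ?H"
    by (auto simp: carrier_subgroup_generated intro: generate.incl)
  then have "inj (positive_prod ?H (s [^] m) (t [^] m))"
    using free_generating_pair_positive_prod_inj[OF group_subgroup_generated]
      generate_subgroup_generated[OF powers] free by blast
  then show "2 ^ (n div m) \<le> card (word_ball G S n)" for n
    using card_word_ball_ge[OF S st] by simp
qed

lemma (in group) uniform_exponential_growth_if_free_powers:
  assumes T: "finite T" "generates G T" and m: "m \<ge> 1"
    and free: "\<And>S. generates G S \<Longrightarrow> \<exists>s\<in>S. \<exists>t\<in>S.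
      subgroup_generated G {s [^] (m :: nat), t [^] m} \<cong> free_group (UNIV :: bool set)"
  shows "uniform_exponential_growth G"
proof -
  have "1 < ereal (2 powr (1 / (2 * real m)))" using m by (simp add: one_ereal_def)
  also have "\<dots> \<le> (INF S\<in>{S. finite S \<and> generates G S}. exp_growth_rate G S)"
  proof (rule INF_greatest)
    fix S assume "S \<in> {S. finite S \<and> generates G S}"
    then have S: "finite S" "generates G S" by simp_all
    obtain s t where "s \<in> S" "t \<in> S"
      "subgroup_generated G {s [^] m, t [^] m} \<cong> free_group (UNIV :: bool set)"
      using free[OF S(2)] by blast
    then show "ereal (2 powr (1 / (2 * real m))) \<le> exp_growth_rate G S"
      using exp_growth_rate_ge_if_free_powers[OF S(1) _ _ _ m] S(2) by (simp add: generates_def)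
  qed
  finally show ?thesis using T by (auto simp: uniform_exponential_growth_def)
qed

theorem artin_free_noncommuting_powers:
  assumes graph: "presentation_graph V E lab" "triangle_free E" "two_two_free E lab"
    "\<not> spherical_type V E lab"
    and m: "uniform_power_exponent (artin_group V E lab) m"
    and S: "generates (artin_group V E lab) S"
  obtains s t where "s \<in> S" "t \<in> S"
    "s [^]\<^bsub>artin_group V E lab\<^esub> m \<otimes>\<^bsub>artin_group V E lab\<^esub> t [^]\<^bsub>artin_group V E lab\<^esub> m
      \<noteq> t [^]\<^bsub>artin_group V E lab\<^esub> m \<otimes>\<^bsub>artin_group V E lab\<^esub> s [^]\<^bsub>artin_group V E lab\<^esub> m"
    "subgroup_generated (artin_group V E lab) {s [^]\<^bsub>artin_group V E lab\<^esub> m, t [^]\<^bsub>artin_group V E lab\<^esub> m}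
      \<cong> free_group (UNIV :: bool set)"
proof -
  let ?A = "artin_group V E lab"
  have "m \<ge> 1" using m by (simp add: uniform_power_exponent_def)
  obtain a c where nonadjacent: "a \<in> V" "c \<in> V" "a \<noteq> c" "{a, c} \<notin> E"
    using complete_graph_spherical[OF graph(1,2)] graph(4) by blast
  obtain s t where st: "s \<in> S" "t \<in> S"
    "s [^]\<^bsub>?A\<^esub> m \<otimes>\<^bsub>?A\<^esub> t [^]\<^bsub>?A\<^esub> m \<noteq> t [^]\<^bsub>?A\<^esub> m \<otimes>\<^bsub>?A\<^esub> s [^]\<^bsub>?A\<^esub> m"
    using artin_noncommuting_powers[OF graph(1-3) nonadjacent S \<open>m \<ge> 1\<close>] .
  have "s \<in> carrier ?A" "t \<in> carrier ?A" using st S by (auto simp: generates_def)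
  then have "subgroup_generated ?A {s [^]\<^bsub>?A\<^esub> m, t [^]\<^bsub>?A\<^esub> m} \<cong> free_group (UNIV :: bool set)"
    using m st(3) unfolding uniform_power_exponent_def by blast
  then show ?thesis by (rule that[OF st])
qed

theorem corollary4:
  fixes V :: "'v set" and E :: "'v set set" and lab :: "'v set \<Rightarrow> nat" and m :: nat
  assumes "presentation_graph V E lab"
    and "triangle_free E"
    and "two_two_free E lab"
    and "\<not> spherical_type V E lab"
    and "m \<ge> 1"
    and "uniform_power_exponent (artin_group V E lab) m"
  shows "(\<forall>S. generates (artin_group V E lab) S \<longrightarrow>
           (\<exists>s\<in>S. \<exists>t\<in>S.
              is_free_group (subgroup_generated (artin_group V E lab)
                {s [^]\<^bsub>artin_group V E lab\<^esub> m, t [^]\<^bsub>artin_group V E lab\<^esub> m}) \<and>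
              \<not> comm_group (subgroup_generated (artin_group V E lab)
                {s [^]\<^bsub>artin_group V E lab\<^esub> m, t [^]\<^bsub>artin_group V E lab\<^esub> m})))
         \<and> uniform_exponential_growth (artin_group V E lab)"
proof (intro conjI allI impI)
  let ?A = "artin_group V E lab"
  interpret A: group ?A by (rule group_artin_group)
  note free_powers = artin_free_noncommuting_powers[OF assms(1-4,6)]
  show "\<exists>s\<in>S. \<exists>t\<in>S. is_free_group (subgroup_generated ?A {s [^]\<^bsub>?A\<^esub> m, t [^]\<^bsub>?A\<^esub> m}) \<and>
      \<not> comm_group (subgroup_generated ?A {s [^]\<^bsub>?A\<^esub> m, t [^]\<^bsub>?A\<^esub> m})" if S: "generates ?A S" for S
  proof -
    obtain s t where st: "s \<in> S" "t \<in> S"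
      "s [^]\<^bsub>?A\<^esub> m \<otimes>\<^bsub>?A\<^esub> t [^]\<^bsub>?A\<^esub> m \<noteq> t [^]\<^bsub>?A\<^esub> m \<otimes>\<^bsub>?A\<^esub> s [^]\<^bsub>?A\<^esub> m"
      "subgroup_generated ?A {s [^]\<^bsub>?A\<^esub> m, t [^]\<^bsub>?A\<^esub> m} \<cong> free_group (UNIV :: bool set)"
      using free_powers[OF S] .
    have "{s [^]\<^bsub>?A\<^esub> m, t [^]\<^bsub>?A\<^esub> m} \<subseteq> carrier ?A" using st(1,2) S by (auto simp: generates_def)
    then have "\<not> comm_group (subgroup_generated ?A {s [^]\<^bsub>?A\<^esub> m, t [^]\<^bsub>?A\<^esub> m})"
      by (rule A.not_comm_group_subgroup_generated[OF insertI1 insertI2[OF singletonI] _ st(3)])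
    moreover have "is_free_group (subgroup_generated ?A {s [^]\<^bsub>?A\<^esub> m, t [^]\<^bsub>?A\<^esub> m})"
      by (rule is_free_group_if_free_generating_pair[OF st(4)]) (use st(3) in metis)
    ultimately show ?thesis using st(1,2) by blast
  qed
  have "finite (artin_gen V E lab ` V)" using assms(1) by (simp add: presentation_graph_def)
  then show "uniform_exponential_growth ?A"
    using A.uniform_exponential_growth_if_free_powers[OF _ generates_artin_gens assms(5)] free_powers
    by metis
qed

end
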